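(* Let $\kappa\in L^1(\mathbb{R}^N\setminus\Omega)\cap L^\infty(\mathbb{R}^N\setminus\Omega)$ be non-negative, $d\mu=\kappa\,dx$, $Z_R:=L^2((0,T);L^2(\mathbb{R}^N\setminus\Omega,\mu))$, $\xi>0$, let $Z_{ad,R}\subset Z_R$ be closed and convex, let $\mathcal{Z}\subset Z_R$ be open with $Z_{ad,R}\subset\mathcal{Z}$, and let $J:L^2((0,T);L^2(\Omega))\to\mathbb{R}$ be weakly lower-semicontinuous. Let $u\mapsto J(u):L^2((0,T);L^2(\Omega))\to\mathbb{R}$ be continuously Fréchet differentiable with $J'(u)\in L^2((0,T);L^2(\Omega))$. If $\bar z$ is a minimizer over $Z_{ad,R}$ of $$\mathcal{J}(z):=J(Sz)+\frac{\xi}{2}\|z\|^2_{Z_R},$$ then, with $\bar u:=S\bar z$, the first order necessary optimality conditions are given by $$\int_\Sigma(\bar p+\xi\bar z)(z-\bar z)\,d\mu dt\ge0\qquad\forall z\in Z_{ad,R},\qquad(\ast)$$ where $\bar p\in L^2((0,T);W^{s,2}_{\Omega,\kappa})\cap H^1((0,T);(W^{s,2}_{\Omega,\kappa})^\star)$ is the weak solution of the adjoint equation $$\begin{cases}-\partial_t\bar p+(-\Delta)^s\bar p=J'(\bar u)&\text{in }Q,\\ \mathcal{N}_s\bar p+\kappa\bar p=0&\text{in }\Sigma,\\ \bar p(T,\cdot)=0&\text{in }\Omega.\end{cases}$$ Moreover, $(\ast)$ is equivalent to $$\bar z=\mathcal{P}_{Z_{ad,R}}(-\xi^{-1}\bar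 p),$$ where $\mathcal{P}_{Z_{ad,R}}$ is the projection onto the set $Z_{ad,R}$. If $J$ is convex, then $(\ast)$ is sufficient (for $\bar z\in Z_{ad,R}$ to be a minimizer).
   Context: $N\ge 1$, $0<s<1$, $T>0$; $\Omega\subset\mathbb{R}^N$ is a bounded domain with Lipschitz continuous boundary; $Q:=(0,T)\times\Omega$, $\Sigma:=(0,T)\times(\mathbb{R}^N\setminus\Omega)$. $C_{N,s}:=\frac{s2^{2s}\Gamma(\frac{2s+N}{2})}{\pi^{N/2}\Gamma(1-s)}$; $(-\Delta)^s u(x)=C_{N,s}\,\mathrm{P.V.}\int_{\mathbb{R}^N}\frac{u(x)-u(y)}{|x-y|^{N+2s}}dy$; the nonlocal normal derivative is $\mathcal{N}_s u(x):=C_{N,s}\int_\Omega\frac{u(x)-u(y)}{|x-y|^{N+2s}}dy$ for $x\in\mathbb{R}^N\setminus\overline\Omega$. Put $\mathbb{R}^{2N}\setminus(\mathbb{R}^N\setminus\Omega)^2:=(\Omega\times\Omega)\cup(\Omega\times(\mathbb{R}^N\setminus\Omega))\cup((\mathbb{R}^N\setminus\Omega)\times\Omega)$. $W^{s,2}_{\Omega,\kappa}$ is the Hilbert space of measurable $u:\mathbb{R}^N\to\mathbb{R}$ with finite norm $$\|u\|_{W^{s,2}_{\Omega,\kappa}}:=\left(\|u\|^2_{L^2(\Omega)}+\|u\|^2_{L^2(\mathbb{R}^N\setminus\Omega,\mu)}+\int\int_{\mathbb{R}^{2N}\setminus(\mathbb{R}^N\setminus\Omega)^2}\frac{|u(x)-u(y)|^2}{|x-y|^{N+2s}}dxdy\right)^{1/2},$$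 with dual $(W^{s,2}_{\Omega,\kappa})^\star$. $U_R:=L^2((0,T);W^{s,2}_{\Omega,\kappa})\cap H^1((0,T);(W^{s,2}_{\Omega,\kappa})^\star)$, where time derivatives are those of $u$ regarded as the element $v\mapsto\int_\Omega u(t,\cdot)v\,dx$ of the dual. $J'(u)$ is identified with an element of $L^2((0,T);L^2(\Omega))$ by Riesz representation. $\mathcal{E}(u,v):=\frac{C_{N,s}}{2}\int\int_{\mathbb{R}^{2N}\setminus(\mathbb{R}^N\setminus\Omega)^2}\frac{(u(x)-u(y))(v(x)-v(y))}{|x-y|^{N+2s}}dxdy+\int_{\mathbb{R}^N\setminus\Omega}\kappa uv\,dx$. State equation: $\partial_tu+(-\Delta)^su=0$ in $Q$, $\mathcal{N}_su+\kappa u=\kappa z$ in $\Sigma$, $u(0,\cdot)=0$ in $\Omega$; for $z\in Z_R$ its weak solution is the unique $u\in U_R$ with $u(0,\cdot)=0$ in $\Omega$ and $\langle\partial_tu,v\rangle+\mathcal{E}(u,v)=\int_{\mathbb{R}^N\setminus\Omega}zv\,d\mu$ for every $v\in W^{s,2}_{\Omega,\kappa}$ and a.e. $t\in(0,T)$. $S:Z_R\to L^2((0,T);L^2(\Omega))$, $Sz:=u$ (restricted to $Q$), is linear and continuous. The weak solution of the adjoint equation is $\bar p\in U_R$ with $\bar p(T,\cdot)=0$ in $\Omega$ and $\langle-\partial_t\bar p,v\rangle+\mathcal{E}(\bar p,v)=\int_\Omega J'(\bar u)v\,dx$ for every $v\in W^{s,2}_{\Omega,\kappa}$ and a.e. $t$.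 *)

theory Defs
  imports "HOL-Analysis.Analysis" "HOL-Library.Function_Algebras"
begin

text \<open>Functions form a real vector space under the pointwise operations.\<close>

instantiation "fun" :: (type, scaleR) scaleR
begin

definition scaleR_fun_def: "c *\<^sub>R f = (\<lambda>x. c *\<^sub>R f x)"

instance ..

end

instance "fun" :: (type, real_vector) real_vector
  by standard (auto simp: scaleR_fun_def fun_eq_iff plus_fun_def scaleR_add_right scaleR_add_left)


text \<open>
  A (semi)normed space is a set of elements of an ambient real vector space together with a
  seminorm on it. Elements of Lebesgue and Sobolev type spaces are represented by functions; two
  functions represent the same element iff the seminorm of their difference is 0.
\<close>

record 'v nspace =
  elems :: "'v set"
  nrm :: "'v \<Rightarrow> real"

definition same_in :: "'v::real_vector nspace \<Rightarrow> 'v \<Rightarrow> 'v \<Rightarrow> bool" where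
  "same_in X u v \<longleftrightarrow> u \<in> elems X \<and> v \<in> elems X \<and> nrm X (u - v) = 0"

definition closed_in :: "'v::real_vector nspace \<Rightarrow> 'v set \<Rightarrow> bool" where
  "closed_in X C \<longleftrightarrow> C \<subseteq> elems X \<and>
     (\<forall>u\<in>elems X. (\<forall>e>0. \<exists>c\<in>C. nrm X (u - c) < e) \<longrightarrow> u \<in> C)"

definition open_in :: "'v::real_vector nspace \<Rightarrow> 'v set \<Rightarrow> bool" where
  "open_in X U \<longleftrightarrow> U \<subseteq> elems X \<and>
     (\<forall>u\<in>U. \<exists>e>0. \<forall>v\<in>elems X. nrm X (v - u) < e \<longrightarrow> v \<in> U)"

text \<open>
  The metric projection; for a nonempty closed convex set of a Hilbert
  space the chosen point is unique up to \<open>same_in X\<close>.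
\<close>

definition proj_onto :: "'v::real_vector nspace \<Rightarrow> 'v set \<Rightarrow> 'v \<Rightarrow> 'v" where
  "proj_onto X C q = (SOME w. w \<in> C \<and> (\<forall>y\<in>C. nrm X (q - w) \<le> nrm X (q - y)))"

text \<open>Only the values of a functional on \<open>elems X\<close> are relevant.\<close>

definition dual :: "'v::real_vector nspace \<Rightarrow> ('v \<Rightarrow> real) nspace" where
  "dual X = \<lparr>
     elems = {l. (\<forall>u\<in>elems X. \<forall>v\<in>elems X. l (u + v) = l u + l v) \<and>
                 (\<forall>c. \<forall>u\<in>elems X. l (c *\<^sub>R u) = c * l u) \<and>
                 (\<exists>C. \<forall>u\<in>elems X. \<bar>l u\<bar> \<le> C * nrm X u)},
     nrm = (\<lambda>l. SUP u\<in>{u\<in>elems X. nrm X u \<le> 1}. \<bar>l u\<bar>) \<rparr>"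

definition weakly_converges :: "'v::real_vector nspace \<Rightarrow> (nat \<Rightarrow> 'v) \<Rightarrow> 'v \<Rightarrow> bool" where
  "weakly_converges X f u \<longleftrightarrow> (\<forall>n. f n \<in> elems X) \<and> u \<in> elems X \<and>
     (\<forall>l\<in>elems (dual X). (\<lambda>n. l (f n)) \<longlonglongrightarrow> l u)"

definition weakly_lsc :: "'v::real_vector nspace \<Rightarrow> ('v \<Rightarrow> real) \<Rightarrow> bool" where
  "weakly_lsc X J \<longleftrightarrow> (\<forall>f u. weakly_converges X f u \<longrightarrow>
     ereal (J u) \<le> liminf (\<lambda>n. ereal (J (f n))))"

definition frechet_deriv_at ::
    "'v::real_vector nspace \<Rightarrow> ('v \<Rightarrow> real) \<Rightarrow> ('v \<Rightarrow> real) \<Rightarrow> 'v \<Rightarrow> bool" where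
  "frechet_deriv_at X J l u \<longleftrightarrow> l \<in> elems (dual X) \<and>
     (\<forall>e>0. \<exists>d>0. \<forall>h\<in>elems X. nrm X h < d \<longrightarrow> \<bar>J (u + h) - J u - l h\<bar> \<le> e * nrm X h)"

definition continuously_frechet ::
    "'v::real_vector nspace \<Rightarrow> ('v \<Rightarrow> real) \<Rightarrow> ('v \<Rightarrow> 'v \<Rightarrow> real) \<Rightarrow> bool" where
  "continuously_frechet X J D \<longleftrightarrow>
     (\<forall>u\<in>elems X. frechet_deriv_at X J (D u) u) \<and>
     (\<forall>u\<in>elems X. \<forall>e>0. \<exists>d>0. \<forall>v\<in>elems X. nrm X (v - u) < d \<longrightarrow> nrm (dual X) (D v - D u) < e)"

definition L2 :: "'b measure \<Rightarrow> ('b \<Rightarrow> real) nspace" where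
  "L2 M = \<lparr>
     elems = {f \<in> borel_measurable M. integrable M (\<lambda>x. (f x)\<^sup>2)},
     nrm = (\<lambda>f. sqrt (LINT x|M. (f x)\<^sup>2)) \<rparr>"


text \<open>
  Bochner spaces with values in a seminormed space (the library's Bochner integral needs a normed
  type).
\<close>

definition simple_in :: "'b measure \<Rightarrow> 'v::real_vector nspace \<Rightarrow> ('b \<Rightarrow> 'v) \<Rightarrow> bool" where
  "simple_in M X s \<longleftrightarrow> simple_function M s \<and> s ` space M \<subseteq> elems X"

definition strongly_measurable :: "'b measure \<Rightarrow> 'v::real_vector nspace \<Rightarrow> ('b \<Rightarrow> 'v) \<Rightarrow> bool" where
  "strongly_measurable M X f \<longleftrightarrow> (AE t in M. f t \<in> elems X) \<and>
     (\<exists>s. (\<forall>n. simple_in M X (s n)) \<and> (AE t in M. (\<lambda>n. nrm X (f t - s n t)) \<longlonglongrightarrow> 0))"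

text \<open>Used for finite measures only, so simple functions need no finite support condition.\<close>

definition bochner_integral_in ::
    "'b measure \<Rightarrow> 'v::real_vector nspace \<Rightarrow> ('b \<Rightarrow> 'v) \<Rightarrow> 'v \<Rightarrow> bool" where
  "bochner_integral_in M X f I \<longleftrightarrow> strongly_measurable M X f \<and> I \<in> elems X \<and>
     (\<exists>s. (\<forall>n. simple_in M X (s n)) \<and>
          (\<lambda>n. \<integral>\<^sup>+t. ennreal (nrm X (f t - s n t)) \<partial>M) \<longlonglongrightarrow> 0 \<and>
          (\<lambda>n. nrm X (Bochner_Integration.simple_bochner_integral M (s n) - I)) \<longlonglongrightarrow> 0)"

definition bochner_L2 :: "'b measure \<Rightarrow> 'v::real_vector nspace \<Rightarrow> ('b \<Rightarrow> 'v) nspace" where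
  "bochner_L2 M X = \<lparr>
     elems = {u. strongly_measurable M X u \<and> integrable M (\<lambda>t. (nrm X (u t))\<^sup>2)},
     nrm = (\<lambda>u. sqrt (LINT t|M. (nrm X (u t))\<^sup>2)) \<rparr>"

abbreviation time_interval :: "real \<Rightarrow> real measure" where
  "time_interval T \<equiv> lebesgue_on {0<..<T}"

text \<open>The smooth functions with compact support in \<open>(0,T)\<close>.\<close>

definition test_functions :: "real \<Rightarrow> (real \<Rightarrow> real) set" where
  "test_functions T = {\<phi>. (\<forall>k x. (deriv ^^ k) \<phi> field_differentiable (at x)) \<and>
     closure {t. \<phi> t \<noteq> 0} \<subseteq> {0<..<T}}"

text \<open>\<open>f \<in> H\<^sup>1((0,T);X)\<close> with distributional derivative \<open>g\<close>.\<close>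

definition H1_with_deriv ::
    "real \<Rightarrow> 'v::real_vector nspace \<Rightarrow> (real \<Rightarrow> 'v) \<Rightarrow> (real \<Rightarrow> 'v) \<Rightarrow> bool" where
  "H1_with_deriv T X f g \<longleftrightarrow>
     f \<in> elems (bochner_L2 (time_interval T) X) \<and> g \<in> elems (bochner_L2 (time_interval T) X) \<and>
     (\<forall>\<phi>\<in>test_functions T. \<exists>I.
        bochner_integral_in (time_interval T) X (\<lambda>t. deriv \<phi> t *\<^sub>R f t) I \<and>
        bochner_integral_in (time_interval T) X (\<lambda>t. \<phi> t *\<^sub>R g t) (- I))"


text \<open>
  Near every boundary point \<open>\<Omega>\<close> is the strict epigraph, in some direction \<open>e\<close>, of a Lipschitz
  function on the hyperplane orthogonal to \<open>e\<close>.
\<close>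

definition lipschitz_boundary :: "'a::euclidean_space set \<Rightarrow> bool" where
  "lipschitz_boundary \<Omega> \<longleftrightarrow> (\<forall>x0\<in>frontier \<Omega>. \<exists>e r L g.
     norm e = 1 \<and> 0 < r \<and> L-lipschitz_on {y. y \<bullet> e = 0} g \<and>
     \<Omega> \<inter> ball x0 r = {x \<in> ball x0 r. g (x - (x \<bullet> e) *\<^sub>R e) < x \<bullet> e})"

definition lipschitz_domain :: "'a::euclidean_space set \<Rightarrow> bool" where
  "lipschitz_domain \<Omega> \<longleftrightarrow>
     \<Omega> \<noteq> {} \<and> open \<Omega> \<and> connected \<Omega> \<and> bounded \<Omega> \<and> lipschitz_boundary \<Omega>"

definition frac_const :: "real \<Rightarrow> real \<Rightarrow> real" where
  "frac_const N s = s * 2 powr (2 * s) * Gamma ((2 * s + N) / 2) / (pi powr (N / 2) * Gamma (1 - s))"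

definition ext_measure :: "'a::euclidean_space set \<Rightarrow> ('a \<Rightarrow> real) \<Rightarrow> 'a measure" where
  "ext_measure \<Omega> \<kappa> = density (lebesgue_on (- \<Omega>)) (\<lambda>x. ennreal (\<kappa> x))"

definition cross_region :: "'a set \<Rightarrow> ('a \<times> 'a) set" where
  "cross_region \<Omega> = (\<Omega> \<times> \<Omega>) \<union> (\<Omega> \<times> (- \<Omega>)) \<union> ((- \<Omega>) \<times> \<Omega>)"

definition W_space ::
    "real \<Rightarrow> 'a::euclidean_space set \<Rightarrow> ('a \<Rightarrow> real) \<Rightarrow> ('a \<Rightarrow> real) nspace" where
  "W_space s \<Omega> \<kappa> = \<lparr>
     elems = {u \<in> borel_measurable lebesgue.
        u \<in> elems (L2 (lebesgue_on \<Omega>)) \<and> u \<in> elems (L2 (ext_measure \<Omega> \<kappa>)) \<and>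
        set_integrable (lebesgue \<Otimes>\<^sub>M lebesgue) (cross_region \<Omega>)
          (\<lambda>(x, y). \<bar>u x - u y\<bar>\<^sup>2 / norm (x - y) powr (real DIM('a) + 2 * s))},
     nrm = (\<lambda>u. sqrt ((nrm (L2 (lebesgue_on \<Omega>)) u)\<^sup>2 + (nrm (L2 (ext_measure \<Omega> \<kappa>)) u)\<^sup>2 +
        set_lebesgue_integral (lebesgue \<Otimes>\<^sub>M lebesgue) (cross_region \<Omega>)
          (\<lambda>(x, y). \<bar>u x - u y\<bar>\<^sup>2 / norm (x - y) powr (real DIM('a) + 2 * s)))) \<rparr>"

definition energy_form ::
    "real \<Rightarrow> 'a::euclidean_space set \<Rightarrow> ('a \<Rightarrow> real) \<Rightarrow> ('a \<Rightarrow> real) \<Rightarrow> ('a \<Rightarrow> real) \<Rightarrow> real" where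
  "energy_form s \<Omega> \<kappa> u v =
     frac_const (real DIM('a)) s / 2 *
       set_lebesgue_integral (lebesgue \<Otimes>\<^sub>M lebesgue) (cross_region \<Omega>)
         (\<lambda>(x, y). (u x - u y) * (v x - v y) / norm (x - y) powr (real DIM('a) + 2 * s)) +
     (LINT x|lebesgue_on (- \<Omega>). \<kappa> x * u x * v x)"

text \<open>The time derivative of \<open>u\<close> is that of \<open>t \<mapsto> (v \<mapsto> \<integral>\<^sub>\<Omega> u(t) v dx)\<close> in the dual of \<open>W_space\<close>.\<close>

definition has_time_deriv ::
    "real \<Rightarrow> real \<Rightarrow> 'a::euclidean_space set \<Rightarrow> ('a \<Rightarrow> real) \<Rightarrow>
     (real \<Rightarrow> 'a \<Rightarrow> real) \<Rightarrow> (real \<Rightarrow> ('a \<Rightarrow> real) \<Rightarrow> real) \<Rightarrow> bool" where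
  "has_time_deriv T s \<Omega> \<kappa> u w \<longleftrightarrow>
     H1_with_deriv T (dual (W_space s \<Omega> \<kappa>)) (\<lambda>t v. LINT x|lebesgue_on \<Omega>. u t x * v x) w"

definition U_R ::
    "real \<Rightarrow> real \<Rightarrow> 'a::euclidean_space set \<Rightarrow> ('a \<Rightarrow> real) \<Rightarrow> (real \<Rightarrow> 'a \<Rightarrow> real) set" where
  "U_R T s \<Omega> \<kappa> = {u \<in> elems (bochner_L2 (time_interval T) (W_space s \<Omega> \<kappa>)).
     \<exists>w. has_time_deriv T s \<Omega> \<kappa> u w}"

text \<open>
  \<open>u(t0,\<cdot>) = 0\<close> in \<open>\<Omega>\<close>, for the representative of \<open>u\<close> in \<open>C([0,T]; L\<^sup>2(\<Omega>))\<close>.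
\<close>

definition vanishes_at ::
    "real \<Rightarrow> 'a::euclidean_space set \<Rightarrow> (real \<Rightarrow> 'a \<Rightarrow> real) \<Rightarrow> real \<Rightarrow> bool" where
  "vanishes_at T \<Omega> u t0 \<longleftrightarrow> (\<exists>c.
     (\<forall>t\<in>{0..T}. c t \<in> elems (L2 (lebesgue_on \<Omega>))) \<and>
     (\<forall>t\<in>{0..T}. ((\<lambda>r. nrm (L2 (lebesgue_on \<Omega>)) (c r - c t)) \<longlongrightarrow> 0) (at t within {0..T})) \<and>
     (AE t in time_interval T. same_in (L2 (lebesgue_on \<Omega>)) (u t) (c t)) \<and>
     same_in (L2 (lebesgue_on \<Omega>)) (c t0) 0)"

definition Q_space ::
    "real \<Rightarrow> 'a::euclidean_space set \<Rightarrow> (real \<Rightarrow> 'a \<Rightarrow> real) nspace" where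
  "Q_space T \<Omega> = bochner_L2 (time_interval T) (L2 (lebesgue_on \<Omega>))"

definition Z_R ::
    "real \<Rightarrow> 'a::euclidean_space set \<Rightarrow> ('a \<Rightarrow> real) \<Rightarrow> (real \<Rightarrow> 'a \<Rightarrow> real) nspace" where
  "Z_R T \<Omega> \<kappa> = bochner_L2 (time_interval T) (L2 (ext_measure \<Omega> \<kappa>))"

text \<open>
  The integral over \<open>Q\<close> or \<open>\<Sigma>\<close> is iterated because the representatives of elements of \<open>Q_space\<close>
  and \<open>Z_R\<close> need not be jointly measurable.
\<close>

definition pairing ::
    "real \<Rightarrow> 'a measure \<Rightarrow> (real \<Rightarrow> 'a \<Rightarrow> real) \<Rightarrow> (real \<Rightarrow> 'a \<Rightarrow> real) \<Rightarrow> real" where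
  "pairing T M f g = (LINT t|time_interval T. (LINT x|M. f t x * g t x))"

definition state_solution ::
    "real \<Rightarrow> real \<Rightarrow> 'a::euclidean_space set \<Rightarrow> ('a \<Rightarrow> real) \<Rightarrow>
     (real \<Rightarrow> 'a \<Rightarrow> real) \<Rightarrow> (real \<Rightarrow> 'a \<Rightarrow> real) \<Rightarrow> bool" where
  "state_solution T s \<Omega> \<kappa> z u \<longleftrightarrow> u \<in> U_R T s \<Omega> \<kappa> \<and> vanishes_at T \<Omega> u 0 \<and>
     (\<exists>w. has_time_deriv T s \<Omega> \<kappa> u w \<and>
        (\<forall>v\<in>elems (W_space s \<Omega> \<kappa>). AE t in time_interval T.
           w t v + energy_form s \<Omega> \<kappa> (u t) v = (LINT x|ext_measure \<Omega> \<kappa>. z t x * v x)))"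

definition adjoint_solution ::
    "real \<Rightarrow> real \<Rightarrow> 'a::euclidean_space set \<Rightarrow> ('a \<Rightarrow> real) \<Rightarrow>
     (real \<Rightarrow> 'a \<Rightarrow> real) \<Rightarrow> (real \<Rightarrow> 'a \<Rightarrow> real) \<Rightarrow> bool" where
  "adjoint_solution T s \<Omega> \<kappa> f p \<longleftrightarrow> p \<in> U_R T s \<Omega> \<kappa> \<and> vanishes_at T \<Omega> p T \<and>
     (\<exists>w. has_time_deriv T s \<Omega> \<kappa> p w \<and>
        (\<forall>v\<in>elems (W_space s \<Omega> \<kappa>). AE t in time_interval T.
           - w t v + energy_form s \<Omega> \<kappa> (p t) v = (LINT x|lebesgue_on \<Omega>. f t x * v x)))"

definition reduced_cost ::
    "real \<Rightarrow> 'a::euclidean_space set \<Rightarrow> ('a \<Rightarrow> real) \<Rightarrow> real \<Rightarrow> ((real \<Rightarrow> 'a \<Rightarrow> real) \<Rightarrow> real) \<Rightarrow>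
     ((real \<Rightarrow> 'a \<Rightarrow> real) \<Rightarrow> (real \<Rightarrow> 'a \<Rightarrow> real)) \<Rightarrow> (real \<Rightarrow> 'a \<Rightarrow> real) \<Rightarrow> real" where
  "reduced_cost T \<Omega> \<kappa> \<xi> J S z = J (S z) + \<xi> / 2 * (nrm (Z_R T \<Omega> \<kappa>) z)\<^sup>2"

definition optimality_condition ::
    "real \<Rightarrow> 'a::euclidean_space set \<Rightarrow> ('a \<Rightarrow> real) \<Rightarrow> real \<Rightarrow> (real \<Rightarrow> 'a \<Rightarrow> real) set \<Rightarrow>
     (real \<Rightarrow> 'a \<Rightarrow> real) \<Rightarrow> (real \<Rightarrow> 'a \<Rightarrow> real) \<Rightarrow> bool" where
  "optimality_condition T \<Omega> \<kappa> \<xi> Zad p zbar \<longleftrightarrow>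
     (\<forall>z\<in>Zad. 0 \<le> pairing T (ext_measure \<Omega> \<kappa>) (p + \<xi> *\<^sub>R zbar) (z - zbar))"

definition is_minimizer :: "'b set \<Rightarrow> ('b \<Rightarrow> real) \<Rightarrow> 'b \<Rightarrow> bool" where
  "is_minimizer C F z \<longleftrightarrow> z \<in> C \<and> (\<forall>y\<in>C. F z \<le> F y)"

end

theory Submission
  imports Defs
begin

text \<open>
  Along the segment from \<open>zbar\<close> to an admissible \<open>z\<close> the reduced cost is differentiable, and its
  derivative at \<open>zbar\<close> is the pairing of \<open>J' (S zbar)\<close> with \<open>S z - S zbar\<close> plus \<open>\<xi>\<close> times the inner
  product of \<open>zbar\<close> and \<open>z - zbar\<close>. The adjoint state converts the first term into the pairing of
  \<open>pbar\<close> with \<open>z - zbar\<close> on the exterior (\<open>state_adjoint_duality\<close>), so that the optimality condition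
  says that this derivative is nonnegative in all admissible directions. Necessity is then immediate,
  sufficiency holds because a convex \<open>J\<close> lies above its tangents and the control cost is convex
  (\<open>convex_above_tangent\<close>), and dividing the condition by \<open>- \<xi>\<close> gives the variational
  characterization of the best approximation of \<open>- pbar / \<xi>\<close> in the admissible set
  (\<open>best_approximation_iff\<close>). The projection is this best approximation only if there is one, which
  requires the control space to be complete (\<open>complete_L2\<close>, \<open>complete_bochner_L2\<close>).

  The analysis is in two facts about weak solutions. Duality tests the state equation with the adjoint
  state and the adjoint equation with the state; the symmetric energy forms cancel and one has to
  integrate by parts in time. Differentiability of the reduced cost along the segment requires the
  state to depend affinely on the control. The map \<open>S\<close> merely selects a solution for each control, so
  this rests on uniqueness, which follows from testing the equation of a difference with itself
  (\<open>solves_zero_unique\<close>). Both use the energy identity of Lions and Magenes: if \<open>u\<close> is square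
  integrable with values in \<open>X\<close> and its derivative \<open>w\<close> is square integrable with values in the dual of
  \<open>X\<close>, then \<open>\<parallel>u(t)\<parallel>\<^sup>2 - \<parallel>u(0)\<parallel>\<^sup>2\<close> is twice the integral of \<open>w(u)\<close> over \<open>(0,t)\<close>, where the norm is that
  of the pivot space (\<open>energy_identity\<close>; \<open>integration_by_parts\<close> is its polarization).

  The energy identity is obtained from difference quotients in time. The distributional definition of
  the derivative is first turned into increments,
  \<open>b (c x) v = b (c 0) v + \<integral> w v\<close> for every fixed \<open>v\<close>, by testing with smooth approximations of
  indicator functions of intervals (\<open>weak_derivative_imp_primitive\<close>). Hence the difference quotients
  of \<open>c\<close>, as functionals on \<open>X\<close>, are bounded in \<open>L\<^sup>2\<close> and tend weakly to \<open>w\<close> on functions that are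
  constant on intervals, and by density (\<open>weak_null_on_measurable_sets\<close>, \<open>functionals_weak_null\<close>) on
  all of \<open>L\<^sup>2\<close> with values in \<open>X\<close>, in particular on \<open>u\<close> itself. Expanding the square then gives one
  inequality from backward quotients and the opposite one from forward quotients.

  Elements of all spaces are functions, and functions at distance 0 are identified. The spaces are
  therefore handled as subspaces of function spaces with a seminorm, or with a positive semidefinite
  form, and statements about elements hold up to seminorm 0.
\<close>

section \<open>Seminormed spaces, duals and semi-inner products\<close>

locale seminormed =
  fixes X :: "'v::real_vector nspace"
  assumes zero_mem: "0 \<in> elems X"
    and add_mem: "u \<in> elems X \<Longrightarrow> v \<in> elems X \<Longrightarrow> u + v \<in> elems X"
    and scale_mem: "u \<in> elems X \<Longrightarrow> c *\<^sub>R u \<in> elems X"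
    and nrm_nonneg: "u \<in> elems X \<Longrightarrow> 0 \<le> nrm X u"
    and nrm_scale: "u \<in> elems X \<Longrightarrow> nrm X (c *\<^sub>R u) = \<bar>c\<bar> * nrm X u"
    and nrm_add: "u \<in> elems X \<Longrightarrow> v \<in> elems X \<Longrightarrow> nrm X (u + v) \<le> nrm X u + nrm X v"
begin

lemma minus_mem: "u \<in> elems X \<Longrightarrow> - u \<in> elems X"
  using scale_mem[of u "-1"] by simp

lemma diff_mem: "u \<in> elems X \<Longrightarrow> v \<in> elems X \<Longrightarrow> u - v \<in> elems X"
  using add_mem[of u "- v"] minus_mem by simp

lemma nrm_zero: "nrm X 0 = 0"
  using nrm_scale[OF zero_mem, of 0] by simp

lemma nrm_minus: "u \<in> elems X \<Longrightarrow> nrm X (- u) = nrm X u"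
  using nrm_scale[of u "-1"] by simp

lemma nrm_diff_commute: "u \<in> elems X \<Longrightarrow> v \<in> elems X \<Longrightarrow> nrm X (u - v) = nrm X (v - u)"
  using nrm_minus[OF diff_mem, of u v] by simp

lemma nrm_diff: "u \<in> elems X \<Longrightarrow> v \<in> elems X \<Longrightarrow> nrm X (u - v) \<le> nrm X u + nrm X v"
  using nrm_add[of u "- v"] minus_mem nrm_minus by simp

lemma nrm_triangle:
  "u \<in> elems X \<Longrightarrow> v \<in> elems X \<Longrightarrow> w \<in> elems X \<Longrightarrow> nrm X (u - w) \<le> nrm X (u - v) + nrm X (v - w)"
  using nrm_add[OF diff_mem diff_mem, of u v v w] by simp

lemma nrm_reverse_triangle:
  assumes "u \<in> elems X" "v \<in> elems X"
  shows "\<bar>nrm X u - nrm X v\<bar> \<le> nrm X (u - v)"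
  using nrm_add[OF assms(2) diff_mem, of u v] nrm_add[OF assms(1) diff_mem, of v u]
    nrm_diff_commute[OF assms] assms by simp

lemma dual_mem_iff:
  "l \<in> elems (dual X) \<longleftrightarrow> (\<forall>u\<in>elems X. \<forall>v\<in>elems X. l (u + v) = l u + l v) \<and>
     (\<forall>c. \<forall>u\<in>elems X. l (c *\<^sub>R u) = c * l u) \<and> (\<exists>C. \<forall>u\<in>elems X. \<bar>l u\<bar> \<le> C * nrm X u)"
  by (simp add: dual_def)

lemma dual_add: "l \<in> elems (dual X) \<Longrightarrow> u \<in> elems X \<Longrightarrow> v \<in> elems X \<Longrightarrow> l (u + v) = l u + l v"
  and dual_scale: "l \<in> elems (dual X) \<Longrightarrow> u \<in> elems X \<Longrightarrow> l (c *\<^sub>R u) = c * l u"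
  by (auto simp: dual_mem_iff)

lemma dual_diff: "l \<in> elems (dual X) \<Longrightarrow> u \<in> elems X \<Longrightarrow> v \<in> elems X \<Longrightarrow> l (u - v) = l u - l v"
  using dual_add[of l u "(-1) *\<^sub>R v"] dual_scale[of l v "-1"] scale_mem[of v "-1"] by simp


lemma dual_bdd_above:
  assumes "l \<in> elems (dual X)"
  shows "bdd_above ((\<lambda>u. \<bar>l u\<bar>) ` {u \<in> elems X. nrm X u \<le> 1})"
proof -
  obtain C where C: "\<And>u. u \<in> elems X \<Longrightarrow> \<bar>l u\<bar> \<le> C * nrm X u"
    using assms dual_mem_iff by blast
  have "\<bar>l u\<bar> \<le> \<bar>C\<bar>" if "u \<in> elems X" "nrm X u \<le> 1" for u
  proof -
    have "C * nrm X u \<le> \<bar>C\<bar> * nrm X u"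
      using nrm_nonneg[OF that(1)] by (intro mult_right_mono) auto
    also have "\<dots> \<le> \<bar>C\<bar> * 1"
      using that by (intro mult_left_mono) auto
    finally show ?thesis using C[OF that(1)] by simp
  qed
  then show ?thesis by (auto simp: bdd_above_def)
qed

lemma dual_nrm_eq: "nrm (dual X) l = (SUP u\<in>{u \<in> elems X. nrm X u \<le> 1}. \<bar>l u\<bar>)"
  by (simp add: dual_def)

lemma dual_nrm_nonneg:
  assumes "l \<in> elems (dual X)" shows "0 \<le> nrm (dual X) l"
proof -
  have "\<bar>l 0\<bar> \<le> nrm (dual X) l"
    unfolding dual_nrm_eq using zero_mem nrm_zero
    by (intro cSUP_upper dual_bdd_above assms) auto
  then show ?thesis by simp
qed

lemma dual_nrm_le:
  assumes "\<And>u. u \<in> elems X \<Longrightarrow> \<bar>l u\<bar> \<le> C * nrm X u" "0 \<le> C"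
  shows "nrm (dual X) l \<le> C"
  unfolding dual_nrm_eq
proof (rule cSUP_least)
  show "{u \<in> elems X. nrm X u \<le> 1} \<noteq> {}" using zero_mem nrm_zero by auto
  fix u assume "u \<in> {u \<in> elems X. nrm X u \<le> 1}"
  then show "\<bar>l u\<bar> \<le> C"
    using assms(1)[of u] mult_left_mono[OF _ assms(2), of "nrm X u" 1] by auto
qed

lemma dual_bound:
  assumes l: "l \<in> elems (dual X)" and u: "u \<in> elems X"
  shows "\<bar>l u\<bar> \<le> nrm (dual X) l * nrm X u"
proof (cases "nrm X u = 0")
  case True
  then show ?thesis using l u by (force simp: dual_mem_iff)
next
  case False
  then have pos: "0 < nrm X u" using nrm_nonneg[OF u] by simp
  define v where "v = inverse (nrm X u) *\<^sub>R u"
  have "v \<in> elems X" "nrm X v \<le> 1"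
    using scale_mem[OF u] nrm_scale[OF u] pos by (auto simp: v_def)
  then have "\<bar>l v\<bar> \<le> nrm (dual X) l"
    unfolding dual_nrm_eq by (intro cSUP_upper dual_bdd_above l) auto
  moreover have "l v = l u / nrm X u"
    using dual_scale[OF l u] by (simp add: v_def field_simps)
  ultimately show ?thesis using pos by (simp add: field_simps)
qed

lemma seminormed_dual: "seminormed (dual X)"
proof
  show "0 \<in> elems (dual X)" by (force simp: dual_mem_iff intro: exI[of _ 0])
  show add: "k + l \<in> elems (dual X)" if k: "k \<in> elems (dual X)" and l: "l \<in> elems (dual X)" for k l
  proof -
    have "\<bar>(k + l) u\<bar> \<le> (nrm (dual X) k + nrm (dual X) l) * nrm X u" if "u \<in> elems X" for u
      using dual_bound[OF k that] dual_bound[OF l that] by (simp add: algebra_simps)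
    then have "\<exists>C. \<forall>u\<in>elems X. \<bar>(k + l) u\<bar> \<le> C * nrm X u" by blast
    moreover have "\<forall>u\<in>elems X. \<forall>v\<in>elems X. (k + l) (u + v) = (k + l) u + (k + l) v"
      using dual_add[OF k] dual_add[OF l] by simp
    moreover have "\<forall>c. \<forall>u\<in>elems X. (k + l) (c *\<^sub>R u) = c * (k + l) u"
      using dual_scale[OF k] dual_scale[OF l] by (simp add: algebra_simps)
    ultimately show ?thesis unfolding dual_mem_iff by blast
  qed
  show scale: "c *\<^sub>R l \<in> elems (dual X)" if l: "l \<in> elems (dual X)" for c l
  proof -
    have "\<bar>(c *\<^sub>R l) u\<bar> \<le> (\<bar>c\<bar> * nrm (dual X) l) * nrm X u" if "u \<in> elems X" for u
      using mult_left_mono[OF dual_bound[OF l that], of "\<bar>c\<bar>"]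
      by (simp add: scaleR_fun_def abs_mult mult.assoc)
    then have "\<exists>C. \<forall>u\<in>elems X. \<bar>(c *\<^sub>R l) u\<bar> \<le> C * nrm X u" by blast
    then show ?thesis
      using dual_add[OF l] dual_scale[OF l] unfolding dual_mem_iff
      by (simp add: algebra_simps scaleR_fun_def)
  qed
  show "0 \<le> nrm (dual X) l" if "l \<in> elems (dual X)" for l using that by (rule dual_nrm_nonneg)
  have le: "nrm (dual X) (c *\<^sub>R l) \<le> \<bar>c\<bar> * nrm (dual X) l" if l: "l \<in> elems (dual X)" for c l
    using mult_left_mono[OF dual_bound[OF l], of _ "\<bar>c\<bar>"] dual_nrm_nonneg[OF l]
    by (intro dual_nrm_le) (auto simp: scaleR_fun_def abs_mult mult.assoc)
  show "nrm (dual X) (c *\<^sub>R l) = \<bar>c\<bar> * nrm (dual X) l" if l: "l \<in> elems (dual X)" for c l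
  proof (cases "c = 0")
    case True
    then show ?thesis using le[OF l, of 0] dual_nrm_nonneg[OF scale[OF l, of 0]] by simp
  next
    case False
    have "nrm (dual X) l = nrm (dual X) (inverse c *\<^sub>R c *\<^sub>R l)" using False by simp
    also have "\<dots> \<le> \<bar>inverse c\<bar> * nrm (dual X) (c *\<^sub>R l)" by (rule le[OF scale[OF l]])
    finally have "\<bar>c\<bar> * nrm (dual X) l \<le> nrm (dual X) (c *\<^sub>R l)"
      using False by (simp add: field_simps)
    with le[OF l, of c] show ?thesis by simp
  qed
  show "nrm (dual X) (k + l) \<le> nrm (dual X) k + nrm (dual X) l"
    if k: "k \<in> elems (dual X)" and l: "l \<in> elems (dual X)" for k l
    using dual_bound[OF k] dual_bound[OF l] dual_nrm_nonneg[OF k] dual_nrm_nonneg[OF l]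
    by (intro dual_nrm_le) (force simp: algebra_simps)+
qed

end

text \<open>The form is only required to be positive semidefinite, since a function that vanishes almost
  everywhere has seminorm 0 without being 0. The rules are restricted to the elements of the space,
  because integrals of products are additive only where they exist.\<close>

locale semi_inner =
  fixes X :: "'v::real_vector nspace" and b :: "'v \<Rightarrow> 'v \<Rightarrow> real"
  assumes zero_mem': "0 \<in> elems X"
    and add_mem': "u \<in> elems X \<Longrightarrow> v \<in> elems X \<Longrightarrow> u + v \<in> elems X"
    and scale_mem': "u \<in> elems X \<Longrightarrow> c *\<^sub>R u \<in> elems X"
    and sym: "u \<in> elems X \<Longrightarrow> v \<in> elems X \<Longrightarrow> b u v = b v u"
    and add_left: "u \<in> elems X \<Longrightarrow> v \<in> elems X \<Longrightarrow> w \<in> elems X \<Longrightarrow> b (u + v) w = b u w + b v w"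
    and scale_left: "u \<in> elems X \<Longrightarrow> v \<in> elems X \<Longrightarrow> b (c *\<^sub>R u) v = c * b u v"
    and nonneg: "u \<in> elems X \<Longrightarrow> 0 \<le> b u u"
    and nrm_eq: "u \<in> elems X \<Longrightarrow> nrm X u = sqrt (b u u)"
begin

lemma diff_mem': "u \<in> elems X \<Longrightarrow> v \<in> elems X \<Longrightarrow> u - v \<in> elems X"
  using add_mem'[of u "(-1) *\<^sub>R v"] scale_mem'[of v "-1"] by simp

lemma add_right: "u \<in> elems X \<Longrightarrow> v \<in> elems X \<Longrightarrow> w \<in> elems X \<Longrightarrow> b w (u + v) = b w u + b w v"
  using add_left sym add_mem' by metis

lemma scale_right: "u \<in> elems X \<Longrightarrow> v \<in> elems X \<Longrightarrow> b v (c *\<^sub>R u) = c * b v u"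
  using scale_left sym scale_mem' by metis

lemma diff_left: "u \<in> elems X \<Longrightarrow> v \<in> elems X \<Longrightarrow> w \<in> elems X \<Longrightarrow> b (u - v) w = b u w - b v w"
  using add_left[of u "(-1) *\<^sub>R v" w] scale_left[of v w "-1"] scale_mem'[of v "-1"] by simp

lemma diff_right: "u \<in> elems X \<Longrightarrow> v \<in> elems X \<Longrightarrow> w \<in> elems X \<Longrightarrow> b w (u - v) = b w u - b w v"
  using diff_left sym diff_mem' by metis

lemma nrm_square: "u \<in> elems X \<Longrightarrow> (nrm X u)\<^sup>2 = b u u"
  using nonneg nrm_eq by simp

lemma square_add:
  assumes "u \<in> elems X" "v \<in> elems X"
  shows "b (u + v) (u + v) = b u u + 2 * b u v + b v v"
  using assms sym[OF assms] by (simp add: add_left add_right add_mem')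

lemma square_diff:
  assumes "u \<in> elems X" "v \<in> elems X"
  shows "b (u - v) (u - v) = b u u - 2 * b u v + b v v"
  using assms sym[OF assms] by (simp add: diff_left diff_right diff_mem')

lemma cauchy_schwarz_square:
  assumes u: "u \<in> elems X" and v: "v \<in> elems X"
  shows "(b u v)\<^sup>2 \<le> b u u * b v v"
proof -
  have q: "0 \<le> b u u + 2 * t * b u v + t\<^sup>2 * b v v" for t
  proof -
    have "0 \<le> b (u + t *\<^sub>R v) (u + t *\<^sub>R v)"
      using u v by (intro nonneg add_mem' scale_mem')
    also have "\<dots> = b u u + 2 * t * b u v + t\<^sup>2 * b v v"
      using u v by (simp add: square_add scale_mem' scale_left scale_right power2_eq_square)
    finally show ?thesis .
  qed
  show ?thesis
  proof (cases "b v v = 0")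
    case True
    have "b u v = 0"
    proof (rule ccontr)
      assume ne: "b u v \<noteq> 0"
      have "b u u + 2 * (- (b u u + 1) / (2 * b u v)) * b u v = -1"
        using ne by (simp add: field_simps)
      with q[of "- (b u u + 1) / (2 * b u v)"] True show False by simp
    qed
    then show ?thesis using True by simp
  next
    case False
    then have pos: "0 < b v v" using nonneg[OF v] by simp
    have "b u u + 2 * (- b u v / b v v) * b u v + (- b u v / b v v)\<^sup>2 * b v v
      = b u u - (b u v)\<^sup>2 / b v v"
      using pos by (simp add: field_simps power2_eq_square)
    with q[of "- b u v / b v v"] have "(b u v)\<^sup>2 / b v v \<le> b u u" by simp
    then show ?thesis using pos by (simp add: field_simps)
  qed
qed

lemma cauchy_schwarz:
  assumes u: "u \<in> elems X" and v: "v \<in> elems X"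
  shows "\<bar>b u v\<bar> \<le> nrm X u * nrm X v"
proof -
  have "\<bar>b u v\<bar> = sqrt ((b u v)\<^sup>2)" by simp
  also have "\<dots> \<le> sqrt (b u u * b v v)"
    using cauchy_schwarz_square[OF u v] by (rule real_sqrt_le_mono)
  also have "\<dots> = nrm X u * nrm X v"
    using nrm_eq u v by (simp add: real_sqrt_mult)
  finally show ?thesis .
qed

lemma seminormed: "seminormed X"
proof
  fix u v :: 'v and c :: real
  assume u: "u \<in> elems X"
  show "nrm X (c *\<^sub>R u) = \<bar>c\<bar> * nrm X u"
  proof -
    have "b (c *\<^sub>R u) (c *\<^sub>R u) = c\<^sup>2 * b u u"
      using u by (simp add: scale_left scale_right scale_mem' power2_eq_square)
    then show ?thesis using u by (simp add: nrm_eq scale_mem' real_sqrt_mult)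
  qed
  assume v: "v \<in> elems X"
  have "(nrm X (u + v))\<^sup>2 \<le> (nrm X u + nrm X v)\<^sup>2"
    using cauchy_schwarz[OF u v] u v
    by (simp add: nrm_square add_mem' square_add power2_sum)
  then show "nrm X (u + v) \<le> nrm X u + nrm X v"
    by (rule power2_le_imp_le) (use u v nrm_eq nonneg in simp)
qed (use zero_mem' add_mem' scale_mem' nrm_eq nonneg in auto)

end

sublocale semi_inner \<subseteq> seminormed X
  by (rule seminormed)

context semi_inner
begin

lemma form_in_dual_of_subspace:
  assumes Y: "seminormed Y" and sub: "elems Y \<subseteq> elems X"
    and le: "\<And>v. v \<in> elems Y \<Longrightarrow> nrm X v \<le> nrm Y v" and u: "u \<in> elems X"
  shows "b u \<in> elems (dual Y)"
  unfolding seminormed.dual_mem_iff[OF Y]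
proof (intro conjI ballI allI exI)
  fix v v' and c :: real assume v: "v \<in> elems Y"
  show "b u (c *\<^sub>R v) = c * b u v" using u v sub by (intro scale_right) auto
  have "\<bar>b u v\<bar> \<le> nrm X u * nrm X v" using u v sub by (intro cauchy_schwarz) auto
  also have "\<dots> \<le> nrm X u * nrm Y v"
    using le[OF v] nrm_nonneg[OF u] by (rule mult_left_mono)
  finally show "\<bar>b u v\<bar> \<le> nrm X u * nrm Y v" .
  assume v': "v' \<in> elems Y"
  show "b u (v + v') = b u v + b u v'" using u v v' sub by (intro add_right) auto
qed

lemma form_diff_bound:
  assumes "u \<in> elems X" "v \<in> elems X" "u' \<in> elems X" "v' \<in> elems X"
  shows "\<bar>b u v - b u' v'\<bar> \<le> nrm X (u - u') * nrm X v + nrm X u' * nrm X (v - v')"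
proof -
  have "b u v - b u' v' = b (u - u') v + b u' (v - v')"
    using assms by (simp add: diff_left diff_right diff_mem)
  moreover have "\<bar>b (u - u') v\<bar> \<le> nrm X (u - u') * nrm X v"
    using assms by (intro cauchy_schwarz diff_mem)
  moreover have "\<bar>b u' (v - v')\<bar> \<le> nrm X u' * nrm X (v - v')"
    using assms by (intro cauchy_schwarz diff_mem)
  ultimately show ?thesis by linarith
qed

text \<open>Moving from \<open>w\<close> towards \<open>y\<close> by the fraction \<open>t\<close> changes the squared distance to \<open>q\<close> by
  \<open>- 2 * t * b (q - w) (y - w) + t\<^sup>2 * b (y - w) (y - w)\<close>. For small \<open>t\<close> the linear term decides.\<close>

lemma best_approximation_iff:
  assumes C: "convex C" "C \<subseteq> elems X" and q: "q \<in> elems X" and w: "w \<in> C"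
  shows "(\<forall>y\<in>C. nrm X (q - w) \<le> nrm X (q - y)) \<longleftrightarrow> (\<forall>y\<in>C. b (q - w) (y - w) \<le> 0)"
proof
  have wX: "w \<in> elems X" using C w by auto
  assume best: "\<forall>y\<in>C. nrm X (q - w) \<le> nrm X (q - y)"
  show "\<forall>y\<in>C. b (q - w) (y - w) \<le> 0"
  proof (intro ballI, rule ccontr)
    fix y assume y: "y \<in> C" and "\<not> b (q - w) (y - w) \<le> 0"
    then have pos: "0 < b (q - w) (y - w)" by simp
    have yX: "y \<in> elems X" using C y by auto
    define \<beta> where "\<beta> = b (q - w) (y - w)"
    define d where "d = b (y - w) (y - w)"
    \<comment> \<open>The quadratic term \<open>t\<^sup>2 * d\<close> is at most \<open>t * \<beta>\<close>; the denominator \<open>d + 1\<close> allows \<open>d = 0\<close>.\<close>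
    define t where "t = min 1 (\<beta> / (d + 1))"
    have d: "0 \<le> d" unfolding d_def using yX wX by (intro nonneg diff_mem)
    have t: "0 < t" "t \<le> 1" using pos d by (auto simp: t_def \<beta>_def)
    have mem: "w + t *\<^sub>R (y - w) \<in> C"
      using convexD_alt[OF C(1) w y, of t] t by (simp add: algebra_simps)
    have qm: "q - w \<in> elems X" and ym: "y - w \<in> elems X" using q wX yX diff_mem by auto
    have "nrm X (q - w) \<le> nrm X (q - (w + t *\<^sub>R (y - w)))" using best mem by blast
    then have "(nrm X (q - w))\<^sup>2 \<le> (nrm X ((q - w) - t *\<^sub>R (y - w)))\<^sup>2"
      using nrm_nonneg[OF qm] by (intro power_mono) (auto simp: algebra_simps)
    moreover have "(nrm X ((q - w) - t *\<^sub>R (y - w)))\<^sup>2 = (nrm X (q - w))\<^sup>2 - 2 * t * \<beta> + t\<^sup>2 * d"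
    proof -
      have "(nrm X ((q - w) - t *\<^sub>R (y - w)))\<^sup>2
          = b ((q - w) - t *\<^sub>R (y - w)) ((q - w) - t *\<^sub>R (y - w))"
        by (intro nrm_square diff_mem scale_mem qm ym)
      also have "\<dots> = b (q - w) (q - w) - 2 * b (q - w) (t *\<^sub>R (y - w))
          + b (t *\<^sub>R (y - w)) (t *\<^sub>R (y - w))"
        by (intro square_diff scale_mem qm ym)
      also have "\<dots> = (nrm X (q - w))\<^sup>2 - 2 * t * \<beta> + t\<^sup>2 * d"
        unfolding nrm_square[OF qm] scale_left[OF ym scale_mem[OF ym]] scale_right[OF ym ym]
          scale_right[OF ym qm] \<beta>_def d_def by (simp add: power2_eq_square)
      finally show ?thesis .
    qed
    ultimately have "0 \<le> - 2 * t * \<beta> + t\<^sup>2 * d" by simp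
    then have "0 \<le> t * (t * d - 2 * \<beta>)" by (simp add: power2_eq_square algebra_simps)
    then have "2 * \<beta> \<le> t * d" using t by (simp add: zero_le_mult_iff)
    also have "\<dots> \<le> \<beta> / (d + 1) * d" using d by (intro mult_right_mono) (auto simp: t_def)
    also have "\<dots> \<le> \<beta>" using pos d by (simp add: \<beta>_def field_simps)
    finally show False using pos by (simp add: \<beta>_def)
  qed
next
  have wX: "w \<in> elems X" using C w by auto
  assume vi: "\<forall>y\<in>C. b (q - w) (y - w) \<le> 0"
  show "\<forall>y\<in>C. nrm X (q - w) \<le> nrm X (q - y)"
  proof
    fix y assume y: "y \<in> C"
    have qm: "q - w \<in> elems X" and ym: "y - w \<in> elems X" using q wX y C diff_mem by auto
    have "(nrm X (q - y))\<^sup>2 = (nrm X ((q - w) - (y - w)))\<^sup>2" by simp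
    also have "\<dots> = b (q - w) (q - w) - 2 * b (q - w) (y - w) + b (y - w) (y - w)"
      using nrm_square[OF diff_mem[OF qm ym]] square_diff[OF qm ym] by simp
    finally have "(nrm X (q - w))\<^sup>2 \<le> (nrm X (q - y))\<^sup>2"
      using vi y nonneg[OF ym] nrm_square[OF qm] by fastforce
    then show "nrm X (q - w) \<le> nrm X (q - y)"
      by (rule power2_le_imp_le) (use q y C nrm_nonneg diff_mem in auto)
  qed
qed

lemma parallelogram:
  assumes "u \<in> elems X" "v \<in> elems X"
  shows "(nrm X (u + v))\<^sup>2 + (nrm X (u - v))\<^sup>2 = 2 * (nrm X u)\<^sup>2 + 2 * (nrm X v)\<^sup>2"
  using assms by (simp add: nrm_square add_mem diff_mem square_add square_diff)

text \<open>Applied to the distances of two points of a convex set from \<open>q\<close>, the parallelogram law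
  bounds the distance of the two points, because their midpoint is no closer to \<open>q\<close> than \<open>m\<close>.
  It yields both uniqueness of best approximations and that minimizing sequences are Cauchy.\<close>

lemma near_best_approximations:
  assumes C: "convex C" "C \<subseteq> elems X" and q: "q \<in> elems X" and xy: "x \<in> C" "y \<in> C"
    and m: "\<And>z. z \<in> C \<Longrightarrow> m \<le> nrm X (q - z)" "0 \<le> m"
  shows "(nrm X (x - y))\<^sup>2 \<le> 2 * ((nrm X (q - x))\<^sup>2 - m\<^sup>2) + 2 * ((nrm X (q - y))\<^sup>2 - m\<^sup>2)"
proof -
  have X: "x \<in> elems X" "y \<in> elems X" using C xy by auto
  define z where "z = (1/2) *\<^sub>R x + (1/2) *\<^sub>R y"
  have z: "z \<in> C" using convexD[OF C(1) xy, of "1/2" "1/2"] by (simp add: z_def)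
  have "(q - x) + (q - y) = 2 *\<^sub>R (q - z)" by (simp add: z_def algebra_simps flip: scaleR_2)
  then have "(nrm X ((q - x) + (q - y)))\<^sup>2 = 4 * (nrm X (q - z))\<^sup>2"
    using nrm_scale[OF diff_mem, of q z 2] q z C by (auto simp: power_mult_distrib)
  moreover have "m\<^sup>2 \<le> (nrm X (q - z))\<^sup>2" using m z by (intro power_mono) auto
  moreover have "(nrm X ((q - x) - (q - y)))\<^sup>2 = (nrm X (x - y))\<^sup>2"
    using nrm_diff_commute[OF X] by (simp add: algebra_simps)
  ultimately show ?thesis
    using parallelogram[OF diff_mem diff_mem, of q x q y] q X by simp
qed

lemma best_approximation_unique:
  assumes C: "convex C" "C \<subseteq> elems X" and q: "q \<in> elems X" and w: "w \<in> C" "w' \<in> C"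
    and best: "\<And>y. y \<in> C \<Longrightarrow> nrm X (q - w) \<le> nrm X (q - y)"
      "\<And>y. y \<in> C \<Longrightarrow> nrm X (q - w') \<le> nrm X (q - y)"
  shows "nrm X (w - w') = 0"
proof -
  have "nrm X (q - w) = nrm X (q - w')" using best w by (auto intro: antisym)
  moreover have "0 \<le> nrm X (q - w)" using q w C by (intro nrm_nonneg diff_mem) auto
  ultimately show ?thesis
    using near_best_approximations[OF C q w, of "nrm X (q - w)"] best by simp
qed

end

definition complete_in :: "'v::real_vector nspace \<Rightarrow> bool" where
  "complete_in X \<longleftrightarrow> (\<forall>f. (\<forall>n. f n \<in> elems X) \<longrightarrow>
     (\<forall>e>0. \<exists>N. \<forall>m\<ge>N. \<forall>n\<ge>N. nrm X (f m - f n) < e) \<longrightarrow>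
     (\<exists>u\<in>elems X. (\<lambda>n. nrm X (f n - u)) \<longlonglongrightarrow> 0))"

lemma (in semi_inner) best_approximation_exists:
  assumes "complete_in X" and closed: "closed_in X C" and C: "convex C" "C \<noteq> {}"
    and q: "q \<in> elems X"
  shows "\<exists>w\<in>C. \<forall>y\<in>C. nrm X (q - w) \<le> nrm X (q - y)"
proof -
  have CX: "C \<subseteq> elems X" using closed by (auto simp: closed_in_def)
  define m where "m = (INF y\<in>C. nrm X (q - y))"
  have bdd: "bdd_below ((\<lambda>y. nrm X (q - y)) ` C)"
    using q CX by (intro bdd_belowI2[of _ 0] nrm_nonneg diff_mem) auto
  have m_le: "m \<le> nrm X (q - y)" if "y \<in> C" for y
    unfolding m_def using that bdd by (intro cINF_lower)
  have m0: "0 \<le> m"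
    unfolding m_def using C q CX by (intro cINF_greatest nrm_nonneg diff_mem) auto
  have "\<exists>y\<in>C. nrm X (q - y) < m + inverse (Suc n)" for n
    using cINF_less_iff[OF C(2) bdd, of "m + inverse (Suc n)"] by (simp add: m_def)
  then obtain f where f: "\<And>n. f n \<in> C" "\<And>n. nrm X (q - f n) < m + inverse (Suc n)" by metis
  have fX: "f n \<in> elems X" for n using f CX by auto
  have d0: "(\<lambda>n. (nrm X (q - f n))\<^sup>2 - m\<^sup>2) \<longlonglongrightarrow> 0"
  proof -
    have up: "(\<lambda>n. (m + inverse (real (Suc n)))\<^sup>2 - m\<^sup>2) \<longlonglongrightarrow> (m + 0)\<^sup>2 - m\<^sup>2"
      by (intro tendsto_intros LIMSEQ_inverse_real_of_nat)
    have "\<forall>n. 0 \<le> (nrm X (q - f n))\<^sup>2 - m\<^sup>2"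
      using m_le[OF f(1)] m0 by (auto intro!: power_mono)
    moreover have "\<forall>n. (nrm X (q - f n))\<^sup>2 - m\<^sup>2 \<le> (m + inverse (real (Suc n)))\<^sup>2 - m\<^sup>2"
      using f(2) nrm_nonneg[OF diff_mem[OF q fX]] by (simp add: less_imp_le power_mono)
    ultimately show ?thesis
      using up by (intro tendsto_sandwich[OF _ _ tendsto_const[of 0] up[simplified]]) auto
  qed
  have cauchy: "\<exists>N. \<forall>i\<ge>N. \<forall>j\<ge>N. nrm X (f i - f j) < e" if e: "0 < e" for e
  proof -
    obtain N where N: "\<And>n. n \<ge> N \<Longrightarrow> (nrm X (q - f n))\<^sup>2 - m\<^sup>2 < e\<^sup>2 / 4"
      using order_tendstoD(2)[OF d0, of "e\<^sup>2 / 4"] e by (auto simp: eventually_sequentially)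
    have "nrm X (f i - f j) < e" if "i \<ge> N" "j \<ge> N" for i j
    proof -
      have quarters: "2 * x + 2 * y < z" if "x < z / 4" "y < z / 4" for x y z :: real
        using that by simp
      have "(nrm X (f i - f j))\<^sup>2
          \<le> 2 * ((nrm X (q - f i))\<^sup>2 - m\<^sup>2) + 2 * ((nrm X (q - f j))\<^sup>2 - m\<^sup>2)"
        by (rule near_best_approximations[OF C(1) CX q f(1) f(1) m_le m0])
      then have "(nrm X (f i - f j))\<^sup>2 < e\<^sup>2"
        using quarters[OF N[OF that(1)] N[OF that(2)]] by (rule order.strict_trans1)
      then show ?thesis using e by (auto intro: power2_less_imp_less)
    qed
    then show ?thesis by blast
  qed
  have "\<exists>w\<in>elems X. (\<lambda>n. nrm X (f n - w)) \<longlonglongrightarrow> 0"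
    using assms(1) unfolding complete_in_def by (elim allE[of _ f] impE) (use fX cauchy in auto)
  then obtain w where w: "w \<in> elems X" "(\<lambda>n. nrm X (f n - w)) \<longlonglongrightarrow> 0" by auto
  have "w \<in> C"
  proof -
    have "\<exists>c\<in>C. nrm X (w - c) < e" if "0 < e" for e
    proof -
      have "eventually (\<lambda>n. nrm X (f n - w) < e) sequentially"
        using order_tendstoD(2)[OF w(2) that] .
      then obtain n where "nrm X (f n - w) < e" by (auto simp: eventually_sequentially)
      then show ?thesis using f(1) nrm_diff_commute[OF fX w(1)] by metis
    qed
    then show ?thesis using closed w(1) by (auto simp: closed_in_def)
  qed
  moreover have "nrm X (q - w) \<le> m"
  proof (rule LIMSEQ_le_const)
    show "(\<lambda>n. (m + inverse (real (Suc n))) + nrm X (f n - w)) \<longlonglongrightarrow> m"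
      using tendsto_add[OF tendsto_add[OF tendsto_const LIMSEQ_inverse_real_of_nat] w(2), of m] by simp
    have "nrm X (q - w) \<le> (m + inverse (real (Suc n))) + nrm X (f n - w)" for n
      using nrm_triangle[OF q fX w(1), of n] f(2)[of n] by simp
    then show "\<exists>N. \<forall>n\<ge>N. nrm X (q - w) \<le> (m + inverse (real (Suc n))) + nrm X (f n - w)" by blast
  qed
  ultimately show ?thesis using m_le by (intro bexI[of _ w]) (auto intro: order_trans)
qed

section \<open>Square integrable functions\<close>

text \<open>On the exceptional null set the limit is arbitrary; completeness of the measure makes every
  subset of it measurable.\<close>

lemma (in complete_measure) AE_limit_measurable:
  fixes f :: "nat \<Rightarrow> 'a \<Rightarrow> real"
  assumes f: "\<And>n. f n \<in> borel_measurable M" and lim: "AE x in M. (\<lambda>n. f n x) \<longlonglongrightarrow> g x"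
  shows "g \<in> borel_measurable M"
proof -
  define N where "N = {x \<in> space M. \<not> (\<lambda>n. f n x) \<longlonglongrightarrow> g x}"
  have N: "N \<in> null_sets M" using lim by (simp add: AE_iff_null_sets N_def)
  have L: "(\<lambda>x. lim (\<lambda>n. f n x)) \<in> borel_measurable M" (is "?L \<in> _")
    using f by measurable
  show ?thesis
  proof (rule measurableI)
    fix B :: "real set" assume B: "B \<in> sets borel"
    have "g -` B \<inter> space M = (?L -` B \<inter> space M - N) \<union> (g -` B \<inter> N)"
      by (auto simp: N_def limI)
    moreover have "g -` B \<inter> N \<in> sets M" using N by (intro complete[of _ N]) auto
    ultimately show "g -` B \<inter> space M \<in> sets M"
      using measurable_sets[OF L B] N by (auto intro: null_setsD2)
  qed simp
qed

lemma L2_mem_iff: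
  "f \<in> elems (L2 M) \<longleftrightarrow> f \<in> borel_measurable M \<and> integrable M (\<lambda>x. (f x)\<^sup>2)"
  by (simp add: L2_def)

lemma L2_nrm: "nrm (L2 M) f = sqrt (LINT x|M. (f x)\<^sup>2)"
  by (simp add: L2_def)

lemma L2_measurable: "f \<in> elems (L2 M) \<Longrightarrow> f \<in> borel_measurable M"
  by (simp add: L2_mem_iff)

lemma integrable_product_if_squares:
  fixes f g :: "'a \<Rightarrow> real"
  assumes [measurable]: "f \<in> borel_measurable M" "g \<in> borel_measurable M"
    and "integrable M (\<lambda>x. (f x)\<^sup>2)" "integrable M (\<lambda>x. (g x)\<^sup>2)"
  shows "integrable M (\<lambda>x. f x * g x)"
proof (rule Bochner_Integration.integrable_bound)
  show "integrable M (\<lambda>x. (f x)\<^sup>2 + (g x)\<^sup>2)" using assms by simp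
  show "AE x in M. norm (f x * g x) \<le> norm ((f x)\<^sup>2 + (g x)\<^sup>2)"
  proof (rule AE_I2)
    fix x
    have "0 \<le> (\<bar>f x\<bar> - \<bar>g x\<bar>)\<^sup>2 + (f x)\<^sup>2 + (g x)\<^sup>2" by simp
    then have "2 * (\<bar>f x\<bar> * \<bar>g x\<bar>) \<le> 2 * ((f x)\<^sup>2 + (g x)\<^sup>2)"
      by (simp add: power2_diff algebra_simps)
    then show "norm (f x * g x) \<le> norm ((f x)\<^sup>2 + (g x)\<^sup>2)" by (simp add: abs_mult)
  qed
qed measurable

lemma L2_mult_integrable:
  "f \<in> elems (L2 M) \<Longrightarrow> g \<in> elems (L2 M) \<Longrightarrow> integrable M (\<lambda>x. f x * g x)"
  by (intro integrable_product_if_squares) (auto simp: L2_mem_iff)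

lemma semi_inner_L2: "semi_inner (L2 M) (\<lambda>f g. LINT x|M. f x * g x)"
proof
  fix f g h :: "'a \<Rightarrow> real" and c :: real
  show "0 \<in> elems (L2 M)" by (simp add: L2_mem_iff zero_fun_def)
  assume f: "f \<in> elems (L2 M)"
  show "c *\<^sub>R f \<in> elems (L2 M)"
    using f by (auto simp: L2_mem_iff scaleR_fun_def power_mult_distrib)
  show "0 \<le> (LINT x|M. f x * f x)" by simp
  show "nrm (L2 M) f = sqrt (LINT x|M. f x * f x)" by (simp add: L2_nrm power2_eq_square)
  assume g: "g \<in> elems (L2 M)"
  have "integrable M (\<lambda>x. (f x)\<^sup>2 + 2 * (f x * g x) + (g x)\<^sup>2)"
    using f g L2_mult_integrable[OF f g]
    by (intro Bochner_Integration.integrable_add integrable_mult_right) (auto simp: L2_mem_iff)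
  then show "f + g \<in> elems (L2 M)"
    using f g by (auto simp: L2_mem_iff plus_fun_def power2_sum algebra_simps)
  show "(LINT x|M. f x * g x) = (LINT x|M. g x * f x)" by (simp add: mult.commute)
  show "(LINT x|M. (c *\<^sub>R f) x * g x) = c * (LINT x|M. f x * g x)"
    by (simp add: scaleR_fun_def mult.assoc)
  assume h: "h \<in> elems (L2 M)"
  show "(LINT x|M. (f + g) x * h x) = (LINT x|M. f x * h x) + (LINT x|M. g x * h x)"
    using L2_mult_integrable[OF f h] L2_mult_integrable[OF g h]
    by (simp add: plus_fun_def distrib_right)
qed

lemma L2_cauchy_schwarz:
  assumes "f \<in> elems (L2 M)" "g \<in> elems (L2 M)"
  shows "\<bar>LINT x|M. f x * g x\<bar> \<le> sqrt (LINT x|M. (f x)\<^sup>2) * sqrt (LINT x|M. (g x)\<^sup>2)"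
  using semi_inner.cauchy_schwarz[OF semi_inner_L2 assms] by (simp add: L2_nrm)

lemma (in finite_measure) const_in_L2: "(\<lambda>_. c) \<in> elems (L2 M)"
  by (simp add: L2_mem_iff)

text \<open>On a finite measure space the \<open>L\<^sup>2\<close> norm controls the \<open>L\<^sup>1\<close> norm, so the partial sums
  are bounded in \<open>L\<^sup>1\<close>.\<close>

lemma (in finite_measure) AE_summable_if_L2_geometric:
  assumes a: "\<And>n. a n \<in> elems (L2 M)" "\<And>n. nrm (L2 M) (a n) \<le> (1/2)^n"
  shows "AE x in M. summable (\<lambda>n. \<bar>a n x\<bar>)"
proof -
  have [measurable]: "a n \<in> borel_measurable M" for n using a(1) by (rule L2_measurable)
  have aa: "(\<lambda>x. \<bar>a n x\<bar>) \<in> elems (L2 M)" for n using a(1) by (simp add: L2_mem_iff)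
  define K where "K = sqrt (LINT x|M. 1)"
  have int: "integrable M (\<lambda>x. \<bar>a n x\<bar>)" for n
    using L2_mult_integrable[OF aa const_in_L2[of 1]] by simp
  have le: "(LINT x|M. \<bar>a n x\<bar>) \<le> (1/2)^n * K" for n
  proof -
    have "(LINT x|M. \<bar>a n x\<bar>) \<le> nrm (L2 M) (a n) * K"
      using L2_cauchy_schwarz[OF aa const_in_L2, of n 1] by (simp add: L2_nrm K_def)
    also have "\<dots> \<le> (1/2)^n * K"
      using a(2) by (intro mult_right_mono) (auto simp: K_def)
    finally show ?thesis .
  qed
  have "(\<integral>\<^sup>+x. (\<Sum>n. ennreal \<bar>a n x\<bar>) \<partial>M) = (\<Sum>n. \<integral>\<^sup>+x. ennreal \<bar>a n x\<bar> \<partial>M)"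
    by (intro nn_integral_suminf) auto
  also have "\<dots> = (\<Sum>n. ennreal (LINT x|M. \<bar>a n x\<bar>))"
    using int by (intro suminf_cong nn_integral_eq_integral) auto
  also have "\<dots> \<le> (\<Sum>n. ennreal ((1/2)^n * K))"
    using le by (intro suminf_le ennreal_leI) auto
  also have "\<dots> = ennreal (\<Sum>n. (1/2)^n * K)"
    by (intro suminf_ennreal2 summable_mult2) (auto simp: K_def)
  also have "\<dots> < \<infinity>" by simp
  finally have fin: "(\<integral>\<^sup>+x. (\<Sum>n. ennreal \<bar>a n x\<bar>) \<partial>M) \<noteq> \<infinity>" by simp
  have "AE x in M. (\<Sum>n. ennreal \<bar>a n x\<bar>) \<noteq> \<infinity>"
    by (rule nn_integral_PInf_AE) (use fin in auto)
  then show ?thesis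
    by (rule AE_mp) (auto intro!: AE_I2 summable_suminf_not_top)
qed

text \<open>Fatou's lemma for squares.\<close>

lemma square_integral_limit_le:
  fixes d :: "nat \<Rightarrow> 'a \<Rightarrow> real"
  assumes d[measurable]: "\<And>m. d m \<in> borel_measurable M" and e[measurable]: "e \<in> borel_measurable M"
    and lim: "AE x in M. (\<lambda>m. d m x) \<longlonglongrightarrow> e x"
    and int: "\<And>m. integrable M (\<lambda>x. (d m x)\<^sup>2)" and le: "\<And>m. (LINT x|M. (d m x)\<^sup>2) \<le> C"
  shows "integrable M (\<lambda>x. (e x)\<^sup>2)" "(LINT x|M. (e x)\<^sup>2) \<le> C"
proof -
  have C: "0 \<le> C" by (rule order_trans[OF _ le[of 0]]) simp
  have "(\<integral>\<^sup>+x. ennreal ((e x)\<^sup>2) \<partial>M) = (\<integral>\<^sup>+x. liminf (\<lambda>m. ennreal ((d m x)\<^sup>2)) \<partial>M)"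
    using lim by (intro nn_integral_cong_AE)
      (auto elim!: eventually_mono intro!: lim_imp_Liminf[symmetric] tendsto_ennrealI tendsto_power)
  also have "\<dots> \<le> liminf (\<lambda>m. \<integral>\<^sup>+x. ennreal ((d m x)\<^sup>2) \<partial>M)"
    by (rule nn_integral_liminf) auto
  also have "\<dots> = liminf (\<lambda>m. ennreal (LINT x|M. (d m x)\<^sup>2))"
    using int by (simp add: nn_integral_eq_integral)
  also have "\<dots> \<le> ennreal C"
    by (intro Liminf_le always_eventually allI ennreal_leI le trivial_limit_sequentially)
  finally have *: "(\<integral>\<^sup>+x. ennreal ((e x)\<^sup>2) \<partial>M) \<le> ennreal C" .
  then show I: "integrable M (\<lambda>x. (e x)\<^sup>2)"
    by (intro integrableI_nonneg) (auto intro: le_less_trans)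
  show "(LINT x|M. (e x)\<^sup>2) \<le> C"
    using * C by (subst (asm) nn_integral_eq_integral[OF I]) auto
qed

text \<open>A Cauchy sequence converges as soon as a subsequence does.\<close>

lemma (in seminormed) complete_in_if_geometric_limits:
  assumes lim: "\<And>f :: nat \<Rightarrow> 'v. (\<And>n. f n \<in> elems X) \<Longrightarrow> (\<And>n m. n \<le> m \<Longrightarrow> nrm X (f m - f n) \<le> (1/2)^n) \<Longrightarrow>
    \<exists>u\<in>elems X. (\<lambda>n. nrm X (f n - u)) \<longlonglongrightarrow> 0"
  shows "complete_in X"
  unfolding complete_in_def
proof (intro allI impI)
  fix f :: "nat \<Rightarrow> 'v" assume f: "\<forall>n. f n \<in> elems X"
    and cau: "\<forall>e>0. \<exists>N. \<forall>m\<ge>N. \<forall>n\<ge>N. nrm X (f m - f n) < e"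
  have "\<forall>k. \<exists>N. \<forall>m\<ge>N. \<forall>n\<ge>N. nrm X (f m - f n) < (1/2)^k" using cau by simp
  then obtain R :: "nat \<Rightarrow> nat" where R: "\<And>k m n. m \<ge> R k \<Longrightarrow> n \<ge> R k \<Longrightarrow> nrm X (f m - f n) < (1/2)^k" by metis
  define r where "r k = Max (R ` {..k}) + k" for k
  have rR: "R k \<le> r m" if "k \<le> m" for k m
    unfolding r_def using that by (intro trans_le_add1 Max_ge) auto
  have "nrm X (f (r m) - f (r n)) \<le> (1/2)^n" if "n \<le> m" for m n
    using R[OF rR[OF that] rR[OF order_refl]] by simp
  then obtain u where u: "u \<in> elems X" "(\<lambda>n. nrm X (f (r n) - u)) \<longlonglongrightarrow> 0"
    using lim[of "\<lambda>n. f (r n)"] f by blast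
  have "(\<lambda>n. nrm X (f n - u)) \<longlonglongrightarrow> 0"
  proof (rule LIMSEQ_I)
    fix e :: real assume e: "0 < e"
    then obtain N where N: "\<And>m n. m \<ge> N \<Longrightarrow> n \<ge> N \<Longrightarrow> nrm X (f m - f n) < e / 2"
      using cau half_gt_zero by metis
    obtain K where K: "\<And>n. n \<ge> K \<Longrightarrow> nrm X (f (r n) - u) < e / 2"
      using order_tendstoD(2)[OF u(2), of "e/2"] e by (auto simp: eventually_sequentially)
    have "norm (nrm X (f n - u) - 0) < e" if n: "n \<ge> N + K" for n
    proof -
      have "n \<le> r n" by (simp add: r_def)
      then have "nrm X (f n - f (r n)) < e / 2" using n by (intro N) auto
      moreover have "nrm X (f (r n) - u) < e / 2" using n by (intro K) auto
      ultimately show ?thesis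
        using nrm_triangle[of "f n" "f (r n)" u] f u nrm_nonneg[OF diff_mem, of "f n" u] by auto
    qed
    then show "\<exists>N. \<forall>n\<ge>N. norm (nrm X (f n - u) - 0) < e" by blast
  qed
  then show "\<exists>u\<in>elems X. (\<lambda>n. nrm X (f n - u)) \<longlonglongrightarrow> 0" using u by blast
qed

text \<open>A sequence with geometrically decreasing steps converges almost everywhere, and by Fatou's
  lemma the limit is as close to each member in \<open>L\<^sup>2\<close> as the later members are.\<close>

lemma (in finite_measure) complete_L2: "complete_in (L2 M)"
proof -
  interpret L: semi_inner "L2 M" "\<lambda>f g. LINT x|M. f x * g x" by (rule semi_inner_L2)
  show ?thesis
  proof (rule L.complete_in_if_geometric_limits)
    fix f :: "nat \<Rightarrow> 'a \<Rightarrow> real" assume f: "\<And>n. f n \<in> elems (L2 M)"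
      and cau: "\<And>n m. n \<le> m \<Longrightarrow> nrm (L2 M) (f m - f n) \<le> (1/2)^n"
    have [measurable]: "f n \<in> borel_measurable M" for n using f by (rule L2_measurable)
    define g where "g x = lim (\<lambda>n. f n x)" for x
    have [measurable]: "g \<in> borel_measurable M" unfolding g_def by measurable
    have "AE x in M. summable (\<lambda>n. \<bar>(f (Suc n) - f n) x\<bar>)"
      by (intro AE_summable_if_L2_geometric L.diff_mem f cau) simp
    then have lim: "AE x in M. (\<lambda>n. f n x) \<longlonglongrightarrow> g x"
    proof (rule AE_mp, intro AE_I2 impI)
      fix x assume "summable (\<lambda>n. \<bar>(f (Suc n) - f n) x\<bar>)"
      then have "summable (\<lambda>n. \<bar>f (Suc n) x - f n x\<bar>)" by (simp only: minus_apply)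
      then have "summable (\<lambda>n. f (Suc n) x - f n x)" by (rule summable_rabs_cancel)
      then have "convergent (\<lambda>n. \<Sum>k<n. f (Suc k) x - f k x)" by (simp add: summable_iff_convergent)
      then have "convergent (\<lambda>n. f n x - f 0 x)" by (simp only: sum_lessThan_telescope[of "\<lambda>k. f k x"])
      then have "convergent (\<lambda>n. (f n x - f 0 x) + f 0 x)"
        by (intro convergent_add convergent_const)
      then show "(\<lambda>n. f n x) \<longlonglongrightarrow> g x" by (simp add: g_def convergent_LIMSEQ_iff)
    qed
    have main: "integrable M (\<lambda>x. (f n x - g x)\<^sup>2) \<and> (LINT x|M. (f n x - g x)\<^sup>2) \<le> ((1/2)^n)\<^sup>2" for n
    proof -
      have mem: "f (m + n) - f n \<in> elems (L2 M)" for m using f by (intro L.diff_mem)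
      have ints: "integrable M (\<lambda>x. (f (m + n) x - f n x)\<^sup>2)" for m
        using mem[of m] by (simp add: L2_mem_iff)
      have les: "(LINT x|M. (f (m + n) x - f n x)\<^sup>2) \<le> ((1/2)^n)\<^sup>2" for m
        using cau[of n "m + n"] by (simp add: L2_nrm real_sqrt_le_iff sqrt_le_D)
      have "AE x in M. (\<lambda>m. f (m + n) x - f n x) \<longlonglongrightarrow> g x - f n x"
      proof (rule AE_mp[OF lim], intro AE_I2 impI tendsto_diff tendsto_const)
        fix x assume "(\<lambda>n. f n x) \<longlonglongrightarrow> g x"
        then show "(\<lambda>m. f (m + n) x) \<longlonglongrightarrow> g x" by (rule LIMSEQ_ignore_initial_segment)
      qed
      from square_integral_limit_le[OF _ _ this ints les]
      have "integrable M (\<lambda>x. (g x - f n x)\<^sup>2) \<and> (LINT x|M. (g x - f n x)\<^sup>2) \<le> ((1/2)^n)\<^sup>2"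
        by simp
      moreover have "(g x - f n x)\<^sup>2 = (f n x - g x)\<^sup>2" for x by (rule power2_commute)
      ultimately show ?thesis by simp
    qed
    have fg: "f n - g \<in> elems (L2 M)" for n using main by (simp add: L2_mem_iff fun_diff_def)
    then have "g \<in> elems (L2 M)" using L.diff_mem[OF f fg, of 0 0] by simp
    moreover have "(\<lambda>n. nrm (L2 M) (f n - g)) \<longlonglongrightarrow> 0"
    proof (rule tendsto_sandwich)
      show "\<forall>\<^sub>F n in sequentially. 0 \<le> nrm (L2 M) (f n - g)" using L.nrm_nonneg[OF fg] by simp
      show "\<forall>\<^sub>F n in sequentially. nrm (L2 M) (f n - g) \<le> (1/2)^n"
        using main by (intro always_eventually allI) (simp add: L2_nrm real_le_lsqrt)
    qed (auto intro: LIMSEQ_realpow_zero)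
    ultimately show "\<exists>u\<in>elems (L2 M). (\<lambda>n. nrm (L2 M) (f n - u)) \<longlonglongrightarrow> 0" by blast
  qed
qed

section \<open>Bochner spaces over seminormed spaces\<close>

text \<open>Strong measurability allows arbitrary values on null sets, which real measurability tolerates
  only over complete measures. Finiteness puts all simple functions into the Bochner space.\<close>

locale bochner = seminormed X + finite_measure M + complete_measure M
  for X :: "'v::real_vector nspace" and M :: "'b measure"
begin

lemma simple_in_mem: "simple_in M X s \<Longrightarrow> t \<in> space M \<Longrightarrow> s t \<in> elems X"
  by (auto simp: simple_in_def)

lemma simple_in_compose: "simple_in M X s \<Longrightarrow> simple_function M (\<lambda>t. h (s t))"
  by (rule simple_function_compose1) (simp add: simple_in_def)

lemma simple_in_compose_measurable: "simple_in M X s \<Longrightarrow> (\<lambda>t. h (s t) :: real) \<in> borel_measurable M"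
  by (intro borel_measurable_simple_function simple_in_compose)

lemma simple_in_compose_integrable:
  assumes "simple_in M X s" shows "integrable M (\<lambda>t. h (s t) :: real)"
  using simple_in_compose[OF assms, of h]
  by (intro integrableI_simple_bochner_integrable simple_bochner_integrable.intros)
    (auto simp: emeasure_eq_measure)

lemma strongly_measurableE:
  assumes "strongly_measurable M X f"
  obtains s where "\<And>n. simple_in M X (s n)" "AE t in M. f t \<in> elems X"
    "AE t in M. (\<lambda>n. nrm X (f t - s n t)) \<longlonglongrightarrow> 0"
  using assms by (auto simp: strongly_measurable_def)

lemma strongly_measurable_nrm:
  assumes "strongly_measurable M X f"
  shows "(\<lambda>t. nrm X (f t)) \<in> borel_measurable M"
proof -
  obtain s where s: "\<And>n. simple_in M X (s n)" and f: "AE t in M. f t \<in> elems X"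
    and lim: "AE t in M. (\<lambda>n. nrm X (f t - s n t)) \<longlonglongrightarrow> 0"
    using assms by (rule strongly_measurableE) blast
  have "AE t in M. (\<lambda>n. nrm X (s n t)) \<longlonglongrightarrow> nrm X (f t)"
    using f lim AE_space
  proof eventually_elim
    fix t assume t: "f t \<in> elems X" "(\<lambda>n. nrm X (f t - s n t)) \<longlonglongrightarrow> 0" "t \<in> space M"
    show "(\<lambda>n. nrm X (s n t)) \<longlonglongrightarrow> nrm X (f t)"
    proof (rule LIM_zero_cancel, rule Lim_null_comparison[OF always_eventually t(2)], rule allI)
      fix n
      show "norm (nrm X (s n t) - nrm X (f t)) \<le> nrm X (f t - s n t)"
        using nrm_reverse_triangle[OF t(1) simple_in_mem[OF s t(3)]] by (simp add: abs_minus_commute)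
    qed
  qed
  then show ?thesis by (rule AE_limit_measurable[OF simple_in_compose_measurable[OF s]])
qed

lemma strongly_measurable_combine:
  assumes "strongly_measurable M X f" "strongly_measurable M X g"
  shows "strongly_measurable M X (\<lambda>t. \<alpha> *\<^sub>R f t + \<beta> *\<^sub>R g t)"
proof -
  obtain s where s: "\<And>n. simple_in M X (s n)" and f: "AE t in M. f t \<in> elems X"
    and lim: "AE t in M. (\<lambda>n. nrm X (f t - s n t)) \<longlonglongrightarrow> 0"
    using assms(1) by (rule strongly_measurableE) blast
  obtain s' where s': "\<And>n. simple_in M X (s' n)" and g: "AE t in M. g t \<in> elems X"
    and lim': "AE t in M. (\<lambda>n. nrm X (g t - s' n t)) \<longlonglongrightarrow> 0"
    using assms(2) by (rule strongly_measurableE) blast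
  have "AE t in M. \<alpha> *\<^sub>R f t + \<beta> *\<^sub>R g t \<in> elems X"
    using f g by eventually_elim (intro add_mem scale_mem)
  moreover have "simple_in M X (\<lambda>t. \<alpha> *\<^sub>R s n t + \<beta> *\<^sub>R s' n t)" for n
    using s[of n] s'[of n] simple_function_compose2[of M "s n" "s' n" "\<lambda>u v. \<alpha> *\<^sub>R u + \<beta> *\<^sub>R v"]
    unfolding simple_in_def by (auto intro!: add_mem scale_mem)
  moreover have "AE t in M. (\<lambda>n. nrm X (\<alpha> *\<^sub>R f t + \<beta> *\<^sub>R g t - (\<alpha> *\<^sub>R s n t + \<beta> *\<^sub>R s' n t))) \<longlonglongrightarrow> 0"
    using f g lim lim' AE_space
  proof eventually_elim
    fix t assume t: "f t \<in> elems X" "g t \<in> elems X" "(\<lambda>n. nrm X (f t - s n t)) \<longlonglongrightarrow> 0"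
      "(\<lambda>n. nrm X (g t - s' n t)) \<longlonglongrightarrow> 0" "t \<in> space M"
    have sn: "s n t \<in> elems X" "s' n t \<in> elems X" for n using simple_in_mem s s' t(5) by auto
    have eq: "\<alpha> *\<^sub>R f t + \<beta> *\<^sub>R g t - (\<alpha> *\<^sub>R s n t + \<beta> *\<^sub>R s' n t)
      = \<alpha> *\<^sub>R (f t - s n t) + \<beta> *\<^sub>R (g t - s' n t)" for n
      by (simp add: algebra_simps)
    have m: "\<alpha> *\<^sub>R (f t - s n t) \<in> elems X" "\<beta> *\<^sub>R (g t - s' n t) \<in> elems X" for n
      using t(1,2) sn by (auto intro!: scale_mem diff_mem)
    have "(\<lambda>n. \<bar>\<alpha>\<bar> * nrm X (f t - s n t) + \<bar>\<beta>\<bar> * nrm X (g t - s' n t)) \<longlonglongrightarrow> \<bar>\<alpha>\<bar> * 0 + \<bar>\<beta>\<bar> * 0"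
      by (intro tendsto_intros t(3,4))
    then have z: "(\<lambda>n. \<bar>\<alpha>\<bar> * nrm X (f t - s n t) + \<bar>\<beta>\<bar> * nrm X (g t - s' n t)) \<longlonglongrightarrow> 0" by simp
    show "(\<lambda>n. nrm X (\<alpha> *\<^sub>R f t + \<beta> *\<^sub>R g t - (\<alpha> *\<^sub>R s n t + \<beta> *\<^sub>R s' n t))) \<longlonglongrightarrow> 0"
    proof (rule Lim_null_comparison[OF always_eventually z], rule allI)
      fix n
      have "nrm X (\<alpha> *\<^sub>R (f t - s n t) + \<beta> *\<^sub>R (g t - s' n t))
          \<le> nrm X (\<alpha> *\<^sub>R (f t - s n t)) + nrm X (\<beta> *\<^sub>R (g t - s' n t))"
        by (rule nrm_add[OF m])
      also have "\<dots> = \<bar>\<alpha>\<bar> * nrm X (f t - s n t) + \<bar>\<beta>\<bar> * nrm X (g t - s' n t)"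
        using t(1,2) sn by (simp add: nrm_scale diff_mem)
      finally show "norm (nrm X (\<alpha> *\<^sub>R f t + \<beta> *\<^sub>R g t - (\<alpha> *\<^sub>R s n t + \<beta> *\<^sub>R s' n t)))
          \<le> \<bar>\<alpha>\<bar> * nrm X (f t - s n t) + \<bar>\<beta>\<bar> * nrm X (g t - s' n t)"
        using nrm_nonneg[OF add_mem[OF m]] by (simp add: eq)
    qed
  qed
  ultimately show ?thesis unfolding strongly_measurable_def
    by (intro conjI exI[of _ "\<lambda>n t. \<alpha> *\<^sub>R s n t + \<beta> *\<^sub>R s' n t"]) auto
qed

lemma strongly_measurable_apply:
  assumes f: "strongly_measurable M X f" and l: "strongly_measurable M (dual X) l"
  shows "(\<lambda>t. l t (f t)) \<in> borel_measurable M"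
proof -
  interpret d: seminormed "dual X" by (rule seminormed_dual)
  interpret D: bochner "dual X" M by unfold_locales
  obtain s where s: "\<And>n. simple_in M X (s n)" and fX: "AE t in M. f t \<in> elems X"
    and lim: "AE t in M. (\<lambda>n. nrm X (f t - s n t)) \<longlonglongrightarrow> 0"
    using f by (rule strongly_measurableE) blast
  obtain r where r: "\<And>n. simple_in M (dual X) (r n)" and lX: "AE t in M. l t \<in> elems (dual X)"
    and lim': "AE t in M. (\<lambda>n. nrm (dual X) (l t - r n t)) \<longlonglongrightarrow> 0"
    using l by (rule D.strongly_measurableE) blast
  have "AE t in M. (\<lambda>n. r n t (s n t)) \<longlonglongrightarrow> l t (f t)"
    using fX lX lim lim' AE_space
  proof eventually_elim
    fix t assume t: "f t \<in> elems X" "l t \<in> elems (dual X)" "(\<lambda>n. nrm X (f t - s n t)) \<longlonglongrightarrow> 0"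
      "(\<lambda>n. nrm (dual X) (l t - r n t)) \<longlonglongrightarrow> 0" "t \<in> space M"
    have sn: "s n t \<in> elems X" for n using simple_in_mem s t(5) by auto
    have rn: "r n t \<in> elems (dual X)" for n using D.simple_in_mem r t(5) by auto
    have "(\<lambda>n. nrm (dual X) (l t - r n t) * (nrm X (f t) + nrm X (f t - s n t))
        + nrm (dual X) (l t) * nrm X (f t - s n t)) \<longlonglongrightarrow> 0 * (nrm X (f t) + 0) + nrm (dual X) (l t) * 0"
      by (intro tendsto_intros t)
    then have z: "(\<lambda>n. nrm (dual X) (l t - r n t) * (nrm X (f t) + nrm X (f t - s n t))
        + nrm (dual X) (l t) * nrm X (f t - s n t)) \<longlonglongrightarrow> 0" by simp
    show "(\<lambda>n. r n t (s n t)) \<longlonglongrightarrow> l t (f t)"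
    proof (rule LIM_zero_cancel, rule Lim_null_comparison[OF always_eventually z], rule allI)
      fix n
      have "\<bar>(l t - r n t) (s n t)\<bar> \<le> nrm (dual X) (l t - r n t) * nrm X (s n t)"
        by (intro dual_bound d.diff_mem t rn sn)
      also have "\<dots> \<le> nrm (dual X) (l t - r n t) * (nrm X (f t) + nrm X (f t - s n t))"
        using nrm_reverse_triangle[OF t(1) sn, of n] d.nrm_nonneg[OF d.diff_mem[OF t(2) rn]]
        by (intro mult_left_mono) auto
      finally have 1: "\<bar>l t (s n t) - r n t (s n t)\<bar>
        \<le> nrm (dual X) (l t - r n t) * (nrm X (f t) + nrm X (f t - s n t))" by simp
      have 2: "\<bar>l t (f t) - l t (s n t)\<bar> \<le> nrm (dual X) (l t) * nrm X (f t - s n t)"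
        using dual_bound[OF t(2) diff_mem[OF t(1) sn]] dual_diff[OF t(2) t(1) sn] by simp
      show "norm (r n t (s n t) - l t (f t)) \<le> nrm (dual X) (l t - r n t) *
          (nrm X (f t) + nrm X (f t - s n t)) + nrm (dual X) (l t) * nrm X (f t - s n t)"
        using 1 2 by (simp add: abs_le_iff)
    qed
  qed
  then show ?thesis
  proof (rule AE_limit_measurable[rotated])
    fix n
    have "simple_function M (\<lambda>t. r n t (s n t))"
      using r[of n] s[of n]
      by (intro simple_function_compose2[of M "r n" "s n" "\<lambda>k v. k v"]) (auto simp: simple_in_def)
    then show "(\<lambda>t. r n t (s n t)) \<in> borel_measurable M" by (rule borel_measurable_simple_function)
  qed
qed

lemma strongly_measurable_const:
  assumes "v \<in> elems X" shows "strongly_measurable M X (\<lambda>_. v)"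
proof -
  have "simple_in M X (\<lambda>_. v)" using assms by (auto simp: simple_in_def)
  then show ?thesis using assms nrm_zero
    unfolding strongly_measurable_def by (intro conjI exI[of _ "\<lambda>_ _. v"]) auto
qed

lemma bochner_L2_mem_iff:
  "f \<in> elems (bochner_L2 M X) \<longleftrightarrow> strongly_measurable M X f \<and> integrable M (\<lambda>t. (nrm X (f t))\<^sup>2)"
  by (simp add: bochner_L2_def)

lemma bochner_L2_nrm: "nrm (bochner_L2 M X) f = sqrt (LINT t|M. (nrm X (f t))\<^sup>2)"
  by (simp add: bochner_L2_def)

lemma bochner_L2_AE_mem: "f \<in> elems (bochner_L2 M X) \<Longrightarrow> AE t in M. f t \<in> elems X"
  by (auto simp: bochner_L2_mem_iff strongly_measurable_def)

lemma bochner_L2_nrm_in_L2: "f \<in> elems (bochner_L2 M X) \<Longrightarrow> (\<lambda>t. nrm X (f t)) \<in> elems (L2 M)"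
  using strongly_measurable_nrm by (auto simp: bochner_L2_mem_iff L2_mem_iff)

lemma bochner_L2_nrm_eq: "nrm (bochner_L2 M X) f = nrm (L2 M) (\<lambda>t. nrm X (f t))"
  by (simp add: bochner_L2_nrm L2_nrm)

lemma bochner_L2_combine:
  assumes f: "f \<in> elems (bochner_L2 M X)" and g: "g \<in> elems (bochner_L2 M X)"
  shows "(\<lambda>t. \<alpha> *\<^sub>R f t + \<beta> *\<^sub>R g t) \<in> elems (bochner_L2 M X)"
  unfolding bochner_L2_mem_iff
proof
  interpret L: semi_inner "L2 M" "\<lambda>f g. LINT x|M. f x * g x" by (rule semi_inner_L2)
  let ?h = "\<lambda>t. \<alpha> *\<^sub>R f t + \<beta> *\<^sub>R g t"
  show h: "strongly_measurable M X ?h"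
    using f g by (intro strongly_measurable_combine) (auto simp: bochner_L2_mem_iff)
  have "\<bar>\<alpha>\<bar> *\<^sub>R (\<lambda>t. nrm X (f t)) + \<bar>\<beta>\<bar> *\<^sub>R (\<lambda>t. nrm X (g t)) \<in> elems (L2 M)"
    using f g by (intro L.add_mem L.scale_mem bochner_L2_nrm_in_L2)
  then have int: "integrable M (\<lambda>t. (\<bar>\<alpha>\<bar> * nrm X (f t) + \<bar>\<beta>\<bar> * nrm X (g t))\<^sup>2)"
    by (simp add: L2_mem_iff scaleR_fun_def)
  show "integrable M (\<lambda>t. (nrm X (?h t))\<^sup>2)"
  proof (rule Bochner_Integration.integrable_bound[OF int])
    show "(\<lambda>t. (nrm X (?h t))\<^sup>2) \<in> borel_measurable M"
      using strongly_measurable_nrm[OF h] by measurable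
    show "AE t in M. norm ((nrm X (?h t))\<^sup>2) \<le> norm ((\<bar>\<alpha>\<bar> * nrm X (f t) + \<bar>\<beta>\<bar> * nrm X (g t))\<^sup>2)"
      using bochner_L2_AE_mem[OF f] bochner_L2_AE_mem[OF g]
    proof eventually_elim
      fix t assume t: "f t \<in> elems X" "g t \<in> elems X"
      have "nrm X (?h t) \<le> nrm X (\<alpha> *\<^sub>R f t) + nrm X (\<beta> *\<^sub>R g t)"
        using t by (intro nrm_add scale_mem)
      then have "nrm X (?h t) \<le> \<bar>\<alpha>\<bar> * nrm X (f t) + \<bar>\<beta>\<bar> * nrm X (g t)"
        using t by (simp add: nrm_scale)
      moreover have "0 \<le> nrm X (?h t)" using t by (intro nrm_nonneg add_mem scale_mem)
      ultimately show "norm ((nrm X (?h t))\<^sup>2) \<le> norm ((\<bar>\<alpha>\<bar> * nrm X (f t) + \<bar>\<beta>\<bar> * nrm X (g t))\<^sup>2)"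
        by (auto intro!: power_mono)
    qed
  qed
qed

lemma bochner_L2_add: "f \<in> elems (bochner_L2 M X) \<Longrightarrow> g \<in> elems (bochner_L2 M X) \<Longrightarrow> f + g \<in> elems (bochner_L2 M X)"
  using bochner_L2_combine[of f g 1 1] by (simp add: plus_fun_def)

lemma bochner_L2_diff: "f \<in> elems (bochner_L2 M X) \<Longrightarrow> g \<in> elems (bochner_L2 M X) \<Longrightarrow> f - g \<in> elems (bochner_L2 M X)"
  using bochner_L2_combine[of f g 1 "-1"] by (simp add: fun_diff_def)

lemma bochner_L2_scale: "f \<in> elems (bochner_L2 M X) \<Longrightarrow> c *\<^sub>R f \<in> elems (bochner_L2 M X)"
  using bochner_L2_combine[of f f c 0] by (simp add: scaleR_fun_def)

lemma simple_in_bochner_L2: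
  assumes "simple_in M X s" shows "s \<in> elems (bochner_L2 M X)"
  unfolding bochner_L2_mem_iff
proof
  show "strongly_measurable M X s"
    using assms nrm_zero unfolding strongly_measurable_def
    by (intro conjI exI[of _ "\<lambda>_. s"] AE_I2) (auto simp: simple_in_def)
  show "integrable M (\<lambda>t. (nrm X (s t))\<^sup>2)" by (rule simple_in_compose_integrable[OF assms])
qed

lemma bochner_L2_integrable_apply:
  assumes f: "f \<in> elems (bochner_L2 M X)" and l: "l \<in> elems (bochner_L2 M (dual X))"
  shows "integrable M (\<lambda>t. l t (f t))"
    and "\<bar>LINT t|M. l t (f t)\<bar> \<le> nrm (bochner_L2 M (dual X)) l * nrm (bochner_L2 M X) f"
proof -
  interpret d: seminormed "dual X" by (rule seminormed_dual)
  interpret D: bochner "dual X" M by unfold_locales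
  have m: "(\<lambda>t. l t (f t)) \<in> borel_measurable M"
    using f l by (intro strongly_measurable_apply) (auto simp: bochner_L2_mem_iff D.bochner_L2_mem_iff)
  have int: "integrable M (\<lambda>t. nrm (dual X) (l t) * nrm X (f t))"
    by (intro L2_mult_integrable D.bochner_L2_nrm_in_L2 bochner_L2_nrm_in_L2 f l)
  have le: "AE t in M. \<bar>l t (f t)\<bar> \<le> nrm (dual X) (l t) * nrm X (f t)"
    using bochner_L2_AE_mem[OF f] D.bochner_L2_AE_mem[OF l] by eventually_elim (rule dual_bound)
  show i: "integrable M (\<lambda>t. l t (f t))"
    by (rule Bochner_Integration.integrable_bound[OF int m])
      (use le in \<open>auto elim!: eventually_mono intro: order_trans\<close>)
  have "\<bar>LINT t|M. l t (f t)\<bar> \<le> (LINT t|M. \<bar>l t (f t)\<bar>)" by (rule integral_abs_bound)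
  also have "\<dots> \<le> (LINT t|M. nrm (dual X) (l t) * nrm X (f t))"
    using i int le by (intro integral_mono_AE) auto
  also have "\<dots> \<le> nrm (bochner_L2 M (dual X)) l * nrm (bochner_L2 M X) f"
    using L2_cauchy_schwarz[OF D.bochner_L2_nrm_in_L2[OF l] bochner_L2_nrm_in_L2[OF f]]
    by (simp add: bochner_L2_nrm D.bochner_L2_nrm)
  finally show "\<bar>LINT t|M. l t (f t)\<bar> \<le> nrm (bochner_L2 M (dual X)) l * nrm (bochner_L2 M X) f" .
qed

text \<open>Cutting off the approximating simple functions where they exceed twice the seminorm of
  \<open>f\<close> gives them the square integrable majorant \<open>3 * nrm X (f t)\<close>.\<close>

lemma simple_dense_in_bochner_L2:
  assumes f: "f \<in> elems (bochner_L2 M X)"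
  obtains s where "\<And>n. simple_in M X (s n)" "\<And>n. nrm (bochner_L2 M X) (f - s n) \<le> (1/2)^n"
proof -
  have sm: "strongly_measurable M X f" using f by (simp add: bochner_L2_mem_iff)
  obtain s where s: "\<And>n. simple_in M X (s n)" and fX: "AE t in M. f t \<in> elems X"
    and lim: "AE t in M. (\<lambda>n. nrm X (f t - s n t)) \<longlonglongrightarrow> 0"
    using sm by (rule strongly_measurableE) blast
  define q where "q n t = (if nrm X (s n t) \<le> 2 * nrm X (f t) then s n t else 0)" for n t
  note [measurable] = strongly_measurable_nrm[OF sm] simple_in_compose_measurable[OF s, of "nrm X"]
  have q: "simple_in M X (q n)" for n
  proof -
    have "simple_function M (q n)"
      unfolding q_def using s[of n] by (intro simple_function_If) (auto simp: simple_in_def)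
    then show ?thesis using s[of n] zero_mem by (auto simp: simple_in_def q_def)
  qed
  have fq: "f - q n \<in> elems (bochner_L2 M X)" for n
    by (intro bochner_L2_diff f simple_in_bochner_L2 q)
  have "(\<lambda>n. LINT t|M. (nrm X ((f - q n) t))\<^sup>2) \<longlonglongrightarrow> (LINT t|M. 0)"
  proof (rule integral_dominated_convergence)
    show "integrable M (\<lambda>t. 9 * (nrm X (f t))\<^sup>2)" using f by (auto simp: bochner_L2_mem_iff)
    show "(\<lambda>t. (nrm X ((f - q n) t))\<^sup>2) \<in> borel_measurable M" for n
      using bochner_L2_nrm_in_L2[OF fq, of n] by (auto simp: L2_mem_iff)
    show "AE t in M. (\<lambda>n. (nrm X ((f - q n) t))\<^sup>2) \<longlonglongrightarrow> 0"
      using fX lim AE_space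
    proof eventually_elim
      fix t assume t: "f t \<in> elems X" "(\<lambda>n. nrm X (f t - s n t)) \<longlonglongrightarrow> 0" "t \<in> space M"
      have sn: "s n t \<in> elems X" for n using simple_in_mem[OF s t(3)] .
      have "(\<lambda>n. nrm X (f t - q n t)) \<longlonglongrightarrow> 0"
      proof (cases "nrm X (f t) = 0")
        case True
        have "nrm X (f t - q n t) = 0" for n
          using True t(1) sn[of n] nrm_nonneg[OF sn, of n] nrm_diff[OF t(1) sn, of n]
            nrm_nonneg[OF diff_mem[OF t(1) sn], of n] by (auto simp: q_def)
        then show ?thesis by simp
      next
        case False
        then have pos: "0 < nrm X (f t)" using nrm_nonneg[OF t(1)] by simp
        have "\<forall>\<^sub>F n in sequentially. nrm X (f t - q n t) = nrm X (f t - s n t)"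
          using order_tendstoD(2)[OF t(2) pos]
        proof eventually_elim
          fix n assume "nrm X (f t - s n t) < nrm X (f t)"
          then have "nrm X (s n t) \<le> 2 * nrm X (f t)"
            using nrm_reverse_triangle[OF t(1) sn, of n] by simp
          then show "nrm X (f t - q n t) = nrm X (f t - s n t)" by (simp add: q_def)
        qed
        then show ?thesis using t(2) by (simp add: tendsto_cong)
      qed
      from tendsto_power[OF this, of 2] show "(\<lambda>n. (nrm X ((f - q n) t))\<^sup>2) \<longlonglongrightarrow> 0" by simp
    qed
    show "AE t in M. norm ((nrm X ((f - q n) t))\<^sup>2) \<le> 9 * (nrm X (f t))\<^sup>2" for n
      using fX AE_space
    proof eventually_elim
      fix t assume t: "f t \<in> elems X" "t \<in> space M"
      have qX: "q n t \<in> elems X" using simple_in_mem[OF q t(2)] .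
      have "nrm X (q n t) \<le> 2 * nrm X (f t)" using nrm_nonneg[OF t(1)] nrm_zero by (auto simp: q_def)
      then have "nrm X (f t - q n t) \<le> 3 * nrm X (f t)" using nrm_diff[OF t(1) qX] by simp
      then have "(nrm X (f t - q n t))\<^sup>2 \<le> (3 * nrm X (f t))\<^sup>2"
        using nrm_nonneg[OF diff_mem[OF t(1) qX]] by (intro power_mono)
      then show "norm ((nrm X ((f - q n) t))\<^sup>2) \<le> 9 * (nrm X (f t))\<^sup>2"
        by (simp add: power_mult_distrib)
    qed
  qed simp
  then have "(\<lambda>n. nrm (bochner_L2 M X) (f - q n)) \<longlonglongrightarrow> 0"
    using tendsto_real_sqrt by (fastforce simp: bochner_L2_nrm)
  then have "\<exists>N. nrm (bochner_L2 M X) (f - q N) \<le> (1/2)^n" for n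
  proof -
    assume "(\<lambda>n. nrm (bochner_L2 M X) (f - q n)) \<longlonglongrightarrow> 0"
    then have "\<forall>\<^sub>F k in sequentially. nrm (bochner_L2 M X) (f - q k) < (1/2)^n"
      by (rule order_tendstoD) simp
    then obtain N where "nrm (bochner_L2 M X) (f - q N) < (1/2)^n"
      using eventually_happens'[OF trivial_limit_sequentially] by blast
    then show ?thesis by (intro exI[of _ N]) simp
  qed
  then obtain r where "\<And>n. nrm (bochner_L2 M X) (f - q (r n)) \<le> (1/2)^n" by metis
  with q show ?thesis by (intro that[of "\<lambda>n. q (r n)"])
qed

text \<open>The functional is linear on the whole ambient space, as is the evaluation of functionals at a
  fixed element, for which this will be used.\<close>

lemma bochner_integral_apply:
  assumes I: "bochner_integral_in M X f I" and l: "linear l" "\<And>u. u \<in> elems X \<Longrightarrow> \<bar>l u\<bar> \<le> C * nrm X u"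
  shows "l I = (LINT t|M. l (f t))"
proof -
  obtain s where s: "\<And>n. simple_in M X (s n)"
    and s1: "(\<lambda>n. \<integral>\<^sup>+t. ennreal (nrm X (f t - s n t)) \<partial>M) \<longlonglongrightarrow> 0"
    and s2: "(\<lambda>n. nrm X (Bochner_Integration.simple_bochner_integral M (s n) - I)) \<longlonglongrightarrow> 0"
    using I by (auto simp: bochner_integral_in_def)
  have sm: "strongly_measurable M X f" and IX: "I \<in> elems X" using I by (auto simp: bochner_integral_in_def)
  have fX: "AE t in M. f t \<in> elems X" using sm by (auto simp: strongly_measurable_def)
  interpret l: linear l by (rule l(1))
  define K where "K = max 0 C"
  have K: "0 \<le> K" "\<bar>l u\<bar> \<le> K * nrm X u" if "u \<in> elems X" for u
  proof -
    have "C * nrm X u \<le> K * nrm X u"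
      using nrm_nonneg[OF that] by (intro mult_right_mono) (auto simp: K_def)
    then show "\<bar>l u\<bar> \<le> K * nrm X u" using l(2)[OF that] by simp
  qed (simp add: K_def)
  have lD: "l \<in> elems (dual X)"
    using l(2) unfolding dual_mem_iff by (auto simp: l.add l.scale)
  interpret d: seminormed "dual X" by (rule seminormed_dual)
  interpret D: bochner "dual X" M by unfold_locales
  have lm[measurable]: "(\<lambda>t. l (f t)) \<in> borel_measurable M"
    by (rule strongly_measurable_apply[OF sm D.strongly_measurable_const[OF lD]])
  have sb: "Bochner_Integration.simple_bochner_integrable M (s n)" for n
    using s[of n] unfolding simple_bochner_integrable.simps by (auto simp: simple_in_def emeasure_eq_measure)
  have ls: "l (Bochner_Integration.simple_bochner_integral M (s n)) = (LINT t|M. l (s n t))" for n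
  proof -
    have sl: "Bochner_Integration.simple_bochner_integrable M (\<lambda>t. l (s n t))"
      using simple_in_compose[OF s, of l] by (intro simple_bochner_integrable.intros)
        (auto simp: emeasure_eq_measure)
    show ?thesis
      using simple_bochner_integral_linear[OF l(1) sb] simple_bochner_integrable_eq_integral[OF sl]
      by simp
  qed
  have sX: "Bochner_Integration.simple_bochner_integral M (s n) \<in> elems X" for n
  proof -
    have sum_mem: "(\<Sum>y\<in>A. g y *\<^sub>R y) \<in> elems X" if "finite A" "A \<subseteq> elems X" for A and g :: "'v \<Rightarrow> real"
      using that by (induction A) (auto intro: zero_mem add_mem scale_mem)
    show ?thesis unfolding simple_bochner_integral_def
      using s[of n] by (intro sum_mem) (auto simp: simple_in_def simple_function_def)
  qed
  \<comment> \<open>The right-hand side is a limit of integrals of real simple functions in \<open>L\<^sup>1\<close>.\<close>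
  have le: "(\<integral>\<^sup>+t. ennreal (norm (l (f t) - l (s n t))) \<partial>M)
      \<le> ennreal K * (\<integral>\<^sup>+t. ennreal (nrm X (f t - s n t)) \<partial>M)" for n
  proof -
    have sms: "strongly_measurable M X (s n)"
      using simple_in_bochner_L2[OF s, of n] by (simp add: bochner_L2_mem_iff)
    have "strongly_measurable M X (\<lambda>t. f t - s n t)"
      using strongly_measurable_combine[OF sm sms, of 1 "-1"] by simp
    note [measurable] = strongly_measurable_nrm[OF this]
    have "(\<integral>\<^sup>+t. ennreal (norm (l (f t) - l (s n t))) \<partial>M)
        \<le> (\<integral>\<^sup>+t. ennreal K * ennreal (nrm X (f t - s n t)) \<partial>M)"
    proof (rule nn_integral_mono_AE)
      show "AE t in M. ennreal (norm (l (f t) - l (s n t))) \<le> ennreal K * ennreal (nrm X (f t - s n t))"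
        using fX AE_space
      proof eventually_elim
        fix t assume t: "f t \<in> elems X" "t \<in> space M"
        have "f t - s n t \<in> elems X" using t simple_in_mem[OF s] by (intro diff_mem) auto
        from K[OF this] nrm_nonneg[OF this]
        show "ennreal (norm (l (f t) - l (s n t))) \<le> ennreal K * ennreal (nrm X (f t - s n t))"
          by (simp add: l.diff ennreal_mult[symmetric])
      qed
    qed
    also have "\<dots> = ennreal K * (\<integral>\<^sup>+t. ennreal (nrm X (f t - s n t)) \<partial>M)"
      by (rule nn_integral_cmult) measurable
    finally show ?thesis .
  qed
  have z: "(\<lambda>n. \<integral>\<^sup>+t. ennreal (norm (l (f t) - l (s n t))) \<partial>M) \<longlonglongrightarrow> 0"
  proof (rule tendsto_sandwich[OF always_eventually always_eventually tendsto_const])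
    show "(\<lambda>n. ennreal K * (\<integral>\<^sup>+t. ennreal (nrm X (f t - s n t)) \<partial>M)) \<longlonglongrightarrow> 0"
      using ennreal_tendsto_cmult[OF _ s1, of "ennreal K"] by simp
  qed (use le in auto)
  have "has_bochner_integral M (\<lambda>t. l (f t)) (l I)"
  proof (rule has_bochner_integral.intros[of _ M "\<lambda>n t. l (s n t)"])
    show "Bochner_Integration.simple_bochner_integrable M (\<lambda>t. l (s n t))" for n
      using simple_in_compose[OF s, of l] by (intro simple_bochner_integrable.intros)
        (auto simp: emeasure_eq_measure)
    show "(\<lambda>n. Bochner_Integration.simple_bochner_integral M (\<lambda>t. l (s n t))) \<longlonglongrightarrow> l I"
    proof (rule LIM_zero_cancel)
      have b: "\<bar>l (Bochner_Integration.simple_bochner_integral M (s n)) - l I\<bar>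
          \<le> K * nrm X (Bochner_Integration.simple_bochner_integral M (s n) - I)" for n
        using K(2)[OF diff_mem[OF sX IX], of n] by (simp add: l.diff)
      have "(\<lambda>n. K * nrm X (Bochner_Integration.simple_bochner_integral M (s n) - I)) \<longlonglongrightarrow> 0"
        using tendsto_mult_left[OF s2, of K] by simp
      then show "(\<lambda>n. Bochner_Integration.simple_bochner_integral M (\<lambda>t. l (s n t)) - l I) \<longlonglongrightarrow> 0"
        by (rule Lim_null_comparison[rotated])
          (use b simple_bochner_integral_linear[OF l(1) sb] in auto)
    qed
  qed (use z in auto)
  then show ?thesis by (simp add: has_bochner_integral_integral_eq)
qed

text \<open>An identity that holds at almost every time for each fixed test element may be tested with a
  strongly measurable function, since the simple functions approximating it have altogether only
  countably many values.\<close>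

lemma AE_apply_zero:
  assumes L: "AE t in M. L t \<in> elems (dual X)"
    and zero: "\<And>v. v \<in> elems X \<Longrightarrow> AE t in M. L t v = (0 :: real)"
    and p: "strongly_measurable M X p"
  shows "AE t in M. L t (p t) = 0"
proof -
  obtain s where s: "\<And>n. simple_in M X (s n)" and pX: "AE t in M. p t \<in> elems X"
    and lim: "AE t in M. (\<lambda>n. nrm X (p t - s n t)) \<longlonglongrightarrow> 0"
    using p by (rule strongly_measurableE) blast
  define V where "V = (\<Union>n. s n ` space M)"
  have V: "countable V" "V \<subseteq> elems X"
    using s unfolding V_def by (auto simp: simple_in_def simple_function_def intro: countable_finite)
  have "AE t in M. \<forall>v\<in>V. L t v = 0"
    using zero V by (subst AE_ball_countable) auto
  then show ?thesis
    using L pX lim AE_space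
  proof eventually_elim
    fix t assume t: "\<forall>v\<in>V. L t v = 0" "L t \<in> elems (dual X)" "p t \<in> elems X"
      "(\<lambda>n. nrm X (p t - s n t)) \<longlonglongrightarrow> 0" "t \<in> space M"
    have sX: "s n t \<in> elems X" for n using simple_in_mem[OF s t(5)] .
    have "\<bar>L t (p t)\<bar> \<le> nrm (dual X) (L t) * nrm X (p t - s n t)" for n
    proof -
      have "L t (s n t) = 0" using t(1,5) by (auto simp: V_def)
      then show ?thesis
        using dual_bound[OF t(2) diff_mem[OF t(3) sX], of n] dual_diff[OF t(2,3) sX, of n] by simp
    qed
    moreover have "(\<lambda>n. nrm (dual X) (L t) * nrm X (p t - s n t)) \<longlonglongrightarrow> nrm (dual X) (L t) * 0"
      by (intro tendsto_intros t(4))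
    ultimately have "\<bar>L t (p t)\<bar> \<le> nrm (dual X) (L t) * 0"
      by (intro LIMSEQ_le_const) auto
    then show "L t (p t) = 0" by simp
  qed
qed

end

lemma (in semi_inner) strongly_measurable_form:
  assumes M: "bochner X M" and f: "strongly_measurable M X f" and g: "strongly_measurable M X g"
  shows "(\<lambda>t. b (f t) (g t)) \<in> borel_measurable M"
proof -
  interpret B: bochner X M by (rule M)
  obtain s where s: "\<And>n. simple_in M X (s n)" and fX: "AE t in M. f t \<in> elems X"
    and lim: "AE t in M. (\<lambda>n. nrm X (f t - s n t)) \<longlonglongrightarrow> 0"
    using f by (rule B.strongly_measurableE) blast
  obtain r where r: "\<And>n. simple_in M X (r n)" and gX: "AE t in M. g t \<in> elems X"
    and lim': "AE t in M. (\<lambda>n. nrm X (g t - r n t)) \<longlonglongrightarrow> 0"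
    using g by (rule B.strongly_measurableE) blast
  have "AE t in M. (\<lambda>n. b (s n t) (r n t)) \<longlonglongrightarrow> b (f t) (g t)"
    using fX gX lim lim' AE_space
  proof eventually_elim
    fix t assume t: "f t \<in> elems X" "g t \<in> elems X" "(\<lambda>n. nrm X (f t - s n t)) \<longlonglongrightarrow> 0"
      "(\<lambda>n. nrm X (g t - r n t)) \<longlonglongrightarrow> 0" "t \<in> space M"
    have sn: "s n t \<in> elems X" "r n t \<in> elems X" for n using B.simple_in_mem s r t(5) by auto
    have "(\<lambda>n. nrm X (f t - s n t) * nrm X (g t)
        + (nrm X (f t) + nrm X (f t - s n t)) * nrm X (g t - r n t))
        \<longlonglongrightarrow> 0 * nrm X (g t) + (nrm X (f t) + 0) * 0"
      by (intro tendsto_intros t)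
    then have z: "(\<lambda>n. nrm X (f t - s n t) * nrm X (g t)
        + (nrm X (f t) + nrm X (f t - s n t)) * nrm X (g t - r n t)) \<longlonglongrightarrow> 0" by simp
    show "(\<lambda>n. b (s n t) (r n t)) \<longlonglongrightarrow> b (f t) (g t)"
    proof (rule LIM_zero_cancel, rule Lim_null_comparison[OF always_eventually z], rule allI)
      fix n
      have "nrm X (s n t) * nrm X (g t - r n t)
          \<le> (nrm X (f t) + nrm X (f t - s n t)) * nrm X (g t - r n t)"
        using nrm_reverse_triangle[OF t(1) sn(1), of n] nrm_nonneg[OF diff_mem[OF t(2) sn(2)], of n]
        by (intro mult_right_mono) auto
      then show "norm (b (s n t) (r n t) - b (f t) (g t)) \<le> nrm X (f t - s n t) * nrm X (g t)
          + (nrm X (f t) + nrm X (f t - s n t)) * nrm X (g t - r n t)"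
        using form_diff_bound[OF t(1,2) sn, of n n] by (simp add: abs_minus_commute)
    qed
  qed
  then show ?thesis
  proof (rule B.AE_limit_measurable[rotated])
    fix n
    have "simple_function M (\<lambda>t. b (s n t) (r n t))"
      using r[of n] s[of n] by (intro simple_function_compose2[of M "s n" "r n" b]) (auto simp: simple_in_def)
    then show "(\<lambda>t. b (s n t) (r n t)) \<in> borel_measurable M" by (rule borel_measurable_simple_function)
  qed
qed

lemma (in semi_inner) bochner_L2_form_integrable:
  assumes M: "bochner X M" and f: "f \<in> elems (bochner_L2 M X)" and g: "g \<in> elems (bochner_L2 M X)"
  shows "integrable M (\<lambda>t. b (f t) (g t))"
proof -
  interpret B: bochner X M by (rule M)
  show ?thesis
  proof (rule Bochner_Integration.integrable_bound)
    show "integrable M (\<lambda>t. nrm X (f t) * nrm X (g t))"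
      by (intro L2_mult_integrable B.bochner_L2_nrm_in_L2 f g)
    show "(\<lambda>t. b (f t) (g t)) \<in> borel_measurable M"
      using f g by (intro strongly_measurable_form M) (auto simp: B.bochner_L2_mem_iff)
    show "AE t in M. norm (b (f t) (g t)) \<le> norm (nrm X (f t) * nrm X (g t))"
      using B.bochner_L2_AE_mem[OF f] B.bochner_L2_AE_mem[OF g]
      by eventually_elim (use cauchy_schwarz nrm_nonneg in auto)
  qed
qed

lemma (in semi_inner) semi_inner_bochner_L2:
  assumes M: "bochner X M"
  shows "semi_inner (bochner_L2 M X) (\<lambda>f g. LINT t|M. b (f t) (g t))"
proof -
  interpret B: bochner X M by (rule M)
  note int = bochner_L2_form_integrable[OF M]
  show ?thesis
  proof
    fix f g h and c :: real
    show "0 \<in> elems (bochner_L2 M X)"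
      using B.simple_in_bochner_L2[of 0] zero_mem by (auto simp: simple_in_def zero_fun_def)
    assume f: "f \<in> elems (bochner_L2 M X)"
    show "c *\<^sub>R f \<in> elems (bochner_L2 M X)" by (rule B.bochner_L2_scale[OF f])
    have AEf: "AE t in M. f t \<in> elems X" by (rule B.bochner_L2_AE_mem[OF f])
    show "0 \<le> (LINT t|M. b (f t) (f t))"
      using AEf by (intro integral_nonneg_AE) (auto elim!: eventually_mono intro: nonneg)
    have "(LINT t|M. (nrm X (f t))\<^sup>2) = (LINT t|M. b (f t) (f t))"
      using AEf int[OF f f] f
      by (intro integral_cong_AE) (auto simp: B.bochner_L2_mem_iff elim!: eventually_mono intro: nrm_square)
    then show "nrm (bochner_L2 M X) f = sqrt (LINT t|M. b (f t) (f t))"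
      by (simp add: B.bochner_L2_nrm)
    assume g: "g \<in> elems (bochner_L2 M X)"
    have AEg: "AE t in M. g t \<in> elems X" by (rule B.bochner_L2_AE_mem[OF g])
    show "f + g \<in> elems (bochner_L2 M X)" by (rule B.bochner_L2_add[OF f g])
    show "(LINT t|M. b (f t) (g t)) = (LINT t|M. b (g t) (f t))"
    proof (rule integral_cong_AE)
      show "AE t in M. b (f t) (g t) = b (g t) (f t)" using AEf AEg by eventually_elim (rule sym)
    qed (use int[OF f g] int[OF g f] in auto)
    have "(LINT t|M. b ((c *\<^sub>R f) t) (g t)) = (LINT t|M. c * b (f t) (g t))"
    proof (rule integral_cong_AE)
      show "AE t in M. b ((c *\<^sub>R f) t) (g t) = c * b (f t) (g t)"
        using AEf AEg by eventually_elim (simp add: scaleR_fun_def scale_left)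
    qed (use int[OF f g] int[OF B.bochner_L2_scale[OF f] g, of c] in auto)
    then show "(LINT t|M. b ((c *\<^sub>R f) t) (g t)) = c * (LINT t|M. b (f t) (g t))" by simp
    assume h: "h \<in> elems (bochner_L2 M X)"
    have AEh: "AE t in M. h t \<in> elems X" by (rule B.bochner_L2_AE_mem[OF h])
    have "(LINT t|M. b ((f + g) t) (h t)) = (LINT t|M. b (f t) (h t) + b (g t) (h t))"
    proof (rule integral_cong_AE)
      show "AE t in M. b ((f + g) t) (h t) = b (f t) (h t) + b (g t) (h t)"
        using AEf AEg AEh by eventually_elim (simp add: add_left)
    qed (use int[OF f h] int[OF g h] int[OF B.bochner_L2_add[OF f g] h] in auto)
    then show "(LINT t|M. b ((f + g) t) (h t)) = (LINT t|M. b (f t) (h t)) + (LINT t|M. b (g t) (h t))"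
      using int[OF f h] int[OF g h] by simp
  qed
qed

text \<open>Riesz--Fischer. Strong measurability of the limit holds because each member of the sequence
  is close in \<open>L\<^sup>2\<close> to a simple function, so closely that these simple functions converge almost
  everywhere to the same limit.\<close>

lemma (in bochner) complete_bochner_L2:
  assumes X: "complete_in X" and sn: "seminormed (bochner_L2 M X)"
  shows "complete_in (bochner_L2 M X)"
proof -
  interpret B: seminormed "bochner_L2 M X" by (rule sn)
  show ?thesis
  proof (rule B.complete_in_if_geometric_limits)
    fix f :: "nat \<Rightarrow> 'b \<Rightarrow> 'v"
    assume f: "\<And>n. f n \<in> elems (bochner_L2 M X)"
      and cau: "\<And>n m. n \<le> m \<Longrightarrow> nrm (bochner_L2 M X) (f m - f n) \<le> (1/2)^n"
    have "\<exists>s. simple_in M X s \<and> nrm (bochner_L2 M X) (f n - s) \<le> (1/2)^n" for n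
      using simple_dense_in_bochner_L2[OF f] by metis
    then obtain s where s: "\<And>n. simple_in M X (s n)"
      and fs: "\<And>n. nrm (bochner_L2 M X) (f n - s n) \<le> (1/2)^n" by metis
    have fX: "AE t in M. \<forall>n. f n t \<in> elems X"
      using bochner_L2_AE_mem[OF f] by (simp add: AE_all_countable)
    have "AE t in M. summable (\<lambda>n. \<bar>nrm X ((f n - s n) t)\<bar>)"
      using fs by (intro AE_summable_if_L2_geometric bochner_L2_nrm_in_L2 bochner_L2_diff f
          simple_in_bochner_L2 s) (simp only: bochner_L2_nrm_eq)
    then have fs0: "AE t in M. (\<lambda>n. nrm X (f n t - s n t)) \<longlonglongrightarrow> 0"
      by (rule AE_mp) (auto intro!: AE_I2 dest!: summable_LIMSEQ_zero simp: tendsto_rabs_zero_iff)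
    have "AE t in M. summable (\<lambda>n. \<bar>nrm X ((f (Suc n) - f n) t)\<bar>)"
      using cau[of _ "Suc _"] by (intro AE_summable_if_L2_geometric bochner_L2_nrm_in_L2 bochner_L2_diff f)
        (simp only: bochner_L2_nrm_eq le_SucI order_refl)
    then have "AE t in M. \<exists>u\<in>elems X. (\<lambda>n. nrm X (f n t - u)) \<longlonglongrightarrow> 0"
      using fX
    proof eventually_elim
      fix t assume sum: "summable (\<lambda>n. \<bar>nrm X ((f (Suc n) - f n) t)\<bar>)" and t: "\<forall>n. f n t \<in> elems X"
      define a where "a n = nrm X (f (Suc n) t - f n t)" for n
      have a0: "0 \<le> a n" for n using t by (auto simp: a_def intro: nrm_nonneg diff_mem)
      have "a = (\<lambda>n. \<bar>nrm X ((f (Suc n) - f n) t)\<bar>)" using a0 by (auto simp: a_def)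
      then have suma: "summable a" using sum by simp
      have tele: "nrm X (f (m + k) t - f m t) \<le> sum a {m..<m + k}" for m k
      proof (induction k)
        case (Suc k)
        have "nrm X (f (Suc (m + k)) t - f m t) \<le> a (m + k) + nrm X (f (m + k) t - f m t)"
          unfolding a_def using t by (intro nrm_triangle) auto
        with Suc show ?case by simp
      qed (simp add: nrm_zero)
      have "\<exists>N. \<forall>m\<ge>N. \<forall>n\<ge>N. nrm X (f m t - f n t) < e" if "0 < e" for e
      proof -
        obtain N where N: "\<And>m n. m \<ge> N \<Longrightarrow> \<bar>sum a {m..<n}\<bar> < e"
          using suma \<open>0 < e\<close> unfolding summable_Cauchy by (metis real_norm_def)
        have le: "nrm X (f n t - f m t) < e" if "N \<le> m" "m \<le> n" for m n
          using tele[of m "n - m"] N[OF that(1), of n] that by auto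
        have "nrm X (f m t - f n t) < e" if "m \<ge> N" "n \<ge> N" for m n
          using le[of m n] le[of n m] nrm_diff_commute[of "f m t" "f n t"] t that
          by (cases "m \<le> n") auto
        then show ?thesis by blast
      qed
      then show "\<exists>u\<in>elems X. (\<lambda>n. nrm X (f n t - u)) \<longlonglongrightarrow> 0"
        using X t unfolding complete_in_def by (elim allE[of _ "\<lambda>n. f n t"] impE) auto
    qed
    then obtain g where g: "AE t in M. g t \<in> elems X \<and> (\<lambda>n. nrm X (f n t - g t)) \<longlonglongrightarrow> 0"
    proof -
      assume *: "\<And>g. (AE t in M. g t \<in> elems X \<and> (\<lambda>n. nrm X (f n t - g t)) \<longlonglongrightarrow> 0) \<Longrightarrow> thesis"
      assume "AE t in M. \<exists>u\<in>elems X. (\<lambda>n. nrm X (f n t - u)) \<longlonglongrightarrow> 0"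
      then show thesis
        by (intro *[of "\<lambda>t. SOME u. u \<in> elems X \<and> (\<lambda>n. nrm X (f n t - u)) \<longlonglongrightarrow> 0"])
          (elim eventually_mono, rule someI_ex, blast)
    qed
    have gX: "AE t in M. g t \<in> elems X" using g by (rule eventually_mono) simp
    have gm: "strongly_measurable M X g"
      unfolding strongly_measurable_def
    proof (intro conjI exI[of _ s] allI s gX)
      show "AE t in M. (\<lambda>n. nrm X (g t - s n t)) \<longlonglongrightarrow> 0"
        using g fs0 fX AE_space
      proof eventually_elim
        fix t assume t: "g t \<in> elems X \<and> (\<lambda>n. nrm X (f n t - g t)) \<longlonglongrightarrow> 0"
          "(\<lambda>n. nrm X (f n t - s n t)) \<longlonglongrightarrow> 0" "\<forall>n. f n t \<in> elems X" "t \<in> space M"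
        have z: "(\<lambda>n. nrm X (f n t - g t) + nrm X (f n t - s n t)) \<longlonglongrightarrow> 0"
          using tendsto_add[OF conjunct2[OF t(1)] t(2)] by simp
        have sX: "s n t \<in> elems X" for n using simple_in_mem[OF s t(4)] .
        show "(\<lambda>n. nrm X (g t - s n t)) \<longlonglongrightarrow> 0"
        proof (rule Lim_null_comparison[OF always_eventually z], rule allI)
          fix n
          show "norm (nrm X (g t - s n t)) \<le> nrm X (f n t - g t) + nrm X (f n t - s n t)"
            using nrm_triangle[of "g t" "f n t" "s n t"] nrm_diff_commute[of "g t" "f n t"] t(1,3) sX[of n]
              nrm_nonneg[OF diff_mem, of "g t" "s n t"] by auto
        qed
      qed
    qed
    have dm: "(\<lambda>t. nrm X (f n t - g t)) \<in> borel_measurable M" for n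
    proof -
      have "strongly_measurable M X (f n)" using f by (simp add: bochner_L2_mem_iff)
      from strongly_measurable_nrm[OF strongly_measurable_combine[OF this gm, of 1 "-1"]]
      show ?thesis by simp
    qed
    have main: "integrable M (\<lambda>t. (nrm X (f n t - g t))\<^sup>2)"
      "(LINT t|M. (nrm X (f n t - g t))\<^sup>2) \<le> ((1/2)^n)\<^sup>2" for n
    proof -
      have mem: "f (m + n) - f n \<in> elems (bochner_L2 M X)" for m using f by (intro bochner_L2_diff)
      have m1: "(\<lambda>t. nrm X ((f (m + n) - f n) t)) \<in> borel_measurable M" for m
        using bochner_L2_nrm_in_L2[OF mem] by (simp add: L2_mem_iff)
      have m2: "integrable M (\<lambda>t. (nrm X ((f (m + n) - f n) t))\<^sup>2)" for m
        using mem[of m] by (simp add: bochner_L2_mem_iff)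
      have m3: "(LINT t|M. (nrm X ((f (m + n) - f n) t))\<^sup>2) \<le> ((1/2)^n)\<^sup>2" for m
        using cau[of n "m + n"] by (simp add: bochner_L2_nrm sqrt_le_D)
      have "AE t in M. (\<lambda>m. nrm X ((f (m + n) - f n) t)) \<longlonglongrightarrow> nrm X (f n t - g t)"
        using g fX
      proof eventually_elim
        fix t assume t: "g t \<in> elems X \<and> (\<lambda>n. nrm X (f n t - g t)) \<longlonglongrightarrow> 0" "\<forall>n. f n t \<in> elems X"
        have z: "(\<lambda>m. nrm X (f (m + n) t - g t)) \<longlonglongrightarrow> 0"
          by (rule LIMSEQ_ignore_initial_segment) (use t in simp)
        show "(\<lambda>m. nrm X ((f (m + n) - f n) t)) \<longlonglongrightarrow> nrm X (f n t - g t)"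
        proof (rule LIM_zero_cancel, rule Lim_null_comparison[OF always_eventually z], rule allI)
          fix m
          have X: "f (m + n) t - f n t \<in> elems X" "g t - f n t \<in> elems X" using t by (auto intro: diff_mem)
          have "norm (nrm X (f (m + n) t - f n t) - nrm X (g t - f n t)) \<le> nrm X (f (m + n) t - g t)"
            using nrm_reverse_triangle[OF X] by simp
          then show "norm (nrm X ((f (m + n) - f n) t) - nrm X (f n t - g t)) \<le> nrm X (f (m + n) t - g t)"
            using nrm_diff_commute[of "f n t" "g t"] t by simp
        qed
      qed
      from square_integral_limit_le[OF m1 dm this m2 m3]
      show "integrable M (\<lambda>t. (nrm X (f n t - g t))\<^sup>2)"
        "(LINT t|M. (nrm X (f n t - g t))\<^sup>2) \<le> ((1/2)^n)\<^sup>2" by blast+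
    qed
    have fg: "f n - g \<in> elems (bochner_L2 M X)" for n
    proof -
      have "strongly_measurable M X (f n)" using f by (simp add: bochner_L2_mem_iff)
      from strongly_measurable_combine[OF this gm, of 1 "-1"]
      show ?thesis using main(1)[of n] by (simp add: bochner_L2_mem_iff fun_diff_def)
    qed
    have "g \<in> elems (bochner_L2 M X)" using bochner_L2_diff[OF f fg, of 0 0] by simp
    moreover have "(\<lambda>n. nrm (bochner_L2 M X) (f n - g)) \<longlonglongrightarrow> 0"
    proof (rule tendsto_sandwich)
      show "\<forall>\<^sub>F n in sequentially. 0 \<le> nrm (bochner_L2 M X) (f n - g)" using B.nrm_nonneg[OF fg] by simp
      show "\<forall>\<^sub>F n in sequentially. nrm (bochner_L2 M X) (f n - g) \<le> (1/2)^n"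
        using main(2) by (intro always_eventually allI) (simp add: bochner_L2_nrm real_le_lsqrt)
    qed (auto intro: LIMSEQ_realpow_zero)
    ultimately show "\<exists>u\<in>elems (bochner_L2 M X). (\<lambda>n. nrm (bochner_L2 M X) (f n - u)) \<longlonglongrightarrow> 0" by blast
  qed
qed


lemma bochner_L2_mono:
  assumes X: "bochner X M" and Y: "bochner Y M"
    and sub: "elems X \<subseteq> elems Y" and le: "\<And>u. u \<in> elems X \<Longrightarrow> nrm Y u \<le> nrm X u"
    and f: "f \<in> elems (bochner_L2 M X)"
  shows "f \<in> elems (bochner_L2 M Y)"
proof -
  interpret X: bochner X M by (rule X)
  interpret Y: bochner Y M by (rule Y)
  have "strongly_measurable M X f" using f by (simp add: X.bochner_L2_mem_iff)
  then obtain s where s: "\<And>n. simple_in M X (s n)" and fX: "AE t in M. f t \<in> elems X"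
    and lim: "AE t in M. (\<lambda>n. nrm X (f t - s n t)) \<longlonglongrightarrow> 0"
    by (rule X.strongly_measurableE) blast
  have sm: "strongly_measurable M Y f"
    unfolding strongly_measurable_def
  proof (intro conjI exI[of _ s] allI)
    show "AE t in M. f t \<in> elems Y" using fX by (rule eventually_mono) (use sub in auto)
    show "simple_in M Y (s n)" for n using s[of n] sub by (auto simp: simple_in_def)
    show "AE t in M. (\<lambda>n. nrm Y (f t - s n t)) \<longlonglongrightarrow> 0"
      using fX lim AE_space
    proof eventually_elim
      fix t assume t: "f t \<in> elems X" "(\<lambda>n. nrm X (f t - s n t)) \<longlonglongrightarrow> 0" "t \<in> space M"
      have d: "f t - s n t \<in> elems X" for n using t X.simple_in_mem[OF s] by (intro X.diff_mem) auto
      show "(\<lambda>n. nrm Y (f t - s n t)) \<longlonglongrightarrow> 0"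
      proof (rule Lim_null_comparison[OF always_eventually t(2)], rule allI)
        fix n
        have "0 \<le> nrm Y (f t - s n t)" using d sub by (intro Y.nrm_nonneg) auto
        then show "norm (nrm Y (f t - s n t)) \<le> nrm X (f t - s n t)" using le[OF d] by simp
      qed
    qed
  qed
  moreover have "integrable M (\<lambda>t. (nrm Y (f t))\<^sup>2)"
  proof (rule Bochner_Integration.integrable_bound)
    show "integrable M (\<lambda>t. (nrm X (f t))\<^sup>2)" using f by (simp add: X.bochner_L2_mem_iff)
    show "(\<lambda>t. (nrm Y (f t))\<^sup>2) \<in> borel_measurable M"
      using Y.strongly_measurable_nrm[OF sm] by measurable
    show "AE t in M. norm ((nrm Y (f t))\<^sup>2) \<le> norm ((nrm X (f t))\<^sup>2)"
      using fX by eventually_elim (use le Y.nrm_nonneg sub in \<open>auto intro!: power_mono\<close>)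
  qed
  ultimately show ?thesis by (simp add: Y.bochner_L2_mem_iff)
qed

section \<open>Primitives on a bounded time interval\<close>

text \<open>The truncation at \<open>x\<close> makes the primitive constant to the left of 0 and to the right of \<open>T\<close>.\<close>

definition prim :: "real \<Rightarrow> (real \<Rightarrow> real) \<Rightarrow> real \<Rightarrow> real" where
  "prim T k x = (LINT t|time_interval T. indicator {..x} t * k t)"

lemma finite_measure_time: "finite_measure (time_interval T)"
  by (rule finite_measure_lebesgue_on) (cases "0 \<le> T"; simp)

lemma complete_measure_time: "complete_measure (time_interval T)"
proof
  fix A B assume AB: "B \<subseteq> A" "A \<in> null_sets (time_interval T)"
  then have "A \<in> null_sets lebesgue" by (simp add: null_sets_restrict_space)
  then have "B \<in> null_sets lebesgue" using AB(1) by (rule completion.complete2[rotated])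
  moreover have "B \<subseteq> {0<..<T}" using AB sets.sets_into_space[OF null_setsD2[OF AB(2)]] by auto
  ultimately show "B \<in> sets (time_interval T)"
    by (auto simp: sets_restrict_space_iff null_sets_def)
qed

lemma AE_time_neq: "AE t in time_interval T. t \<noteq> x"
proof -
  have "AE t in lebesgue. t \<noteq> x"
    by (rule AE_I'[of "{x}"]) auto
  then show ?thesis by (subst AE_restrict_space_iff) auto
qed

lemma borel_measurable_time: "f \<in> borel_measurable borel \<Longrightarrow> f \<in> borel_measurable (time_interval T)"
  for f :: "real \<Rightarrow> real"
  by (intro measurable_restrict_space1 measurable_completion) simp

lemma indicator_measurable_time:
  "A \<in> sets borel \<Longrightarrow> (indicator A :: real \<Rightarrow> real) \<in> borel_measurable (time_interval T)"
  by (intro borel_measurable_time) simp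

lemma integrable_indicator_time:
  "integrable (time_interval T) k \<Longrightarrow> A \<in> sets borel \<Longrightarrow>
    integrable (time_interval T) (\<lambda>t. indicator A t * k t :: real)"
proof (rule Bochner_Integration.integrable_bound[of _ k])
  assume "integrable (time_interval T) k" "A \<in> sets borel"
  then show "(\<lambda>t. indicator A t * k t) \<in> borel_measurable (time_interval T)"
    by (intro borel_measurable_times indicator_measurable_time) auto
qed (auto simp: indicator_def)

lemma prim_left: "x \<le> 0 \<Longrightarrow> prim T k x = 0"
  unfolding prim_def by (rule integral_eq_zero_AE) (auto intro!: AE_I2 simp: indicator_def)

lemma prim_right: "T \<le> x \<Longrightarrow> prim T k x = (LINT t|time_interval T. k t)"
  unfolding prim_def by (rule Bochner_Integration.integral_cong) (auto simp: indicator_def)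

lemma prim_diff:
  assumes "integrable (time_interval T) k" "x \<le> y"
  shows "prim T k y - prim T k x = (LINT t|time_interval T. indicator {x<..y} t * k t)"
proof -
  have "prim T k y - prim T k x = (LINT t|time_interval T. indicator {..y} t * k t - indicator {..x} t * k t)"
    unfolding prim_def using integrable_indicator_time[OF assms(1)]
    by (subst Bochner_Integration.integral_diff) auto
  also have "\<dots> = (LINT t|time_interval T. indicator {x<..y} t * k t)"
    using assms(2) by (intro Bochner_Integration.integral_cong) (auto simp: indicator_def)
  finally show ?thesis .
qed

lemma prim_tendsto:
  assumes k: "integrable (time_interval T) k" and x: "x \<longlonglongrightarrow> a"
  shows "(\<lambda>n. prim T k (x n)) \<longlonglongrightarrow> prim T k a"
  unfolding prim_def
proof (rule integral_dominated_convergence[where w="\<lambda>t. \<bar>k t\<bar>"])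
  show "AE t in time_interval T. (\<lambda>n. indicator {..x n} t * k t) \<longlonglongrightarrow> indicator {..a} t * k t"
    using AE_time_neq[of a]
  proof eventually_elim
    fix t assume "t \<noteq> a"
    then consider "t < a" | "a < t" by linarith
    then have "\<forall>\<^sub>F n in sequentially. indicator {..x n} t * k t = indicator {..a} t * k t"
    proof cases
      case 1
      from order_tendstoD(1)[OF x this] show ?thesis by eventually_elim (use 1 in auto)
    next
      case 2
      from order_tendstoD(2)[OF x this] show ?thesis by eventually_elim (use 2 in auto)
    qed
    then show "(\<lambda>n. indicator {..x n} t * k t) \<longlonglongrightarrow> indicator {..a} t * k t" by (rule tendsto_eventually)
  qed
  show "(\<lambda>t. indicator {..a} t * k t) \<in> borel_measurable (time_interval T)"
    using integrable_indicator_time[OF k, of "{..a}"] by auto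
  show "(\<lambda>t. indicator {..x n} t * k t) \<in> borel_measurable (time_interval T)" for n
    using integrable_indicator_time[OF k, of "{..x n}"] by auto
qed (use k in \<open>auto simp: indicator_def\<close>)

lemma isCont_prim: "integrable (time_interval T) k \<Longrightarrow> isCont (prim T k) a"
  by (simp add: continuous_at_sequentially comp_def prim_tendsto)

lemma has_bochner_integral_FTC_time:
  assumes "a \<le> b" and P: "\<And>x. a \<le> x \<Longrightarrow> x \<le> b \<Longrightarrow> (P has_real_derivative h x) (at x)"
    and h: "\<And>x. a \<le> x \<Longrightarrow> x \<le> b \<Longrightarrow> isCont h x"
  shows "has_bochner_integral (lebesgue_on {a<..<b}) h (P b - P a)"
proof -
  have "has_bochner_integral lborel (\<lambda>x. h x * indicator {a..b} x) (P b - P a)"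
    by (rule has_bochner_integral_FTC_Icc_real[OF assms])
  then have 1: "has_bochner_integral lebesgue (\<lambda>x. h x * indicator {a..b} x) (P b - P a)"
    by (auto simp: has_bochner_integral_iff integrable_completion integral_completion)
  have AE: "AE x in lebesgue. h x * indicator {a..b} x = indicator {a<..<b} x *\<^sub>R h x"
    by (rule AE_I'[of "{a, b}"]) (auto simp: indicator_def)
  have m: "(\<lambda>x. h x * indicator {a..b} x) \<in> borel_measurable lebesgue" using 1 by auto
  have "has_bochner_integral lebesgue (\<lambda>x. indicator {a<..<b} x *\<^sub>R h x) (P b - P a)"
    using 1 has_bochner_integral_cong_AE[OF m borel_measurable_AE[OF m AE] AE] by simp
  then show ?thesis by (simp add: has_bochner_integral_restrict_space)
qed

lemma continuous_integrable_time:
  fixes h :: "real \<Rightarrow> real"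
  assumes "0 \<le> T" "\<And>x. isCont h x"
  shows "integrable (time_interval T) h"
proof -
  have "continuous_on {0..T} h" using assms(2) by (simp add: continuous_at_imp_continuous_on)
  then have "integrable (lebesgue_on {0..T}) h" by (rule continuous_imp_integrable_real)
  then have 1: "integrable lebesgue (\<lambda>t. indicator {0..T} t *\<^sub>R h t)"
    by (simp add: integrable_restrict_space)
  have AE: "AE t in lebesgue. indicator {0..T} t *\<^sub>R h t = indicator {0<..<T} t *\<^sub>R h t"
    by (rule AE_I'[of "{0, T}"]) (auto simp: indicator_def)
  have m: "(\<lambda>t. indicator {0..T} t *\<^sub>R h t) \<in> borel_measurable lebesgue" using 1 by auto
  have "integrable lebesgue (\<lambda>t. indicator {0<..<T} t *\<^sub>R h t)"
    using 1 integrable_cong_AE[OF m borel_measurable_AE[OF m AE] AE] by simp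
  then show ?thesis by (simp add: integrable_restrict_space)
qed

lemma prim_eq:
  assumes T: "0 \<le> T" and P: "\<And>x. (P has_real_derivative h x) (at x)" and h: "\<And>x. isCont h x"
    and x: "0 \<le> x" "x \<le> T"
  shows "prim T h x = P x - P 0"
proof -
  have "has_bochner_integral (lebesgue_on {0<..<x}) h (P x - P 0)"
    by (rule has_bochner_integral_FTC_time[OF x(1) P h])
  then have 1: "has_bochner_integral lebesgue (\<lambda>t. indicator {0<..<x} t *\<^sub>R h t) (P x - P 0)"
    by (simp add: has_bochner_integral_restrict_space)
  have AE: "AE t in lebesgue. indicator {0<..<x} t *\<^sub>R h t = indicator {0<..<T} t *\<^sub>R (indicator {..x} t * h t)"
    by (rule AE_I'[of "{x, T}"]) (use x in \<open>auto simp: indicator_def\<close>)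
  have m: "(\<lambda>t. indicator {0<..<x} t *\<^sub>R h t) \<in> borel_measurable lebesgue" using 1 by auto
  have "has_bochner_integral lebesgue (\<lambda>t. indicator {0<..<T} t *\<^sub>R (indicator {..x} t * h t)) (P x - P 0)"
    using 1 has_bochner_integral_cong_AE[OF m borel_measurable_AE[OF m AE] AE] by simp
  then have "has_bochner_integral (time_interval T) (\<lambda>t. indicator {..x} t * h t) (P x - P 0)"
    by (simp add: has_bochner_integral_restrict_space)
  then show ?thesis by (simp add: prim_def has_bochner_integral_integral_eq)
qed

lemma continuous_has_primitive:
  fixes h :: "real \<Rightarrow> real"
  assumes "\<And>x. isCont h x"
  obtains P where "\<And>x. (P has_real_derivative h x) (at x)"
  using einterval_antiderivative[of "-\<infinity>" \<infinity> h] assms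
  by (auto simp: has_real_derivative_iff_has_vector_derivative)

text \<open>With a primitive \<open>P\<close> of \<open>h\<close>, the integral of the difference quotient of \<open>h\<close> is the increment from
  0 to \<open>x\<close> of the difference quotient of \<open>P\<close>.\<close>

lemma prim_difference_quotient_tendsto:
  assumes T: "0 \<le> T" and h: "\<And>x. isCont h x" and e: "e \<longlonglongrightarrow> 0" "\<And>n. e n \<noteq> 0"
    and x: "0 \<le> x" "x \<le> T"
  shows "(\<lambda>n. prim T (\<lambda>s. (h s - h (s - e n)) / e n) x) \<longlonglongrightarrow> h x - h 0"
proof -
  obtain P where P: "\<And>x. (P has_real_derivative h x) (at x)"
    using continuous_has_primitive[of h] h by blast
  have q: "(\<lambda>n. (P y - P (y - e n)) / e n) \<longlonglongrightarrow> h y" for y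
  proof -
    have "((\<lambda>z. (P z - P y) / (z - y)) \<longlongrightarrow> h y) (at y)"
      using P[of y] by (simp add: has_field_derivative_iff)
    moreover have "filterlim (\<lambda>n. y - e n) (at y) sequentially"
      using tendsto_diff[OF tendsto_const e(1), of y] e(2) by (simp add: filterlim_at)
    ultimately have "(\<lambda>n. (P (y - e n) - P y) / (y - e n - y)) \<longlonglongrightarrow> h y"
      by (rule filterlim_compose)
    moreover have "(P (y - e n) - P y) / (y - e n - y) = (P y - P (y - e n)) / e n" for n
      using e(2)[of n] by (simp add: field_simps)
    ultimately show ?thesis by simp
  qed
  have "prim T (\<lambda>s. (h s - h (s - e n)) / e n) x = (P x - P (x - e n)) / e n - (P 0 - P (0 - e n)) / e n" for n
  proof (rule prim_eq[OF T _ _ x])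
    fix s
    show "((\<lambda>s. (P s - P (s - e n)) / e n) has_real_derivative (h s - h (s - e n)) / e n) (at s)"
      using e(2)[of n] by (auto intro!: derivative_eq_intros DERIV_chain2[OF P] P)
    show "isCont (\<lambda>s. (h s - h (s - e n)) / e n) s"
      by (intro continuous_intros isCont_o2[OF _ h] h e(2))
  qed
  with tendsto_diff[OF q[of x] q[of 0]] show ?thesis by simp
qed

text \<open>The factor \<open>sqrt (y - x)\<close> is what keeps difference quotients of primitives bounded in \<open>L\<^sup>2\<close>.\<close>

lemma prim_cauchy_schwarz:
  assumes k: "k \<in> elems (L2 (time_interval T))" and xy: "x \<le> y"
  shows "(LINT t|time_interval T. indicator {x<..y} t * \<bar>k t\<bar>)
    \<le> sqrt (y - x) * sqrt (prim T (\<lambda>t. (k t)\<^sup>2) y - prim T (\<lambda>t. (k t)\<^sup>2) x)"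
proof -
  let ?M = "time_interval T"
  interpret finite_measure ?M by (rule finite_measure_time)
  have k2: "integrable ?M (\<lambda>t. (k t)\<^sup>2)" and km[measurable]: "k \<in> borel_measurable ?M"
    using k by (auto simp: L2_mem_iff)
  have i: "(\<lambda>t. indicator {x<..y} t :: real) \<in> borel_measurable ?M"
    using indicator_measurable_time[of "{x<..y}" T] by simp
  have ii: "(\<lambda>t. (indicator {x<..y} t :: real)\<^sup>2) = indicator {x<..y}"
    by (auto simp: indicator_def)
  have i1: "integrable ?M (\<lambda>t. indicator {x<..y} t :: real)"
    using integrable_indicator_time[of T "\<lambda>_. 1" "{x<..y}"] by simp
  have a: "indicator {x<..y} \<in> elems (L2 ?M)"
    using i i1 ii by (simp add: L2_mem_iff)
  have bb: "(\<lambda>t. (indicator {x<..y} t * \<bar>k t\<bar>)\<^sup>2) = (\<lambda>t. indicator {x<..y} t * (k t)\<^sup>2)"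
    by (auto simp: indicator_def)
  have b: "(\<lambda>t. indicator {x<..y} t * \<bar>k t\<bar>) \<in> elems (L2 ?M)"
    unfolding L2_mem_iff bb using integrable_indicator_time[OF k2, of "{x<..y}"] i
    by (auto intro!: borel_measurable_times)
  have "(LINT t|?M. indicator {x<..y} t * \<bar>k t\<bar>)
      = (LINT t|?M. indicator {x<..y} t * (indicator {x<..y} t * \<bar>k t\<bar>))"
    by (intro Bochner_Integration.integral_cong) (auto simp: indicator_def)
  also have "\<dots> \<le> sqrt (LINT t|?M. (indicator {x<..y} t)\<^sup>2) * sqrt (LINT t|?M. (indicator {x<..y} t * \<bar>k t\<bar>)\<^sup>2)"
    using L2_cauchy_schwarz[OF a b] by simp
  also have "(LINT t|?M. (indicator {x<..y} t * \<bar>k t\<bar>)\<^sup>2) = prim T (\<lambda>t. (k t)\<^sup>2) y - prim T (\<lambda>t. (k t)\<^sup>2) x"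
    unfolding bb using prim_diff[OF k2 xy] by simp
  also have "(LINT t|?M. (indicator {x<..y} t :: real)\<^sup>2) \<le> y - x"
  proof -
    have "(LINT t|?M. (indicator {x<..y} t :: real)\<^sup>2) = (LINT t|lebesgue. indicator ({0<..<T} \<inter> {x<..y}) t)"
      unfolding ii by (subst integral_restrict_space)
        (simp, intro Bochner_Integration.integral_cong, auto simp: indicator_def)
    also have "\<dots> = measure lebesgue ({0<..<T} \<inter> {x<..y})"
      by simp
    also have "\<dots> \<le> measure lebesgue {x..y}" by (intro measure_mono_fmeasurable) auto
    also have "\<dots> = y - x" using xy by simp
    finally show ?thesis .
  qed
  finally show ?thesis
    using prim_diff[OF k2 xy] by (simp add: mult_right_mono)
qed

section \<open>Smooth cut-off functions\<close>

text \<open>The standard flat function \<open>exp (- 1 / x)\<close>, together with a polynomial factor in \<open>1 / x\<close>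
  that makes the family closed under differentiation.\<close>

definition flat :: "real poly \<Rightarrow> real \<Rightarrow> real" where
  "flat p x = (if 0 < x then poly p (inverse x) * exp (- inverse x) else 0)"

lemma poly_times_exp_minus_tendsto_0: "((\<lambda>y. poly p y * exp (- y)) \<longlongrightarrow> 0) at_top" for p :: "real poly"
proof -
  have "((\<lambda>y. \<Sum>i\<le>degree p. coeff p i * (y ^ i / exp y)) \<longlongrightarrow> (\<Sum>i\<le>degree p. coeff p i * 0)) at_top"
    by (intro tendsto_intros tendsto_power_div_exp_0)
  then show ?thesis
    by (simp add: poly_altdef sum_distrib_right exp_minus divide_inverse mult.assoc)
qed

lemma flat_has_derivative:
  "(flat p has_real_derivative flat (monom 1 2 * (p - pderiv p)) x) (at x)"
proof (cases "x = 0")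
  case False
  show ?thesis
  proof (cases "0 < x")
    case True
    have "((\<lambda>x. poly p (inverse x) * exp (- inverse x)) has_real_derivative
        flat (monom 1 2 * (p - pderiv p)) x) (at x)"
      using True by (auto intro!: derivative_eq_intros DERIV_chain2[OF poly_DERIV]
          simp: flat_def poly_monom power2_eq_square algebra_simps)
    then show ?thesis
      by (rule has_field_derivative_transform_within_open[of _ _ _ "{0<..}"])
        (use True in \<open>auto simp: flat_def\<close>)
  next
    case neg: False
    have "((\<lambda>x. 0) has_real_derivative flat (monom 1 2 * (p - pderiv p)) x) (at x)"
      using neg by (simp add: flat_def)
    then show ?thesis
      by (rule has_field_derivative_transform_within_open[of _ _ _ "{..<0}"])
        (use neg False in \<open>auto simp: flat_def\<close>)
  qed
next
  case True
  have "((\<lambda>h. flat p h / h) \<longlongrightarrow> 0) (at_right 0)"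
  proof (rule Lim_transform_eventually)
    show "((\<lambda>h. poly (p * monom 1 1) (inverse h) * exp (- inverse h)) \<longlongrightarrow> 0) (at_right 0)"
      by (rule filterlim_compose[OF poly_times_exp_minus_tendsto_0 filterlim_inverse_at_top_right])
    show "\<forall>\<^sub>F h in at_right 0. poly (p * monom 1 1) (inverse h) * exp (- inverse h) = flat p h / h"
      by (auto simp: eventually_at_filter flat_def poly_monom divide_inverse)
  qed
  moreover have "((\<lambda>h. flat p h / h) \<longlongrightarrow> 0) (at_left 0)"
    by (rule tendsto_eventually) (auto simp: eventually_at_filter flat_def)
  ultimately have "((\<lambda>h. flat p h / h) \<longlongrightarrow> 0) (at 0)" by (simp add: filterlim_split_at)
  then show ?thesis using True by (simp add: has_field_derivative_iff flat_def)
qed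

text \<open>A set of functions that is closed under differentiation consists of smooth functions.\<close>

inductive_set flat_algebra :: "(real \<Rightarrow> real) set" where
  base: "(\<lambda>x. flat p (c * x + d)) \<in> flat_algebra"
| const: "(\<lambda>_. c) \<in> flat_algebra"
| add: "f \<in> flat_algebra \<Longrightarrow> g \<in> flat_algebra \<Longrightarrow> (\<lambda>x. f x + g x) \<in> flat_algebra"
| mult: "f \<in> flat_algebra \<Longrightarrow> g \<in> flat_algebra \<Longrightarrow> (\<lambda>x. f x * g x) \<in> flat_algebra"

lemma flat_algebra_derivative:
  "f \<in> flat_algebra \<Longrightarrow> \<exists>g\<in>flat_algebra. \<forall>x. (f has_real_derivative g x) (at x)"
proof (induction rule: flat_algebra.induct)
  case (base p c d)
  have "((\<lambda>x. flat p (c * x + d)) has_real_derivative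
      flat (monom 1 2 * (p - pderiv p)) (c * x + d) * c) (at x)" for x
    by (rule DERIV_chain2[OF flat_has_derivative]) (auto intro!: derivative_eq_intros)
  moreover have "(\<lambda>x. flat (monom 1 2 * (p - pderiv p)) (c * x + d) * c) \<in> flat_algebra"
    by (intro flat_algebra.intros)
  ultimately show ?case by (intro bexI allI)
next
  case (const c)
  show ?case by (rule bexI[OF _ flat_algebra.const[of 0]]) simp
next
  case (add f g)
  then obtain f' g' where "f' \<in> flat_algebra" "g' \<in> flat_algebra"
    "\<And>x. (f has_real_derivative f' x) (at x)" "\<And>x. (g has_real_derivative g' x) (at x)" by blast
  then show ?case
    by (intro bexI[of _ "\<lambda>x. f' x + g' x"] allI DERIV_add flat_algebra.add)
next
  case (mult f g)
  then obtain f' g' where *: "f' \<in> flat_algebra" "g' \<in> flat_algebra"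
    "\<And>x. (f has_real_derivative f' x) (at x)" "\<And>x. (g has_real_derivative g' x) (at x)" by blast
  then show ?case
    using mult.hyps by (intro bexI[of _ "\<lambda>x. f' x * g x + g' x * f x"] allI DERIV_mult
        flat_algebra.add flat_algebra.mult)
qed

lemma flat_algebra_smooth:
  assumes "f \<in> flat_algebra" shows "(deriv ^^ k) f field_differentiable (at x)"
proof -
  have "(deriv ^^ k) f \<in> flat_algebra"
  proof (induction k)
    case (Suc k)
    then obtain g where g: "g \<in> flat_algebra" "\<And>x. ((deriv ^^ k) f has_real_derivative g x) (at x)"
      using flat_algebra_derivative by blast
    then have "deriv ((deriv ^^ k) f) = g" by (intro ext DERIV_imp_deriv)
    then show ?case using g by simp
  qed (use assms in simp)
  then show ?thesis using flat_algebra_derivative by (auto simp: field_differentiable_def)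
qed

definition bump :: "real \<Rightarrow> real" where
  "bump x = flat 1 x * flat 1 (1 - x)"

lemma bump_nonneg: "0 \<le> bump x"
  by (simp add: bump_def flat_def)

lemma bump_zero: "x \<le> 0 \<or> 1 \<le> x \<Longrightarrow> bump x = 0"
  by (auto simp: bump_def flat_def)

lemma isCont_bump: "isCont bump x"
proof -
  have "isCont (flat 1) y" for y using flat_has_derivative by (rule DERIV_isCont)
  then have c: "isCont (flat 1) x" "isCont (flat 1) (1 - x)" by auto
  have "isCont (\<lambda>x. flat 1 (1 - x)) x"
    by (rule isCont_o2[where f = "\<lambda>x. 1 - x"]) (use c in simp_all)
  with c show ?thesis unfolding bump_def[abs_def] by (intro continuous_mult)
qed

text \<open>The step is the normalized primitive of a bump. Only its derivative is in the algebra, which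
  suffices for smoothness; that holds after any affine change of variables, so that steps can be
  placed and steepened at will.\<close>

lemma smooth_step:
  obtains \<sigma> \<rho> :: "real \<Rightarrow> real" where
    "\<And>x. (\<sigma> has_real_derivative \<rho> x) (at x)" "\<And>x. isCont \<rho> x" "\<And>x. 0 \<le> \<rho> x"
    "\<And>x. x \<le> 0 \<or> 1 \<le> x \<Longrightarrow> \<rho> x = 0"
    "\<And>x. 0 \<le> \<sigma> x" "\<And>x. \<sigma> x \<le> 1" "\<And>x. x \<le> 0 \<Longrightarrow> \<sigma> x = 0" "\<And>x. 1 \<le> x \<Longrightarrow> \<sigma> x = 1"
    "\<And>c d. (\<lambda>x. \<rho> (c * x + d)) \<in> flat_algebra"
proof -
  obtain P where P: "\<And>x. (P has_real_derivative bump x) (at x)"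
    using continuous_has_primitive[OF isCont_bump] by blast
  have mono: "P x \<le> P y" if "x \<le> y" for x y
    using that by (rule DERIV_nonneg_imp_nondecreasing) (use P bump_nonneg in blast)
  have cont: "continuous_on A P" for A
    using P by (meson DERIV_continuous continuous_at_imp_continuous_on)
  have left: "P x = P 0" if "x \<le> 0" for x
  proof (cases "x < 0")
    case True
    have "P 0 = P x"
    proof (rule DERIV_isconst_end[OF True cont])
      fix y :: real assume "y < 0"
      then show "(P has_real_derivative 0) (at y)" using P[of y] bump_zero[of y] by simp
    qed
    then show ?thesis by simp
  qed (use that in simp)
  have right: "P x = P 1" if "1 \<le> x" for x
  proof (cases "1 < x")
    case True
    show ?thesis
    proof (rule DERIV_isconst_end[OF True cont])
      fix y :: real assume "1 < y"
      then show "(P has_real_derivative 0) (at y)" using P[of y] bump_zero[of y] by simp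
    qed
  qed (use that in simp)
  have pos: "P 0 < P 1"
  proof (rule DERIV_pos_imp_increasing_open[OF _ _ cont])
    fix x :: real assume x: "0 < x" "x < 1"
    then have "0 < bump x" by (simp add: bump_def flat_def)
    then show "\<exists>y. (P has_real_derivative y) (at x) \<and> 0 < y" using P by blast
  qed simp
  define C where "C = P 1 - P 0"
  have C: "0 < C" using pos by (simp add: C_def)
  show ?thesis
  proof (rule that[of "\<lambda>x. (P x - P 0) / C" "\<lambda>x. bump x / C"])
    fix x c d :: real
    show "((\<lambda>x. (P x - P 0) / C) has_real_derivative bump x / C) (at x)"
      using C by (auto intro!: derivative_eq_intros P)
    show "isCont (\<lambda>x. bump x / C) x" using C by (intro continuous_intros isCont_bump) simp
    show "0 \<le> bump x / C" using C bump_nonneg by simp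
    show "bump x / C = 0" if "x \<le> 0 \<or> 1 \<le> x" using that bump_zero by simp
    show "(P x - P 0) / C = 0" if "x \<le> 0" using left[OF that] by simp
    show "(P x - P 0) / C = 1" if "1 \<le> x" using right[OF that] C by (simp add: C_def)
    show "0 \<le> (P x - P 0) / C"
      using mono[of 0 x] left[of x] C by (cases "0 \<le> x") auto
    show "(P x - P 0) / C \<le> 1"
      using mono[of x 1] right[of x] C by (cases "x \<le> 1") (auto simp: C_def)
    have "(\<lambda>x. (1 / C) * (flat 1 (c * x + d) * flat 1 ((- c) * x + (1 - d)))) \<in> flat_algebra"
      by (rule flat_algebra.mult[OF flat_algebra.const flat_algebra.mult[OF flat_algebra.base flat_algebra.base]])
    then show "(\<lambda>x. bump (c * x + d) / C) \<in> flat_algebra"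
      by (simp add: bump_def algebra_simps)
  qed
qed

text \<open>The fundamental lemma of the calculus of variations in the form needed here: testing with
  smooth approximations of the indicator of an interval turns a weak derivative into increments.\<close>

lemma weak_derivative_imp_primitive:
  assumes T: "0 < T" and f0: "continuous_on {0..T} f0" and k: "integrable (time_interval T) k"
    and ae: "AE t in time_interval T. f t = f0 t" and f: "f \<in> borel_measurable (time_interval T)"
    and weak: "\<And>\<phi>. \<phi> \<in> test_functions T \<Longrightarrow>
      (LINT t|time_interval T. deriv \<phi> t * f t) = - (LINT t|time_interval T. \<phi> t * k t)"
    and x: "0 \<le> x" "x \<le> T"
  shows "f0 x = f0 0 + prim T k x"
proof -
  obtain \<sigma> \<rho> :: "real \<Rightarrow> real" where \<sigma>: "\<And>x. (\<sigma> has_real_derivative \<rho> x) (at x)"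
    and \<rho>: "\<And>x. isCont \<rho> x" "\<And>x. 0 \<le> \<rho> x" "\<And>x. x \<le> 0 \<or> 1 \<le> x \<Longrightarrow> \<rho> x = 0"
    and \<sigma>01: "\<And>x. 0 \<le> \<sigma> x" "\<And>x. \<sigma> x \<le> 1" "\<And>x. x \<le> 0 \<Longrightarrow> \<sigma> x = 0" "\<And>x. 1 \<le> x \<Longrightarrow> \<sigma> x = 1"
    and alg: "\<And>c d. (\<lambda>x. \<rho> (c * x + d)) \<in> flat_algebra"
    using smooth_step by blast
  \<comment> \<open>A continuous extension of \<open>f0\<close> to the line makes all integrands below continuous.\<close>
  define h where "h t = f0 (max 0 (min T t))" for t
  have h: "isCont h t" for t
  proof -
    have "continuous_on UNIV h"
      unfolding h_def using T by (intro continuous_on_compose2[OF f0] continuous_intros) auto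
    then show ?thesis by (simp add: continuous_on_eq_continuous_at)
  qed
  \<comment> \<open>The step \<open>s n c\<close> rises from 0 to 1 between \<open>c\<close> and \<open>c + 1 / Suc n\<close>; \<open>r n c\<close> is its slope.\<close>
  define r where "r n c t = real (Suc n) * \<rho> (real (Suc n) * (t - c))" for n c t
  define s where "s n c t = \<sigma> (real (Suc n) * (t - c))" for n c t
  have s': "(s n c has_real_derivative r n c t) (at t)" for n c t
  proof -
    have "((\<lambda>t. real (Suc n) * (t - c)) has_real_derivative real (Suc n)) (at t)"
      by (auto intro!: derivative_eq_intros)
    from DERIV_chain2[OF \<sigma> this] show ?thesis by (simp add: s_def[abs_def] r_def mult.commute)
  qed
  have rc: "isCont (r n c) t" for n c t
    unfolding r_def by (intro continuous_intros isCont_o2[OF _ \<rho>(1)])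
  have ri: "integrable (time_interval T) (\<lambda>t. r n c t * h t)" for n c
    using T by (intro continuous_integrable_time continuous_mult rc h) auto
  have r0: "r n c t = 0" if "t \<le> c \<or> c + 1 / Suc n \<le> t" for n c t
  proof -
    have "real (Suc n) * (t - c) \<le> 0 \<or> 1 \<le> real (Suc n) * (t - c)"
      using that
    proof
      assume "t \<le> c"
      then show ?thesis by (simp add: mult_le_0_iff)
    qed (simp add: field_simps)
    then show ?thesis by (simp add: r_def \<rho>)
  qed
  have small: "\<forall>\<^sub>F n in sequentially. c + 1 / real (Suc n) < d" if "c < d" for c d
  proof -
    have "(\<lambda>n. c + inverse (real (Suc n))) \<longlonglongrightarrow> c"
      using LIMSEQ_inverse_real_of_nat_add[of c] by simp
    from order_tendstoD(2)[OF this that] show ?thesis by (simp add: inverse_eq_divide)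
  qed
  \<comment> \<open>\<open>r n c\<close> is an approximate identity to the right of \<open>c\<close>.\<close>
  have approx: "(\<lambda>n. LINT t|time_interval T. r n c t * h t) \<longlonglongrightarrow> h c" if c: "0 < c" "c < T" for c
  proof (rule tendstoI)
    fix e :: real assume e: "0 < e"
    from h[of c] e obtain d where d: "0 < d" "\<And>t. \<bar>t - c\<bar> < d \<Longrightarrow> \<bar>h t - h c\<bar> < e / 2"
      using half_gt_zero[OF e] unfolding continuous_at_eps_delta dist_real_def by metis
    have cd: "c < c + d" using d(1) by simp
    show "\<forall>\<^sub>F n in sequentially. dist (LINT t|time_interval T. r n c t * h t) (h c) < e"
      using small[OF c(2)] small[OF cd]
    proof eventually_elim
      fix n assume n: "c + 1 / real (Suc n) < T" "c + 1 / real (Suc n) < c + d"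
      have mass: "has_bochner_integral (time_interval T) (r n c) 1"
      proof -
        have "has_bochner_integral (time_interval T) (r n c) (s n c T - s n c 0)"
          using T by (intro has_bochner_integral_FTC_time s' rc) auto
        moreover have "s n c T = 1" unfolding s_def
          by (rule \<sigma>01(4)) (use n(1) in \<open>simp add: field_simps\<close>)
        moreover have "s n c 0 = 0" unfolding s_def
          by (rule \<sigma>01(3)) (use c in \<open>simp add: mult_le_0_iff\<close>)
        ultimately show ?thesis by simp
      qed
      have rint: "integrable (time_interval T) (r n c)" "(LINT t|time_interval T. r n c t) = 1"
        using mass by (auto simp: has_bochner_integral_iff)
      have "(LINT t|time_interval T. r n c t * h t) - h c
          = (LINT t|time_interval T. r n c t * h t - r n c t * h c)"
        using ri rint by simp
      also have "\<bar>\<dots>\<bar> \<le> (LINT t|time_interval T. \<bar>r n c t * h t - r n c t * h c\<bar>)"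
        by (rule integral_abs_bound)
      also have "\<dots> \<le> (LINT t|time_interval T. r n c t * (e / 2))"
      proof (rule integral_mono)
        show "integrable (time_interval T) (\<lambda>t. \<bar>r n c t * h t - r n c t * h c\<bar>)"
          using ri rint by (intro integrable_abs Bochner_Integration.integrable_diff) auto
        show "integrable (time_interval T) (\<lambda>t. r n c t * (e / 2))" using rint by simp
        fix t
        show "\<bar>r n c t * h t - r n c t * h c\<bar> \<le> r n c t * (e / 2)"
        proof (cases "t \<le> c \<or> c + 1 / Suc n \<le> t")
          case False
          then have "\<bar>h t - h c\<bar> < e / 2" using n by (intro d(2)) auto
          moreover have "0 \<le> r n c t" by (simp add: r_def \<rho>)
          ultimately have "r n c t * \<bar>h t - h c\<bar> \<le> r n c t * (e / 2)" by (intro mult_left_mono) auto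
          then show ?thesis using \<open>0 \<le> r n c t\<close> by (simp add: abs_mult flip: right_diff_distrib)
        qed (simp add: r0)
      qed
      also have "\<dots> = e / 2" using rint by simp
      finally show "dist (LINT t|time_interval T. r n c t * h t) (h c) < e"
        using e by (simp add: dist_real_def)
    qed
  qed
  have inner: "h b - h a = prim T k b - prim T k a" if ab: "0 < a" "a < b" "b < T" for a b
  proof -
    \<comment> \<open>A smooth approximation of the indicator function of \<open>{a<..b}\<close>.\<close>
    define \<phi> where "\<phi> n t = s n a t - s n b t" for n t
    have \<phi>': "(\<phi> n has_real_derivative r n a t - r n b t) (at t)" for n t
      unfolding \<phi>_def by (intro DERIV_diff s')
    have d\<phi>: "deriv (\<phi> n) = (\<lambda>t. r n a t - r n b t)" for n
      using \<phi>' by (intro ext DERIV_imp_deriv)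
    have dalg: "deriv (\<phi> n) \<in> flat_algebra" for n
    proof -
      have *: "(\<lambda>t. \<rho> (real (Suc n) * (t - c))) \<in> flat_algebra" for c
        using alg[of "real (Suc n)" "- real (Suc n) * c"] by (simp add: algebra_simps)
      have "(\<lambda>t. real (Suc n) * \<rho> (real (Suc n) * (t - a)) + (- real (Suc n)) * \<rho> (real (Suc n) * (t - b)))
          \<in> flat_algebra"
        by (rule flat_algebra.add[OF flat_algebra.mult[OF flat_algebra.const *]
              flat_algebra.mult[OF flat_algebra.const *]])
      then show ?thesis unfolding d\<phi> r_def by (simp only: mult_minus_left add_uminus_conv_diff)
    qed
    have smooth: "(deriv ^^ i) (\<phi> n) field_differentiable (at t)" for i n t
    proof (cases i)
      case 0
      then show ?thesis using \<phi>' by (auto simp: field_differentiable_def)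
    next
      case (Suc j)
      then show ?thesis using flat_algebra_smooth[OF dalg, of j n t] by (simp add: funpow_swap1)
    qed
    have supp: "\<phi> n t = 0" if "t \<le> a \<or> b + 1 / Suc n \<le> t" for n t
    proof -
      have "(real (Suc n) * (t - a) \<le> 0 \<and> real (Suc n) * (t - b) \<le> 0)
        \<or> (1 \<le> real (Suc n) * (t - a) \<and> 1 \<le> real (Suc n) * (t - b))"
        using that
      proof
        assume "t \<le> a"
        then show ?thesis using ab by (simp add: mult_le_0_iff)
      next
        assume t: "b + 1 / Suc n \<le> t"
        then have "1 \<le> real (Suc n) * (t - b)" by (simp add: field_simps)
        moreover have "real (Suc n) * (t - b) \<le> real (Suc n) * (t - a)"
          using ab by (intro mult_left_mono) auto
        ultimately show ?thesis by linarith
      qed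
      then show ?thesis unfolding \<phi>_def s_def using \<sigma>01(3,4) by auto
    qed
    have test: "\<forall>\<^sub>F n in sequentially. \<phi> n \<in> test_functions T"
      using small[OF ab(3)]
    proof eventually_elim
      fix n assume n: "b + 1 / real (Suc n) < T"
      have "{t. \<phi> n t \<noteq> 0} \<subseteq> {a..b + 1 / Suc n}"       proof
        fix t assume "t \<in> {t. \<phi> n t \<noteq> 0}"
        then have "\<not> (t \<le> a \<or> b + 1 / Suc n \<le> t)" using supp[of t n] by blast
        then show "t \<in> {a..b + 1 / Suc n}" by simp
      qed
      then have "closure {t. \<phi> n t \<noteq> 0} \<subseteq> {a..b + 1 / Suc n}" by (rule closure_minimal) simp
      also have "\<dots> \<subseteq> {0<..<T}" using ab n by auto
      finally show "\<phi> n \<in> test_functions T" using smooth by (simp add: test_functions_def)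
    qed
    have lim1: "(\<lambda>n. LINT t|time_interval T. deriv (\<phi> n) t * f t) \<longlonglongrightarrow> h a - h b"
    proof -
      have "(LINT t|time_interval T. deriv (\<phi> n) t * f t)
          = (LINT t|time_interval T. r n a t * h t) - (LINT t|time_interval T. r n b t * h t)" for n
      proof -
        have "(LINT t|time_interval T. deriv (\<phi> n) t * f t)
            = (LINT t|time_interval T. r n a t * h t - r n b t * h t)"
        proof (rule integral_cong_AE)
          have "deriv (\<phi> n) \<in> borel_measurable borel"
            unfolding d\<phi> using rc by (intro borel_measurable_continuous_onI continuous_at_imp_continuous_on) auto
          then show "(\<lambda>t. deriv (\<phi> n) t * f t) \<in> borel_measurable (time_interval T)"
            by (rule borel_measurable_times[OF borel_measurable_time f])
          show "AE t in time_interval T. deriv (\<phi> n) t * f t = r n a t * h t - r n b t * h t"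
            using ae AE_space by eventually_elim (auto simp: d\<phi> h_def algebra_simps max_def min_def)
        qed (use ri in auto)
        then show ?thesis using ri by simp
      qed
      then show ?thesis using tendsto_diff[OF approx[of a] approx[of b]] ab by simp
    qed
    have lim2: "(\<lambda>n. LINT t|time_interval T. \<phi> n t * k t)
        \<longlonglongrightarrow> (LINT t|time_interval T. indicator {a<..b} t * k t)"
    proof (rule integral_dominated_convergence[where w="\<lambda>t. \<bar>k t\<bar>"])
      have sl: "(\<lambda>n. s n c t) \<longlonglongrightarrow> indicator {c<..} t" for c t
      proof (cases "c < t")
        case False
        then have "s n c t = 0" for n unfolding s_def by (intro \<sigma>01(3)) (simp add: mult_le_0_iff)
        then show ?thesis using False by simp
      next
        case True
        have "\<forall>\<^sub>F n in sequentially. s n c t = 1"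
          using small[OF True]
        proof eventually_elim
          fix n assume "c + 1 / real (Suc n) < t"
          then show "s n c t = 1" unfolding s_def by (intro \<sigma>01(4)) (simp add: field_simps)
        qed
        then show ?thesis using True by (simp add: tendsto_eventually)
      qed
      show "AE t in time_interval T. (\<lambda>n. \<phi> n t * k t) \<longlonglongrightarrow> indicator {a<..b} t * k t"
      proof (rule AE_I2)
        fix t
        have "(\<lambda>n. \<phi> n t) \<longlonglongrightarrow> indicator {a<..} t - indicator {b<..} t"
          unfolding \<phi>_def by (intro tendsto_diff sl)
        also have "indicator {a<..} t - indicator {b<..} t = (indicator {a<..b} t :: real)"
          using ab by (auto simp: indicator_def)
        finally show "(\<lambda>n. \<phi> n t * k t) \<longlonglongrightarrow> indicator {a<..b} t * k t" by (intro tendsto_mult tendsto_const)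
      qed
      show "(\<lambda>t. indicator {a<..b} t * k t) \<in> borel_measurable (time_interval T)"
        using integrable_indicator_time[OF k, of "{a<..b}"] by auto
      have "\<phi> n \<in> borel_measurable borel" for n
        using \<phi>' by (intro borel_measurable_continuous_onI continuous_at_imp_continuous_on ballI DERIV_isCont)
      then show "(\<lambda>t. \<phi> n t * k t) \<in> borel_measurable (time_interval T)" for n
        by (rule borel_measurable_times[OF borel_measurable_time borel_measurable_integrable[OF k]])
      have "\<bar>\<phi> n t\<bar> \<le> 1" for n t
        unfolding \<phi>_def s_def
        using \<sigma>01(1)[of "real (Suc n) * (t - a)"] \<sigma>01(2)[of "real (Suc n) * (t - a)"]
          \<sigma>01(1)[of "real (Suc n) * (t - b)"] \<sigma>01(2)[of "real (Suc n) * (t - b)"] by linarith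
      then show "AE t in time_interval T. norm (\<phi> n t * k t) \<le> \<bar>k t\<bar>" for n
        by (auto simp: abs_mult intro!: mult_left_le_one_le)
    qed (use k in simp)
    have "\<forall>\<^sub>F n in sequentially. (LINT t|time_interval T. deriv (\<phi> n) t * f t)
        = - (LINT t|time_interval T. \<phi> n t * k t)"
      using test by eventually_elim (rule weak)
    from tendsto_cong[OF this] lim1
    have "(\<lambda>n. - (LINT t|time_interval T. \<phi> n t * k t)) \<longlonglongrightarrow> h a - h b" by simp
    from LIMSEQ_unique[OF this tendsto_minus[OF lim2]] show ?thesis
      using prim_diff[OF k, of a b] ab by simp
  qed
  \<comment> \<open>Both sides are continuous up to the end points.\<close>
  have seq: "\<exists>y. (\<forall>n. 0 < y n \<and> y n < T) \<and> y \<longlonglongrightarrow> c" if "0 \<le> c" "c \<le> T" for c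
  proof (intro exI conjI)
    have "(\<lambda>n. c + (T / 2 - c) * inverse (real (Suc n))) \<longlonglongrightarrow> c + (T / 2 - c) * 0"
      by (intro tendsto_intros LIMSEQ_inverse_real_of_nat)
    then show "(\<lambda>n. c + (T / 2 - c) * inverse (real (Suc n))) \<longlonglongrightarrow> c" by simp
    show "\<forall>n. 0 < c + (T / 2 - c) * inverse (real (Suc n)) \<and> c + (T / 2 - c) * inverse (real (Suc n)) < T"
    proof
      fix n
      define \<theta> where "\<theta> = inverse (real (Suc n))"
      have l: "0 < \<theta>" "\<theta> \<le> 1" by (auto simp: \<theta>_def inverse_le_1_iff)
      have eq: "c + (T / 2 - c) * \<theta> = (1 - \<theta>) * c + \<theta> * (T / 2)" by (simp add: algebra_simps)
      have "0 \<le> (1 - \<theta>) * c" "0 < \<theta> * (T / 2)" using l that T by auto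
      moreover have "(1 - \<theta>) * c \<le> (1 - \<theta>) * T" "\<theta> * (T / 2) < \<theta> * T" using l that T by (auto intro: mult_left_mono)
      moreover have "(1 - \<theta>) * T + \<theta> * T = T" by (simp add: algebra_simps)
      ultimately show "0 < c + (T / 2 - c) * inverse (real (Suc n)) \<and> c + (T / 2 - c) * inverse (real (Suc n)) < T"
        unfolding \<theta>_def[symmetric] eq by linarith
    qed
  qed
  obtain y where y: "\<And>n. 0 < y n \<and> y n < T" "y \<longlonglongrightarrow> x" using seq[OF x] by blast
  obtain z where z: "\<And>n. 0 < z n \<and> z n < T" "z \<longlonglongrightarrow> 0" using seq[of 0] T by auto
  have inc: "h (y n) - prim T k (y n) = h (z n) - prim T k (z n)" for n
    using inner[of "y n" "z n"] inner[of "z n" "y n"] y(1)[of n] z(1)[of n]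
    by (cases "y n" "z n" rule: linorder_cases) auto
  have "(\<lambda>n. h (y n) - prim T k (y n)) \<longlonglongrightarrow> h x - prim T k x"
    by (intro tendsto_diff prim_tendsto[OF k y(2)] isCont_tendsto_compose[OF h y(2)])
  moreover have "(\<lambda>n. h (z n) - prim T k (z n)) \<longlonglongrightarrow> h 0 - prim T k 0"
    by (intro tendsto_diff prim_tendsto[OF k z(2)] isCont_tendsto_compose[OF h z(2)])
  ultimately have "h x - prim T k x = h 0 - prim T k 0"
    unfolding inc by (rule LIMSEQ_unique)
  then show ?thesis using x T prim_left[of 0 T k] by (simp add: h_def)
qed

section \<open>Weak convergence of time dependent functionals\<close>

lemma weak_null_closed:
  assumes f: "\<And>k. f k \<in> elems (L2 M)" and g: "g \<in> elems (L2 M)"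
    and lim: "(\<lambda>k. nrm (L2 M) (g - f k)) \<longlonglongrightarrow> 0"
    and l: "\<And>n. l n \<in> elems (L2 M)" "\<And>n. nrm (L2 M) (l n) \<le> B"
    and null: "\<And>k. (\<lambda>n. LINT t|M. f k t * l n t) \<longlonglongrightarrow> 0"
  shows "(\<lambda>n. LINT t|M. g t * l n t) \<longlonglongrightarrow> 0"
proof (rule tendstoI)
  interpret L: semi_inner "L2 M" "\<lambda>f g. LINT x|M. f x * g x" by (rule semi_inner_L2)
  fix e :: real assume e: "0 < e"
  have B: "0 \<le> B" using l(2)[of 0] L.nrm_nonneg[OF l(1), of 0] by simp
  have "(\<lambda>k. nrm (L2 M) (g - f k) * B) \<longlonglongrightarrow> 0 * B" by (intro tendsto_intros lim)
  then have "\<forall>\<^sub>F k in sequentially. nrm (L2 M) (g - f k) * B < e / 2"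
    using e by (intro order_tendstoD) auto
  then obtain k where k: "nrm (L2 M) (g - f k) * B < e / 2"
    using eventually_happens'[OF trivial_limit_sequentially] by blast
  have "\<forall>\<^sub>F n in sequentially. dist (LINT t|M. f k t * l n t) 0 < e / 2"
    using null[of k] e by (intro tendstoD) auto
  then show "\<forall>\<^sub>F n in sequentially. dist (LINT t|M. g t * l n t) 0 < e"
  proof eventually_elim
    fix n assume n: "dist (LINT t|M. f k t * l n t) 0 < e / 2"
    have gf: "g - f k \<in> elems (L2 M)" using g f by (rule L.diff_mem)
    have "\<bar>LINT t|M. (g - f k) t * l n t\<bar> \<le> nrm (L2 M) (g - f k) * nrm (L2 M) (l n)"
      by (rule L.cauchy_schwarz[OF gf l(1)])
    also have "\<dots> \<le> nrm (L2 M) (g - f k) * B"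
      using l(2) L.nrm_nonneg[OF gf] by (intro mult_left_mono)
    finally have "\<bar>(LINT t|M. g t * l n t) - (LINT t|M. f k t * l n t)\<bar> < e / 2"
      using k L.diff_left[OF g f l(1), of k n] by simp
    with n show "dist (LINT t|M. g t * l n t) 0 < e" unfolding dist_real_def by linarith
  qed
qed

text \<open>A Dynkin class argument: a bounded sequence in \<open>L\<^sup>2\<close> whose primitives tend to 0 tends to 0
  weakly on all measurable sets, since by boundedness the sets with this property are closed under
  countable disjoint unions.\<close>

lemma weak_null_on_measurable_sets:
  assumes l: "\<And>n. l n \<in> elems (L2 (time_interval T))" "\<And>n. nrm (L2 (time_interval T)) (l n) \<le> B"
    and prim: "\<And>x. 0 \<le> x \<Longrightarrow> x \<le> T \<Longrightarrow> (\<lambda>n. prim T (l n) x) \<longlonglongrightarrow> 0" and T: "0 \<le> T"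
    and A: "A \<in> sets (time_interval T)"
  shows "(\<lambda>n. LINT t|time_interval T. indicator A t * l n t) \<longlonglongrightarrow> 0"
proof -
  let ?M = "time_interval T"
  interpret finite_measure ?M by (rule finite_measure_time)
  interpret L: semi_inner "L2 ?M" "\<lambda>f g. LINT x|?M. f x * g x" by (rule semi_inner_L2)
  have lint: "integrable ?M (l n)" for n
    using L2_mult_integrable[OF const_in_L2[of 1] l(1)] by simp
  have ind: "(indicator D :: real \<Rightarrow> real) \<in> elems (L2 ?M)" if "D \<in> sets borel" for D
  proof -
    have "(indicator D t :: real)\<^sup>2 = indicator D t * 1" for t by (simp add: indicator_def)
    then show ?thesis
      using indicator_measurable_time[OF that, of T] integrable_indicator_time[of T "\<lambda>_. 1" D] that
      by (simp add: L2_mem_iff)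
  qed
  have prim': "(\<lambda>n. prim T (l n) x) \<longlonglongrightarrow> 0" for x
  proof -
    consider "x < 0" | "0 \<le> x" "x \<le> T" | "T < x" by linarith
    then show ?thesis
    proof cases
      case 3
      then show ?thesis using prim[OF T order_refl] by (simp add: prim_right)
    qed (use prim in \<open>auto simp: prim_left\<close>)
  qed
  have total: "(\<lambda>n. LINT t|?M. l n t) \<longlonglongrightarrow> 0" using prim'[of T] by (simp add: prim_right)
  have borel: "(\<lambda>n. LINT t|?M. indicator D t * l n t) \<longlonglongrightarrow> 0" if D: "D \<in> sets borel" for D :: "real set"
  proof -
    have sig: "sets (borel :: real measure) = sigma_sets UNIV (range (\<lambda>a. {..a}))"
      by (subst borel_eq_atMost) (simp add: sets_measure_of)
    have "Int_stable (range (\<lambda>a :: real. {..a}))" by (auto simp: Int_stable_def)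
    moreover have "range (\<lambda>a :: real. {..a}) \<subseteq> Pow UNIV" by simp
    moreover have "D \<in> sigma_sets UNIV (range (\<lambda>a. {..a}))" using D by (simp add: sig)
    ultimately show ?thesis
    proof (induction rule: sigma_sets_induct_disjoint)
      case (basic D)
      then obtain a where "D = {..a}" by auto
      then show ?case using prim'[of a] by (simp add: prim_def)
    next
      case empty
      show ?case by simp
    next
      case (compl D)
      have D: "D \<in> sets borel" using compl by (simp add: sig)
      have "(LINT t|?M. indicator (UNIV - D) t * l n t)
          = (LINT t|?M. l n t) - (LINT t|?M. indicator D t * l n t)" for n
      proof -
        have "(LINT t|?M. indicator (UNIV - D) t * l n t) = (LINT t|?M. l n t - indicator D t * l n t)"
          by (intro Bochner_Integration.integral_cong) (auto simp: indicator_def)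
        then show ?thesis using lint integrable_indicator_time[OF lint D] by simp
      qed
      then show ?case using tendsto_diff[OF total compl.IH] by simp
    next
      case (union D)
      have D: "D i \<in> sets borel" for i using union.hyps(2) by (auto simp: sig)
      define E where "E k = (\<Union>i<k. D i)" for k
      have E: "E k \<in> sets borel" for k using D by (auto simp: E_def)
      have U: "(\<Union>i. D i) \<in> sets borel" using D by auto
      have ex: "indicator (E k) t = (\<Sum>i<k. indicator (D i) t :: real)" for k t
        unfolding E_def using union.hyps(1)
        by (intro indicator_UN_disjoint) (auto simp: disjoint_family_on_def)
      show ?case
      proof (rule weak_null_closed[where f = "\<lambda>k. indicator (E k)" and l = l, OF ind[OF E] ind[OF U] _ l])
        fix k
        have "(LINT t|?M. indicator (E k) t * l n t) = (\<Sum>i<k. LINT t|?M. indicator (D i) t * l n t)" for n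
          unfolding ex sum_distrib_right
          using integrable_indicator_time[OF lint D] by (intro Bochner_Integration.integral_sum)
        then show "(\<lambda>n. LINT t|?M. indicator (E k) t * l n t) \<longlonglongrightarrow> 0"
          using tendsto_sum[of "{..<k}" "\<lambda>i n. LINT t|?M. indicator (D i) t * l n t" "\<lambda>_. 0"] union.IH by simp
      next
        have "(\<lambda>k. LINT t|?M. ((indicator (\<Union>i. D i) - indicator (E k)) t :: real)\<^sup>2) \<longlonglongrightarrow> (LINT t|?M. 0)"
        proof (rule integral_dominated_convergence[where w = "\<lambda>_. 1"])
          show "(\<lambda>t. ((indicator (\<Union>i. D i) - indicator (E k)) t)\<^sup>2 :: real) \<in> borel_measurable ?M" for k
            using L.diff_mem[OF ind[OF U] ind[OF E], of k] by (auto simp: L2_mem_iff)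
          show "AE t in ?M. (\<lambda>k. ((indicator (\<Union>i. D i) - indicator (E k)) t)\<^sup>2 :: real) \<longlonglongrightarrow> 0"
          proof (rule AE_I2)
            fix t
            have "\<forall>\<^sub>F k in sequentially. indicator (\<Union>i. D i) t - indicator (E k) t = (0 :: real)"
            proof (cases "t \<in> (\<Union>i. D i)")
              case True
              then obtain i where "t \<in> D i" by auto
              then have "t \<in> E k" if "k > i" for k using that by (auto simp: E_def)
              then show ?thesis using True
                by (intro eventually_sequentiallyI[of "Suc i"]) (auto simp: Suc_le_eq)
            next
              case False
              then have "t \<notin> E k" for k by (auto simp: E_def)
              then show ?thesis using False by simp
            qed
            then show "(\<lambda>k. ((indicator (\<Union>i. D i) - indicator (E k)) t)\<^sup>2 :: real) \<longlonglongrightarrow> 0"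
              by (intro tendsto_eventually) (auto elim!: eventually_mono)
          qed
          show "AE t in ?M. norm (((indicator (\<Union>i. D i) - indicator (E k)) t)\<^sup>2 :: real) \<le> 1" for k
            by (auto simp: indicator_def)
        qed auto
        from tendsto_real_sqrt[OF this]
        show "(\<lambda>k. nrm (L2 ?M) (indicator (\<Union>i. D i) - indicator (E k))) \<longlonglongrightarrow> 0"
          by (simp add: L2_nrm)
      qed
    qed
  qed
  have "A \<in> sets lebesgue" using A by (auto simp: sets_restrict_space_iff)
  then obtain S N N' where SN: "A = S \<union> N" "N \<subseteq> N'" "N' \<in> null_sets lborel" "S \<in> sets lborel"
    by (auto elim: sets_completionE)
  have "N' \<in> null_sets lebesgue" using SN(3) by (rule null_sets_completionI)
  then have "AE t in lebesgue. t \<notin> N'" by (rule AE_not_in)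
  then have "AE t in ?M. t \<notin> N'" by (subst AE_restrict_space_iff) (auto elim: eventually_mono)
  then have ae: "AE t in ?M. indicator A t * l n t = indicator S t * l n t" for n
    by eventually_elim (use SN in \<open>auto simp: indicator_def\<close>)
  have "(LINT t|?M. indicator A t * l n t) = (LINT t|?M. indicator S t * l n t)" for n
  proof (rule integral_cong_AE[OF _ _ ae])
    show "(\<lambda>t. indicator A t * l n t) \<in> borel_measurable ?M"
      using A lint by (intro borel_measurable_times borel_measurable_indicator) auto
    show "(\<lambda>t. indicator S t * l n t) \<in> borel_measurable ?M"
      using SN(4) integrable_indicator_time[OF lint, of S n] by auto
  qed
  then show ?thesis using borel[of S] SN(4) by simp
qed

context bochner
begin

lemma apply_simple_eq_sum:
  assumes q: "simple_in M X q" and t: "t \<in> space M"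
  shows "(F (q t) :: real) = (\<Sum>y\<in>q ` space M. indicator (q -` {y} \<inter> space M) t * F y)"
proof -
  have "(\<Sum>y\<in>q ` space M. indicator (q -` {y} \<inter> space M) t * F y)
      = (\<Sum>y\<in>q ` space M. if y = q t then F y else 0)"
    using t by (intro sum.cong) (auto simp: indicator_def)
  also have "\<dots> = F (q t)" using q t by (simp add: simple_in_def simple_function_def)
  finally show ?thesis by simp
qed

text \<open>By \<open>null\<close> the integrals tend to 0 on simple functions, which are dense; the bound by \<open>N\<close> makes
  the functionals on the Bochner space equicontinuous.\<close>

lemma functionals_weak_null:
  assumes meas: "\<And>n v. v \<in> elems X \<Longrightarrow> (\<lambda>t. L n t v) \<in> borel_measurable M"
    and lin: "\<And>n. AE t in M. \<forall>u\<in>elems X. \<forall>v\<in>elems X. L n t (u - v) = L n t u - L n t v"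
    and bound: "\<And>n. AE t in M. \<forall>v\<in>elems X. \<bar>L n t v\<bar> \<le> N n t * nrm X v"
    and N: "\<And>n. N n \<in> elems (L2 M)" "\<And>n. nrm (L2 M) (N n) \<le> B"
    and null: "\<And>v A. v \<in> elems X \<Longrightarrow> A \<in> sets M \<Longrightarrow> (\<lambda>n. LINT t|M. indicator A t * L n t v) \<longlonglongrightarrow> 0"
    and p: "p \<in> elems (bochner_L2 M X)"
  shows "integrable M (\<lambda>t. L n t (p t))" and "(\<lambda>n. LINT t|M. L n t (p t)) \<longlonglongrightarrow> 0"
proof -
  interpret LM: semi_inner "L2 M" "\<lambda>f g. LINT x|M. f x * g x" by (rule semi_inner_L2)
  obtain s where s: "\<And>k. simple_in M X (s k)" and sp: "\<And>k. nrm (bochner_L2 M X) (p - s k) \<le> (1/2)^k"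
    using simple_dense_in_bochner_L2[OF p] by blast
  have pX: "AE t in M. p t \<in> elems X" by (rule bochner_L2_AE_mem[OF p])
  have ps: "p - s k \<in> elems (bochner_L2 M X)" for k
    by (intro bochner_L2_diff p simple_in_bochner_L2 s)
  have smeas: "(\<lambda>t. L n t (s k t)) \<in> borel_measurable M" for n k
  proof -
    have "(\<lambda>t. \<Sum>y\<in>s k ` space M. indicator (s k -` {y} \<inter> space M) t * L n t y) \<in> borel_measurable M"
      using s[of k] by (intro borel_measurable_sum borel_measurable_times borel_measurable_indicator meas)
        (auto simp: simple_in_def simple_function_def)
    then show ?thesis
      using apply_simple_eq_sum[OF s] by (subst measurable_cong) auto
  qed
  have pmeas: "(\<lambda>t. L n t (p t)) \<in> borel_measurable M" for n
  proof -
    have "AE t in M. summable (\<lambda>k. \<bar>nrm X ((p - s k) t)\<bar>)"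
      using sp by (intro AE_summable_if_L2_geometric bochner_L2_nrm_in_L2 ps) (simp only: bochner_L2_nrm_eq)
    then have "AE t in M. (\<lambda>k. L n t (s k t)) \<longlonglongrightarrow> L n t (p t)"
      using pX lin[of n] bound[of n] AE_space
    proof eventually_elim
      fix t assume t: "summable (\<lambda>k. \<bar>nrm X ((p - s k) t)\<bar>)" "p t \<in> elems X"
        "\<forall>u\<in>elems X. \<forall>v\<in>elems X. L n t (u - v) = L n t u - L n t v"
        "\<forall>v\<in>elems X. \<bar>L n t v\<bar> \<le> N n t * nrm X v" "t \<in> space M"
      have sX: "s k t \<in> elems X" for k using simple_in_mem[OF s t(5)] .
      have "(\<lambda>k. nrm X (p t - s k t)) \<longlonglongrightarrow> 0"
        using summable_LIMSEQ_zero[OF t(1)] by (simp add: tendsto_rabs_zero_iff)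
      from tendsto_mult_left[OF this, of "N n t"]
      have z: "(\<lambda>k. N n t * nrm X (p t - s k t)) \<longlonglongrightarrow> 0" by simp
      show "(\<lambda>k. L n t (s k t)) \<longlonglongrightarrow> L n t (p t)"
      proof (rule LIM_zero_cancel, rule Lim_null_comparison[OF always_eventually z], rule allI)
        fix k
        show "norm (L n t (s k t) - L n t (p t)) \<le> N n t * nrm X (p t - s k t)"
        proof -
          have "L n t (p t - s k t) = L n t (p t) - L n t (s k t)" using t(2,3) sX[of k] by blast
          moreover have "\<bar>L n t (p t - s k t)\<bar> \<le> N n t * nrm X (p t - s k t)"
            using t(4) diff_mem[OF t(2) sX] by blast
          ultimately show ?thesis by (simp add: abs_minus_commute)
        qed
      qed
    qed
    then show ?thesis by (rule AE_limit_measurable[OF smeas])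
  qed
  have intg: "integrable M (\<lambda>t. L n t (q t)) \<and>
      \<bar>LINT t|M. L n t (q t)\<bar> \<le> B * nrm (bochner_L2 M X) q"
    if q: "q \<in> elems (bochner_L2 M X)" and m: "(\<lambda>t. L n t (q t)) \<in> borel_measurable M" for q n
  proof -
    have int: "integrable M (\<lambda>t. N n t * nrm X (q t))"
      by (intro L2_mult_integrable N bochner_L2_nrm_in_L2 q)
    have le: "AE t in M. \<bar>L n t (q t)\<bar> \<le> N n t * nrm X (q t)"
      using bound[of n] bochner_L2_AE_mem[OF q] by eventually_elim auto
    have i: "integrable M (\<lambda>t. L n t (q t))"
      by (rule Bochner_Integration.integrable_bound[OF int m])
        (use le in \<open>auto elim!: eventually_mono intro: order_trans\<close>)
    have "\<bar>LINT t|M. L n t (q t)\<bar> \<le> (LINT t|M. \<bar>L n t (q t)\<bar>)" by (rule integral_abs_bound)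
    also have "\<dots> \<le> (LINT t|M. N n t * nrm X (q t))"
      using i int le by (intro integral_mono_AE) auto
    also have "\<dots> \<le> nrm (L2 M) (N n) * nrm (bochner_L2 M X) q"
      using LM.cauchy_schwarz[OF N(1) bochner_L2_nrm_in_L2[OF q], of n]
      by (simp add: bochner_L2_nrm_eq abs_le_iff)
    also have "\<dots> \<le> B * nrm (bochner_L2 M X) q"
      using N(2) by (intro mult_right_mono) (auto simp: bochner_L2_nrm)
    finally show ?thesis using i by simp
  qed
  have pint: "integrable M (\<lambda>t. L n t (p t))" for n using intg[OF p pmeas] by simp
  then show "integrable M (\<lambda>t. L n t (p t))" .
  have sint: "integrable M (\<lambda>t. L n t (s k t))" for n k
    using intg[OF simple_in_bochner_L2[OF s] smeas] by simp
  have slim: "(\<lambda>n. LINT t|M. L n t (s k t)) \<longlonglongrightarrow> 0" for k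
  proof -
    let ?I = "\<lambda>y. s k -` {y} \<inter> space M"
    have I: "?I y \<in> sets M" if "y \<in> s k ` space M" for y
      using s[of k] that by (auto simp: simple_in_def simple_function_def)
    have yX: "y \<in> elems X" if "y \<in> s k ` space M" for y using s[of k] that by (auto simp: simple_in_def)
    have int1: "integrable M (\<lambda>t. indicator (?I y) t * L n t y)" if y: "y \<in> s k ` space M" for n y
    proof -
      have "simple_in M X (\<lambda>_. y)" using yX[OF y] by (auto simp: simple_in_def)
      from intg[OF simple_in_bochner_L2[OF this] meas[OF yX[OF y]]]
      have "integrable M (\<lambda>t. L n t y)" by simp
      from integrable_mult_indicator[OF I[OF y] this] show ?thesis by simp
    qed
    have "(LINT t|M. L n t (s k t)) = (\<Sum>y\<in>s k ` space M. LINT t|M. indicator (?I y) t * L n t y)" for n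
    proof -
      have "(LINT t|M. L n t (s k t)) = (LINT t|M. (\<Sum>y\<in>s k ` space M. indicator (?I y) t * L n t y))"
        by (intro Bochner_Integration.integral_cong refl apply_simple_eq_sum s)
      also have "\<dots> = (\<Sum>y\<in>s k ` space M. LINT t|M. indicator (?I y) t * L n t y)"
        by (rule Bochner_Integration.integral_sum[OF int1])
      finally show ?thesis .
    qed
    moreover have "(\<lambda>n. \<Sum>y\<in>s k ` space M. LINT t|M. indicator (?I y) t * L n t y) \<longlonglongrightarrow> (\<Sum>y\<in>s k ` space M. 0)"
      by (intro tendsto_sum null yX I)
    ultimately show ?thesis by simp
  qed
  have B: "0 \<le> B" using N(2)[of 0] LM.nrm_nonneg[OF N(1), of 0] by simp
  show "(\<lambda>n. LINT t|M. L n t (p t)) \<longlonglongrightarrow> 0"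
  proof (rule tendstoI)
    fix e :: real assume e: "0 < e"
    have "(\<lambda>k. B * (1/2)^k :: real) \<longlonglongrightarrow> B * 0" by (intro tendsto_intros LIMSEQ_realpow_zero) auto
    then have "\<forall>\<^sub>F k in sequentially. B * (1/2)^k < e / 2" using e by (intro order_tendstoD) auto
    then obtain k where k: "B * (1/2)^k < e / 2"
      using eventually_happens'[OF trivial_limit_sequentially] by blast
    have "\<forall>\<^sub>F n in sequentially. dist (LINT t|M. L n t (s k t)) 0 < e / 2"
      using slim[of k] e by (intro tendstoD) auto
    then show "\<forall>\<^sub>F n in sequentially. dist (LINT t|M. L n t (p t)) 0 < e"
    proof eventually_elim
      fix n assume n: "dist (LINT t|M. L n t (s k t)) 0 < e / 2"
      have eq: "AE t in M. L n t (p t) - L n t (s k t) = L n t ((p - s k) t)"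
        using pX lin[of n] AE_space by eventually_elim (simp add: simple_in_mem[OF s])
      have m: "(\<lambda>t. L n t ((p - s k) t)) \<in> borel_measurable M"
        by (rule AE_limit_measurable[of "\<lambda>_ t. L n t (p t) - L n t (s k t)"])
          (use pmeas smeas eq in \<open>auto elim: eventually_mono\<close>)
      have "(LINT t|M. L n t (p t)) - (LINT t|M. L n t (s k t)) = (LINT t|M. L n t ((p - s k) t))"
      proof -
        have "(LINT t|M. L n t (p t)) - (LINT t|M. L n t (s k t)) = (LINT t|M. L n t (p t) - L n t (s k t))"
          using pint sint by simp
        also have "\<dots> = (LINT t|M. L n t ((p - s k) t))"
          by (rule integral_cong_AE[OF _ m eq]) (use pmeas smeas in auto)
        finally show ?thesis .
      qed
      moreover have "\<bar>LINT t|M. L n t ((p - s k) t)\<bar> \<le> B * nrm (bochner_L2 M X) (p - s k)"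
        using conjunct2[OF intg[OF ps m]] .
      moreover have "B * nrm (bochner_L2 M X) (p - s k) \<le> B * (1/2)^k"
        using B sp by (intro mult_left_mono)
      ultimately show "dist (LINT t|M. L n t (p t)) 0 < e"
        using n k by (simp add: dist_real_def)
    qed
  qed
qed

end

section \<open>The energy identity\<close>

lemma (in semi_inner) isCont_form:
  fixes P Q :: "real \<Rightarrow> 'v"
  assumes P: "\<And>s. P s \<in> elems X" "((\<lambda>r. nrm X (P r - P t)) \<longlongrightarrow> 0) (at t)"
    and Q: "\<And>s. Q s \<in> elems X" "((\<lambda>r. nrm X (Q r - Q t)) \<longlongrightarrow> 0) (at t)"
  shows "isCont (\<lambda>s. b (P s) (Q s)) t"
  unfolding isCont_def
proof (rule LIM_zero_cancel, rule Lim_null_comparison)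
  have "((\<lambda>r. nrm X (P r - P t) * (nrm X (Q t) + nrm X (Q r - Q t)) + nrm X (P t) * nrm X (Q r - Q t))
      \<longlongrightarrow> 0 * (nrm X (Q t) + 0) + nrm X (P t) * 0) (at t)"
    by (intro tendsto_intros P Q)
  then show "((\<lambda>r. nrm X (P r - P t) * (nrm X (Q t) + nrm X (Q r - Q t)) + nrm X (P t) * nrm X (Q r - Q t))
      \<longlongrightarrow> 0) (at t)" by simp
  show "\<forall>\<^sub>F r in at t. norm (b (P r) (Q r) - b (P t) (Q t))
      \<le> nrm X (P r - P t) * (nrm X (Q t) + nrm X (Q r - Q t)) + nrm X (P t) * nrm X (Q r - Q t)"
  proof (rule always_eventually, rule allI)
    fix r
    have "nrm X (P r - P t) * nrm X (Q r) \<le> nrm X (P r - P t) * (nrm X (Q t) + nrm X (Q r - Q t))"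
      using nrm_reverse_triangle[OF Q(1) Q(1), of r t] nrm_nonneg[OF diff_mem[OF P(1) P(1)], of r t]
      by (intro mult_left_mono) auto
    then show "norm (b (P r) (Q r) - b (P t) (Q t))
      \<le> nrm X (P r - P t) * (nrm X (Q t) + nrm X (Q r - Q t)) + nrm X (P t) * nrm X (Q r - Q t)"
      using form_diff_bound[OF P(1) Q(1) P(1) Q(1), of r r t t] by simp
  qed
qed

text \<open>A seminormed space \<open>X\<close> embedded in a space \<open>H\<close> with a semi-inner product \<open>b\<close>; through \<open>b\<close>,
  elements of \<open>H\<close> act as functionals on \<open>X\<close>.\<close>

locale gelfand = X: seminormed X + H: semi_inner H b
  for X :: "'v::real_vector nspace" and H :: "'v nspace" and b :: "'v \<Rightarrow> 'v \<Rightarrow> real" +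
  assumes sub: "elems X \<subseteq> elems H"
begin

text \<open>The function \<open>u\<close> has the derivative \<open>w\<close> with values in the dual of \<open>X\<close> and the continuous
  representative \<open>c\<close> in \<open>H\<close>. The derivative is encoded by the increments of \<open>c\<close>, tested with each
  element of \<open>X\<close>, which is the form in which it enters the difference quotients.\<close>

definition evolution ::
  "real \<Rightarrow> (real \<Rightarrow> 'v) \<Rightarrow> (real \<Rightarrow> 'v) \<Rightarrow> (real \<Rightarrow> 'v \<Rightarrow> real) \<Rightarrow> bool" where
  "evolution T u c w \<longleftrightarrow>
     u \<in> elems (bochner_L2 (time_interval T) X) \<and> w \<in> elems (bochner_L2 (time_interval T) (dual X)) \<and>
     (\<forall>t\<in>{0..T}. c t \<in> elems H) \<and>
     (\<forall>t\<in>{0..T}. ((\<lambda>r. nrm H (c r - c t)) \<longlongrightarrow> 0) (at t within {0..T})) \<and>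
     (AE t in time_interval T. same_in H (u t) (c t)) \<and>
     (\<forall>v\<in>elems X. \<forall>x\<in>{0..T}. b (c x) v = b (c 0) v + prim T (\<lambda>t. w t v) x)"

lemma evolutionD:
  assumes "evolution T u c w"
  shows "u \<in> elems (bochner_L2 (time_interval T) X)" "w \<in> elems (bochner_L2 (time_interval T) (dual X))"
    and "\<And>t. t \<in> {0..T} \<Longrightarrow> c t \<in> elems H"
    and "\<And>t. t \<in> {0..T} \<Longrightarrow> ((\<lambda>r. nrm H (c r - c t)) \<longlongrightarrow> 0) (at t within {0..T})"
    and "AE t in time_interval T. same_in H (u t) (c t)"
    and "\<And>v x. v \<in> elems X \<Longrightarrow> x \<in> {0..T} \<Longrightarrow> b (c x) v = b (c 0) v + prim T (\<lambda>t. w t v) x"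
  using assms unfolding evolution_def by blast+

lemma bochner_time: "bochner X (time_interval T)"
  using finite_measure_time complete_measure_time X.seminormed_axioms by (simp add: bochner_def)

lemma bochner_dual_time: "bochner (dual X) (time_interval T)"
  using finite_measure_time complete_measure_time X.seminormed_dual by (simp add: bochner_def)

lemma dual_apply_integrable:
  assumes w: "w \<in> elems (bochner_L2 (time_interval T) (dual X))" and v: "v \<in> elems X"
  shows "integrable (time_interval T) (\<lambda>t. w t v)" "(\<lambda>t. w t v) \<in> borel_measurable (time_interval T)"
proof -
  interpret B: bochner X "time_interval T" by (rule bochner_time)
  have "simple_in (time_interval T) X (\<lambda>_. v)" using v by (auto simp: simple_in_def)
  from B.bochner_L2_integrable_apply(1)[OF B.simple_in_bochner_L2[OF this] w]
  show "integrable (time_interval T) (\<lambda>t. w t v)" .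
  then show "(\<lambda>t. w t v) \<in> borel_measurable (time_interval T)" by auto
qed

lemma evolution_combine:
  assumes u: "evolution T u c w" and u': "evolution T u' c' w'"
  shows "evolution T (\<lambda>t. \<alpha> *\<^sub>R u t + \<beta> *\<^sub>R u' t) (\<lambda>t. \<alpha> *\<^sub>R c t + \<beta> *\<^sub>R c' t) (\<lambda>t. \<alpha> *\<^sub>R w t + \<beta> *\<^sub>R w' t)"
  unfolding evolution_def
proof (intro conjI ballI)
  interpret B: bochner X "time_interval T" by (rule bochner_time)
  interpret D: bochner "dual X" "time_interval T" by (rule bochner_dual_time)
  note a = evolutionD(1-5)[OF u] and a' = evolutionD(1-5)[OF u']
  show "(\<lambda>t. \<alpha> *\<^sub>R u t + \<beta> *\<^sub>R u' t) \<in> elems (bochner_L2 (time_interval T) X)"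
    using a a' by (intro B.bochner_L2_combine) auto
  show "(\<lambda>t. \<alpha> *\<^sub>R w t + \<beta> *\<^sub>R w' t) \<in> elems (bochner_L2 (time_interval T) (dual X))"
    using a a' by (intro D.bochner_L2_combine) auto
  show mem: "\<alpha> *\<^sub>R c t + \<beta> *\<^sub>R c' t \<in> elems H" if "t \<in> {0..T}" for t
    using a a' that by (auto intro!: H.add_mem H.scale_mem)
  have combine: "nrm H (\<alpha> *\<^sub>R x + \<beta> *\<^sub>R x' - (\<alpha> *\<^sub>R y + \<beta> *\<^sub>R y')) \<le> \<bar>\<alpha>\<bar> * nrm H (x - y) + \<bar>\<beta>\<bar> * nrm H (x' - y')"
    if "x \<in> elems H" "x' \<in> elems H" "y \<in> elems H" "y' \<in> elems H" for x x' y y'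
  proof -
    have "\<alpha> *\<^sub>R x + \<beta> *\<^sub>R x' - (\<alpha> *\<^sub>R y + \<beta> *\<^sub>R y') = \<alpha> *\<^sub>R (x - y) + \<beta> *\<^sub>R (x' - y')"
      by (simp add: algebra_simps)
    then show ?thesis
      using H.nrm_add[OF H.scale_mem[OF H.diff_mem] H.scale_mem[OF H.diff_mem], of x y x' y' \<alpha> \<beta>] that
      by (simp add: H.nrm_scale H.diff_mem)
  qed
  show "((\<lambda>r. nrm H (\<alpha> *\<^sub>R c r + \<beta> *\<^sub>R c' r - (\<alpha> *\<^sub>R c t + \<beta> *\<^sub>R c' t))) \<longlongrightarrow> 0) (at t within {0..T})"
    if t: "t \<in> {0..T}" for t
  proof (rule Lim_null_comparison)
    have "((\<lambda>r. \<bar>\<alpha>\<bar> * nrm H (c r - c t) + \<bar>\<beta>\<bar> * nrm H (c' r - c' t)) \<longlongrightarrow> \<bar>\<alpha>\<bar> * 0 + \<bar>\<beta>\<bar> * 0) (at t within {0..T})"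
      using a a' t by (intro tendsto_intros) auto
    then show "((\<lambda>r. \<bar>\<alpha>\<bar> * nrm H (c r - c t) + \<bar>\<beta>\<bar> * nrm H (c' r - c' t)) \<longlongrightarrow> 0) (at t within {0..T})" by simp
    have "norm (nrm H (\<alpha> *\<^sub>R c r + \<beta> *\<^sub>R c' r - (\<alpha> *\<^sub>R c t + \<beta> *\<^sub>R c' t)))
        \<le> \<bar>\<alpha>\<bar> * nrm H (c r - c t) + \<bar>\<beta>\<bar> * nrm H (c' r - c' t)" if "r \<in> {0..T}" for r
      using combine[of "c r" "c' r" "c t" "c' t"] a a' t that H.nrm_nonneg[OF H.diff_mem[OF mem mem], of r t]
      by auto
    then show "\<forall>\<^sub>F r in at t within {0..T}. norm (nrm H (\<alpha> *\<^sub>R c r + \<beta> *\<^sub>R c' r - (\<alpha> *\<^sub>R c t + \<beta> *\<^sub>R c' t)))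
        \<le> \<bar>\<alpha>\<bar> * nrm H (c r - c t) + \<bar>\<beta>\<bar> * nrm H (c' r - c' t)"
      by (auto simp: eventually_at_filter intro: always_eventually)
  qed
  have "AE t in time_interval T. same_in H (u t) (c t)" "AE t in time_interval T. same_in H (u' t) (c' t)"
    using a a' by auto
  then show "AE t in time_interval T. same_in H (\<alpha> *\<^sub>R u t + \<beta> *\<^sub>R u' t) (\<alpha> *\<^sub>R c t + \<beta> *\<^sub>R c' t)"
  proof eventually_elim
    fix t assume t: "same_in H (u t) (c t)" "same_in H (u' t) (c' t)"
    then have m: "u t \<in> elems H" "u' t \<in> elems H" "c t \<in> elems H" "c' t \<in> elems H" by (auto simp: same_in_def)
    have mm: "\<alpha> *\<^sub>R u t + \<beta> *\<^sub>R u' t \<in> elems H" "\<alpha> *\<^sub>R c t + \<beta> *\<^sub>R c' t \<in> elems H"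
      using m by (auto intro!: H.add_mem H.scale_mem)
    show "same_in H (\<alpha> *\<^sub>R u t + \<beta> *\<^sub>R u' t) (\<alpha> *\<^sub>R c t + \<beta> *\<^sub>R c' t)"
      using combine[OF m] t mm H.nrm_nonneg[OF H.diff_mem[OF mm]] by (simp add: same_in_def)
  qed
  fix v x assume v: "v \<in> elems X" and x: "x \<in> {0..T}"
  have w: "w \<in> elems (bochner_L2 (time_interval T) (dual X))" "w' \<in> elems (bochner_L2 (time_interval T) (dual X))"
    using a a' by auto
  have m: "c y \<in> elems H" "c' y \<in> elems H" if "y \<in> {0..T}" for y using a a' that by auto
  have vH: "v \<in> elems H" using v sub by auto
  have bc: "b (\<alpha> *\<^sub>R c y + \<beta> *\<^sub>R c' y) v = \<alpha> * b (c y) v + \<beta> * b (c' y) v" if "y \<in> {0..T}" for y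
    using m[OF that] vH by (simp add: H.add_left H.scale_left H.scale_mem)
  have "prim T (\<lambda>t. (\<alpha> *\<^sub>R w t + \<beta> *\<^sub>R w' t) v) x
      = (LINT t|time_interval T. \<alpha> * (indicator {..x} t * w t v) + \<beta> * (indicator {..x} t * w' t v))"
    unfolding prim_def by (intro Bochner_Integration.integral_cong) (auto simp: scaleR_fun_def algebra_simps)
  also have "\<dots> = \<alpha> * prim T (\<lambda>t. w t v) x + \<beta> * prim T (\<lambda>t. w' t v) x"
    unfolding prim_def
    using integrable_indicator_time[OF dual_apply_integrable(1)[OF w(1) v], of "{..x}"]
      integrable_indicator_time[OF dual_apply_integrable(1)[OF w(2) v], of "{..x}"] by simp
  finally have p: "prim T (\<lambda>t. (\<alpha> *\<^sub>R w t + \<beta> *\<^sub>R w' t) v) x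
      = \<alpha> * prim T (\<lambda>t. w t v) x + \<beta> * prim T (\<lambda>t. w' t v) x" .
  have "b (c x) v = b (c 0) v + prim T (\<lambda>t. w t v) x" "b (c' x) v = b (c' 0) v + prim T (\<lambda>t. w' t v) x"
    by (rule evolutionD(6)[OF u v x], rule evolutionD(6)[OF u' v x])
  moreover have "0 \<in> {0..T}" using x by auto
  ultimately show "b (\<alpha> *\<^sub>R c x + \<beta> *\<^sub>R c' x) v
      = b (\<alpha> *\<^sub>R c 0 + \<beta> *\<^sub>R c' 0) v + prim T (\<lambda>t. (\<alpha> *\<^sub>R w t + \<beta> *\<^sub>R w' t) v) x"
    unfolding p using bc x by (simp add: algebra_simps)
qed

end

locale evolving = gelfand X H b
  for X :: "'v::real_vector nspace" and H :: "'v nspace" and b :: "'v \<Rightarrow> 'v \<Rightarrow> real" +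
  fixes T :: real and u c :: "real \<Rightarrow> 'v" and w :: "real \<Rightarrow> 'v \<Rightarrow> real"
  assumes T: "0 \<le> T" and ev: "evolution T u c w"
begin

abbreviation "I \<equiv> time_interval T"

sublocale B: bochner X I
  by (rule bochner_time)

sublocale D: bochner "dual X" I
  by (rule bochner_dual_time)

lemmas u = evolutionD(1)[OF ev] and w = evolutionD(2)[OF ev] and cH = evolutionD(3)[OF ev]
  and cc = evolutionD(4)[OF ev] and uc = evolutionD(5)[OF ev] and wc = evolutionD(6)[OF ev]

lemma wdual: "AE t in I. w t \<in> elems (dual X)"
  by (rule D.bochner_L2_AE_mem[OF w])

definition rate :: "real \<Rightarrow> real" where
  "rate t = nrm (dual X) (w t)"

text \<open>By the Cauchy--Schwarz inequality, increments of \<open>c\<close> are bounded in the dual of \<open>X\<close> by the square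
  root of the product of the time step and the increment of this primitive.\<close>

definition rate_energy :: "real \<Rightarrow> real" where
  "rate_energy = prim T (\<lambda>t. (rate t)\<^sup>2)"

lemma rate_in_L2: "rate \<in> elems (L2 I)"
  unfolding rate_def[abs_def] by (rule D.bochner_L2_nrm_in_L2[OF w])

lemma rate_integrable: "integrable I (\<lambda>t. (rate t)\<^sup>2)"
  using rate_in_L2 by (simp add: L2_mem_iff)

lemma isCont_rate_energy: "isCont rate_energy t"
  unfolding rate_energy_def by (rule isCont_prim[OF rate_integrable])

lemma rate_energy_mono:
  assumes st: "s \<le> t" shows "rate_energy s \<le> rate_energy t"
proof -
  have "0 \<le> rate_energy t - rate_energy s"
    unfolding rate_energy_def prim_diff[OF rate_integrable st] by (intro integral_nonneg_AE) (auto simp: indicator_def)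
  then show ?thesis by simp
qed

text \<open>The extension of \<open>c\<close> by constants to the whole line makes difference quotients with steps in
  both directions available on the whole interval.\<close>

definition clamp :: "real \<Rightarrow> real" where
  "clamp t = max 0 (min T t)"

definition c_ext :: "real \<Rightarrow> 'v" where
  "c_ext t = c (clamp t)"

lemma clamp_mem: "clamp t \<in> {0..T}"
  using T by (auto simp: clamp_def)

lemma c_ext_mem: "c_ext t \<in> elems H"
  unfolding c_ext_def by (rule cH[OF clamp_mem])

lemma c_ext_tendsto: "((\<lambda>r. nrm H (c_ext r - c_ext t)) \<longlongrightarrow> 0) (at t)"
proof -
  have "continuous_on {0..T} (\<lambda>r. nrm H (c r - c (clamp t)))"
    unfolding continuous_on_def
  proof
    fix r assume r: "r \<in> {0..T}"
    show "((\<lambda>r. nrm H (c r - c (clamp t))) \<longlongrightarrow> nrm H (c r - c (clamp t))) (at r within {0..T})"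
    proof (rule LIM_zero_cancel, rule Lim_null_comparison[OF _ cc[OF r]])
      have "norm (nrm H (c q - c (clamp t)) - nrm H (c r - c (clamp t))) \<le> nrm H (c q - c r)" if "q \<in> {0..T}" for q
        using H.nrm_reverse_triangle[OF H.diff_mem H.diff_mem, of "c q" "c (clamp t)" "c r" "c (clamp t)"]
          cH that r clamp_mem by simp
      then show "\<forall>\<^sub>F q in at r within {0..T}. norm (nrm H (c q - c (clamp t)) - nrm H (c r - c (clamp t))) \<le> nrm H (c q - c r)"
        by (auto simp: eventually_at_filter intro: always_eventually)
    qed
  qed
  then have "continuous_on UNIV (\<lambda>r. nrm H (c (clamp r) - c (clamp t)))"
    by (rule continuous_on_compose2) (use clamp_mem in \<open>auto simp: clamp_def intro!: continuous_intros\<close>)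
  then have "isCont (\<lambda>r. nrm H (c_ext r - c_ext t)) t"
    by (simp add: c_ext_def continuous_on_eq_continuous_at)
  then show ?thesis using H.nrm_zero by (simp add: isCont_def)
qed

lemma c_ext_shift_tendsto: "((\<lambda>r. nrm H (c_ext (r - e) - c_ext (t - e))) \<longlongrightarrow> 0) (at t)"
proof -
  have "filterlim (\<lambda>r. r - e) (at (t - e)) (at t)"
    unfolding filterlim_at by (intro conjI tendsto_intros) (auto simp: eventually_at_filter)
  from filterlim_compose[OF c_ext_tendsto this] show ?thesis by simp
qed

lemma nrm_const_tendsto: "((\<lambda>r. nrm H (v - v)) \<longlongrightarrow> 0) F"
  by (simp add: H.nrm_zero)

lemma c_ext_increment:
  assumes v: "v \<in> elems X"
  shows "b (c_ext t) v - b (c_ext s) v = prim T (\<lambda>t. w t v) t - prim T (\<lambda>t. w t v) s"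
proof -
  have p: "prim T (\<lambda>t. w t v) (clamp t) = prim T (\<lambda>t. w t v) t" for t
  proof -
    consider "t < 0" | "0 \<le> t" "t \<le> T" | "T < t" by linarith
    then show ?thesis using T by cases (auto simp: clamp_def prim_left prim_right max_def min_def)
  qed
  show ?thesis unfolding c_ext_def wc[OF v clamp_mem] by (simp add: p)
qed

lemma c_ext_increment_bound:
  assumes v: "v \<in> elems X" and st: "s \<le> t"
  shows "\<bar>b (c_ext t - c_ext s) v\<bar> \<le> sqrt (t - s) * sqrt (rate_energy t - rate_energy s) * nrm X v"
proof -
  have wi: "integrable I (\<lambda>t. w t v)" by (rule dual_apply_integrable[OF w v])
  have "b (c_ext t - c_ext s) v = (LINT r|I. indicator {s<..t} r * w r v)"
    using c_ext_increment[OF v, of t s] prim_diff[OF wi st] v sub c_ext_mem by (subst H.diff_left) auto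
  also have "\<bar>\<dots>\<bar> \<le> (LINT r|I. \<bar>indicator {s<..t} r * w r v\<bar>)" by (rule integral_abs_bound)
  also have "\<dots> \<le> (LINT r|I. indicator {s<..t} r * \<bar>rate r\<bar> * nrm X v)"
  proof (rule integral_mono_AE)
    show "integrable I (\<lambda>r. \<bar>indicator {s<..t} r * w r v\<bar>)"
      using integrable_indicator_time[OF wi, of "{s<..t}"] by (intro integrable_abs) auto
    have "integrable I (\<lambda>r. \<bar>rate r\<bar>)"
      using L2_mult_integrable[OF B.const_in_L2[of 1] rate_in_L2] by auto
    then show "integrable I (\<lambda>r. indicator {s<..t} r * \<bar>rate r\<bar> * nrm X v)"
      by (intro integrable_mult_left integrable_indicator_time) auto
    show "AE r in I. \<bar>indicator {s<..t} r * w r v\<bar> \<le> indicator {s<..t} r * \<bar>rate r\<bar> * nrm X v"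
      using wdual
    proof eventually_elim
      fix r assume "w r \<in> elems (dual X)"
      from X.dual_bound[OF this v] X.dual_nrm_nonneg[OF this]
      show "\<bar>indicator {s<..t} r * w r v\<bar> \<le> indicator {s<..t} r * \<bar>rate r\<bar> * nrm X v"
        by (auto simp: rate_def indicator_def)
    qed
  qed
  also have "\<dots> = (LINT r|I. indicator {s<..t} r * \<bar>rate r\<bar>) * nrm X v" by simp
  also have "\<dots> \<le> sqrt (t - s) * sqrt (rate_energy t - rate_energy s) * nrm X v"
    using prim_cauchy_schwarz[OF rate_in_L2 st] X.nrm_nonneg[OF v] unfolding rate_energy_def by (intro mult_right_mono)
  finally show ?thesis .
qed

text \<open>The difference quotients as functionals, and a bound for them in the dual of \<open>X\<close> whose square
  is again a difference quotient.\<close>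

definition quot :: "real \<Rightarrow> real \<Rightarrow> 'v \<Rightarrow> real" where
  "quot e s v = b (c_ext s - c_ext (s - e)) v / e"

definition quot_bound :: "real \<Rightarrow> real \<Rightarrow> real" where
  "quot_bound e s = sqrt ((rate_energy s - rate_energy (s - e)) / e)"

lemma rate_energy_quotient_nonneg: "e \<noteq> 0 \<Longrightarrow> 0 \<le> (rate_energy s - rate_energy (s - e)) / e"
  using rate_energy_mono[of "s - e" s] rate_energy_mono[of s "s - e"] by (cases "0 < e") (auto simp: divide_nonpos_neg)

lemma isCont_quot_bound: "e \<noteq> 0 \<Longrightarrow> isCont (quot_bound e) s"
  unfolding quot_bound_def[abs_def] by (intro continuous_intros isCont_o2[OF _ isCont_rate_energy] isCont_rate_energy)

lemma quot_le:
  assumes v: "v \<in> elems X" and e: "e \<noteq> 0"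
  shows "\<bar>quot e s v\<bar> \<le> quot_bound e s * nrm X v"
proof -
  have "\<bar>b (c_ext s - c_ext (s - e)) v\<bar> \<le> sqrt \<bar>e\<bar> * sqrt \<bar>rate_energy s - rate_energy (s - e)\<bar> * nrm X v"
  proof (cases "0 < e")
    case True
    then show ?thesis using c_ext_increment_bound[OF v, of "s - e" s] rate_energy_mono[of "s - e" s] by simp
  next
    case False
    have "b (c_ext s - c_ext (s - e)) v = - b (c_ext (s - e) - c_ext s) v"
      using H.diff_left[OF c_ext_mem c_ext_mem] v sub by auto
    then show ?thesis using False c_ext_increment_bound[OF v, of s "s - e"] rate_energy_mono[of s "s - e"] by simp
  qed
  then have "\<bar>quot e s v\<bar> \<le> sqrt \<bar>e\<bar> * sqrt \<bar>rate_energy s - rate_energy (s - e)\<bar> * nrm X v / \<bar>e\<bar>"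
    using e by (simp add: quot_def divide_right_mono)
  also have "\<dots> = sqrt \<bar>(rate_energy s - rate_energy (s - e)) / e\<bar> * nrm X v"
  proof -
    define r where "r = sqrt \<bar>e\<bar>"
    have r: "0 < r" "\<bar>e\<bar> = r * r" using e by (auto simp: r_def)
    have "sqrt \<bar>(rate_energy s - rate_energy (s - e)) / e\<bar> = sqrt \<bar>rate_energy s - rate_energy (s - e)\<bar> / r"
      by (simp add: real_sqrt_divide abs_divide r_def)
    then show ?thesis unfolding r_def[symmetric] r(2) using r(1) by simp
  qed
  also have "\<dots> = quot_bound e s * nrm X v" using rate_energy_quotient_nonneg[OF e, of s] by (simp only: quot_bound_def abs_of_nonneg)
  finally show ?thesis .
qed

text \<open>The difference quotients converge weakly to \<open>w\<close>; tested with \<open>u\<close> this can be written in terms of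
  \<open>c\<close>, with which \<open>u\<close> agrees almost everywhere.\<close>

lemma quot_tendsto:
  assumes e: "e \<longlonglongrightarrow> 0" "\<And>n. e n \<noteq> 0" and x: "0 \<le> x" "x \<le> T"
  shows "(\<lambda>n. prim T (\<lambda>s. quot (e n) s (c_ext s)) x) \<longlonglongrightarrow> prim T (\<lambda>s. w s (u s)) x"
proof -
  interpret LM: semi_inner "L2 I" "\<lambda>f g. LINT x|I. f x * g x" by (rule semi_inner_L2)
  define L where "L n s v = quot (e n) s v - w s v" for n s v
  define NN where "NN n s = quot_bound (e n) s + rate s" for n s
  have Acont: "isCont (\<lambda>s. quot (e n) s v) s" if "v \<in> elems X" for n s v
  proof -
    have "v \<in> elems H" using that sub by auto
    then have "isCont (\<lambda>s. b (c_ext s) v) s" "isCont (\<lambda>s. b (c_ext (s - e n)) v) s"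
      by (intro H.isCont_form c_ext_mem c_ext_tendsto c_ext_shift_tendsto nrm_const_tendsto; simp)+
    moreover have "quot (e n) s v = (b (c_ext s) v - b (c_ext (s - e n)) v) / e n" for s
      using \<open>v \<in> elems H\<close> by (simp add: quot_def H.diff_left c_ext_mem)
    ultimately show ?thesis using e(2) by (auto intro!: continuous_intros)
  qed
  have ameas: "(\<lambda>s. quot (e n) s v) \<in> borel_measurable I" if "v \<in> elems X" for n v
    using Acont[OF that] by (intro borel_measurable_integrable continuous_integrable_time T) auto
  have meas: "(\<lambda>t. L n t v) \<in> borel_measurable I" if "v \<in> elems X" for n v
    unfolding L_def using ameas[OF that] dual_apply_integrable(2)[OF w that] by (intro borel_measurable_diff)
  have lin: "AE t in I. \<forall>u\<in>elems X. \<forall>v\<in>elems X. L n t (u - v) = L n t u - L n t v" for n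
    using wdual
  proof eventually_elim
    fix t assume wt: "w t \<in> elems (dual X)"
    show "\<forall>u\<in>elems X. \<forall>v\<in>elems X. L n t (u - v) = L n t u - L n t v"
    proof (intro ballI)
      fix u v assume uv: "u \<in> elems X" "v \<in> elems X"
      then have "u \<in> elems H" "v \<in> elems H" using sub by auto
      then have "b (c_ext t - c_ext (t - e n)) (u - v) = b (c_ext t - c_ext (t - e n)) u - b (c_ext t - c_ext (t - e n)) v"
        by (intro H.diff_right H.diff_mem c_ext_mem)
      then show "L n t (u - v) = L n t u - L n t v"
        using X.dual_diff[OF wt uv] by (simp add: L_def quot_def diff_divide_distrib)
    qed
  qed
  have bound: "AE t in I. \<forall>v\<in>elems X. \<bar>L n t v\<bar> \<le> NN n t * nrm X v" for n
    using wdual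
  proof eventually_elim
    fix t assume wt: "w t \<in> elems (dual X)"
    show "\<forall>v\<in>elems X. \<bar>L n t v\<bar> \<le> NN n t * nrm X v"
    proof
      fix v assume v: "v \<in> elems X"
      show "\<bar>L n t v\<bar> \<le> NN n t * nrm X v"
        using quot_le[OF v e(2), of n t] X.dual_bound[OF wt v]
        unfolding L_def NN_def rate_def distrib_right by linarith
    qed
  qed
  have N2: "(quot_bound (e n) s)\<^sup>2 = (rate_energy s - rate_energy (s - e n)) / e n" for n s
    unfolding quot_bound_def by (rule real_sqrt_pow2[OF rate_energy_quotient_nonneg[OF e(2)]])
  have NL: "quot_bound (e n) \<in> elems (L2 I)" for n
    unfolding L2_mem_iff using isCont_quot_bound[OF e(2)[of n]]
    by (auto intro!: borel_measurable_integrable[of I "quot_bound (e n)"] continuous_integrable_time T continuous_intros)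
  have NNL: "NN n \<in> elems (L2 I)" for n
    using LM.add_mem[OF NL rate_in_L2, of n] by (simp add: NN_def[abs_def] plus_fun_def)
  have "(\<lambda>n. prim T (\<lambda>s. (quot_bound (e n) s)\<^sup>2) T) \<longlonglongrightarrow> rate_energy T - rate_energy 0"
    unfolding N2 by (rule prim_difference_quotient_tendsto[OF T isCont_rate_energy e T order_refl])
  then have "(\<lambda>n. LINT s|I. (quot_bound (e n) s)\<^sup>2) \<longlonglongrightarrow> rate_energy T - rate_energy 0" by (simp add: prim_right)
  from tendsto_real_sqrt[OF this] have "(\<lambda>n. nrm (L2 I) (quot_bound (e n))) \<longlonglongrightarrow> sqrt (rate_energy T - rate_energy 0)" by (simp add: L2_nrm)
  then have "Bseq (\<lambda>n. nrm (L2 I) (quot_bound (e n)))" using convergentI convergent_imp_Bseq by blast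
  then obtain R where R: "\<And>n. norm (nrm (L2 I) (quot_bound (e n))) \<le> R" by (auto simp: Bseq_def)
  have NNB: "nrm (L2 I) (NN n) \<le> R + nrm (L2 I) rate" for n
    using LM.nrm_add[OF NL rate_in_L2, of n] R[of n] by (simp add: NN_def[abs_def] plus_fun_def)
  have null: "(\<lambda>n. LINT t|I. indicator F t * L n t v) \<longlonglongrightarrow> 0"
    if v: "v \<in> elems X" and mF: "F \<in> sets I" for v F
  proof (rule weak_null_on_measurable_sets[OF _ _ _ T mF])
    have wi: "integrable I (\<lambda>t. w t v)" by (rule dual_apply_integrable[OF w v])
    have LN: "AE t in I. \<bar>L n t v\<bar> \<le> NN n t * nrm X v" for n
      using bound[of n] by eventually_elim (use v in auto)
    have LN2: "AE t in I. (L n t v)\<^sup>2 \<le> (NN n t * nrm X v)\<^sup>2" for n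
      using LN[of n]
    proof eventually_elim
      fix t assume "\<bar>L n t v\<bar> \<le> NN n t * nrm X v"
      then have "\<bar>L n t v\<bar>\<^sup>2 \<le> (NN n t * nrm X v)\<^sup>2" by (intro power_mono) auto
      then show "(L n t v)\<^sup>2 \<le> (NN n t * nrm X v)\<^sup>2" by simp
    qed
    have N2i: "integrable I (\<lambda>t. (NN n t * nrm X v)\<^sup>2)" for n
      using NNL[of n] by (simp add: L2_mem_iff power_mult_distrib)
    have L2i: "integrable I (\<lambda>t. (L n t v)\<^sup>2)" for n
    proof (rule Bochner_Integration.integrable_bound[OF N2i])
      show "(\<lambda>t. (L n t v)\<^sup>2) \<in> borel_measurable I" using meas[OF v, of n] by measurable
      show "AE t in I. norm ((L n t v)\<^sup>2) \<le> norm ((NN n t * nrm X v)\<^sup>2)"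
        using LN2[of n] by eventually_elim simp
    qed
    show LL: "(\<lambda>t. L n t v) \<in> elems (L2 I)" for n
      using L2i meas[OF v] by (simp add: L2_mem_iff)
    show "nrm (L2 I) (\<lambda>t. L n t v) \<le> (R + nrm (L2 I) rate) * nrm X v" for n
    proof -
      have "(LINT t|I. (L n t v)\<^sup>2) \<le> (LINT t|I. (NN n t * nrm X v)\<^sup>2)"
        by (intro integral_mono_AE L2i N2i LN2)
      then have "nrm (L2 I) (\<lambda>t. L n t v) \<le> sqrt (LINT t|I. (NN n t * nrm X v)\<^sup>2)"
        unfolding L2_nrm by (rule real_sqrt_le_mono)
      also have "\<dots> = nrm (L2 I) (NN n) * nrm X v"
        using X.nrm_nonneg[OF v] by (simp add: L2_nrm power_mult_distrib real_sqrt_mult)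
      also have "\<dots> \<le> (R + nrm (L2 I) rate) * nrm X v"
        using NNB X.nrm_nonneg[OF v] by (intro mult_right_mono)
      finally show ?thesis .
    qed
    fix y assume y: "0 \<le> y" "y \<le> T"
    have vH: "v \<in> elems H" using v sub by auto
    have F: "isCont (\<lambda>s. b (c_ext s) v) s" for s using vH by (intro H.isCont_form c_ext_mem c_ext_tendsto nrm_const_tendsto) auto
    have "(\<lambda>n. prim T (\<lambda>s. (b (c_ext s) v - b (c_ext (s - e n)) v) / e n) y) \<longlonglongrightarrow> b (c_ext y) v - b (c_ext 0) v"
      by (rule prim_difference_quotient_tendsto[OF T F e y])
    moreover have "prim T (\<lambda>t. L n t v) y
        = prim T (\<lambda>s. (b (c_ext s) v - b (c_ext (s - e n)) v) / e n) y - (b (c_ext y) v - b (c_ext 0) v)" for n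
    proof -
      have eq: "quot (e n) s v = (b (c_ext s) v - b (c_ext (s - e n)) v) / e n" for s
        using vH by (simp add: quot_def H.diff_left c_ext_mem)
      have ai: "integrable I (\<lambda>s. quot (e n) s v)"
        by (intro continuous_integrable_time T Acont v)
      have "prim T (\<lambda>t. L n t v) y = prim T (\<lambda>s. quot (e n) s v) y - prim T (\<lambda>t. w t v) y"
        unfolding prim_def L_def right_diff_distrib
        by (rule Bochner_Integration.integral_diff) (auto intro!: integrable_indicator_time ai wi)
      then show ?thesis using c_ext_increment[OF v, of y 0] by (simp add: eq prim_left)
    qed
    ultimately show "(\<lambda>n. prim T (\<lambda>t. L n t v) y) \<longlonglongrightarrow> 0"
      by (simp add: LIM_zero_iff)
  qed
  \<comment> \<open>Truncation at \<open>x\<close> keeps these properties.\<close>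
  define Lx where "Lx n t v = indicator {..x} t * L n t v" for n t v
  have lim0: "(\<lambda>n. LINT t|I. Lx n t (u t)) \<longlonglongrightarrow> 0" and Lxi: "integrable I (\<lambda>t. Lx n t (u t))" for n
  proof -
    have m: "(\<lambda>t. Lx n t v) \<in> borel_measurable I" if "v \<in> elems X" for n v
      unfolding Lx_def using meas[OF that] indicator_measurable_time[of "{..x}" T]
      by (intro borel_measurable_times) auto
    have l: "AE t in I. \<forall>u\<in>elems X. \<forall>v\<in>elems X. Lx n t (u - v) = Lx n t u - Lx n t v" for n
      using lin[of n] by eventually_elim (simp add: Lx_def right_diff_distrib)
    have bd: "AE t in I. \<forall>v\<in>elems X. \<bar>Lx n t v\<bar> \<le> NN n t * nrm X v" for n
      using bound[of n]
    proof eventually_elim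
      fix t assume t: "\<forall>v\<in>elems X. \<bar>L n t v\<bar> \<le> NN n t * nrm X v"
      show "\<forall>v\<in>elems X. \<bar>Lx n t v\<bar> \<le> NN n t * nrm X v"
        using t by (fastforce simp: Lx_def indicator_def intro: order_trans[OF abs_ge_zero])
    qed
    have nl: "(\<lambda>n. LINT t|I. indicator F t * Lx n t v) \<longlonglongrightarrow> 0"
      if v: "v \<in> elems X" and mF: "F \<in> sets I" for v F
    proof -
      have "F \<inter> {..x} = F \<inter> ({..x} \<inter> space I)" using sets.sets_into_space[OF mF] by auto
      moreover have "{..x} \<inter> space I \<in> sets I" by (simp add: sets_restrict_space_iff)
      ultimately have "F \<inter> {..x} \<in> sets I" using mF by auto
      from null[OF v this] show ?thesis
        by (simp add: Lx_def indicator_inter_arith mult.assoc)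
    qed
    show "(\<lambda>n. LINT t|I. Lx n t (u t)) \<longlonglongrightarrow> 0"
      by (rule B.functionals_weak_null(2)[OF m l bd NNL NNB nl u])
    show "integrable I (\<lambda>t. Lx n t (u t))" for n
      by (rule B.functionals_weak_null(1)[OF m l bd NNL NNB nl u])
  qed
  have wui: "integrable I (\<lambda>t. w t (u t))" by (rule B.bochner_L2_integrable_apply(1)[OF u w])
  have CCi: "integrable I (\<lambda>t. quot (e n) t (c_ext t))" for n
  proof (intro continuous_integrable_time T)
    have "quot (e n) t (c_ext t) = (b (c_ext t) (c_ext t) - b (c_ext (t - e n)) (c_ext t)) / e n" for t
      by (simp add: quot_def H.diff_left c_ext_mem)
    moreover have "isCont (\<lambda>t. (b (c_ext t) (c_ext t) - b (c_ext (t - e n)) (c_ext t)) / e n) t" for t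
      using e(2) by (intro continuous_intros H.isCont_form c_ext_mem c_ext_tendsto c_ext_shift_tendsto) auto
    ultimately show "isCont (\<lambda>t. quot (e n) t (c_ext t)) t" for t by simp
  qed
  have "(LINT t|I. Lx n t (u t)) = prim T (\<lambda>s. quot (e n) s (c_ext s)) x - prim T (\<lambda>s. w s (u s)) x" for n
  proof -
    have "AE t in I. Lx n t (u t) = indicator {..x} t * quot (e n) t (c_ext t) - indicator {..x} t * w t (u t)"
      using uc AE_space
    proof eventually_elim
      fix t assume t: "same_in H (u t) (c t)" "t \<in> space I"
      then have tt: "c t = c_ext t" by (auto simp: c_ext_def clamp_def)
      have m: "u t \<in> elems H" "u t - c_ext t \<in> elems H" "nrm H (u t - c_ext t) = 0"
        using t c_ext_mem tt H.diff_mem by (auto simp: same_in_def)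
      have d: "c_ext t - c_ext (t - e n) \<in> elems H" using c_ext_mem by (intro H.diff_mem)
      have "b (c_ext t - c_ext (t - e n)) (u t - c_ext t) = 0"
        using H.cauchy_schwarz[OF d m(2)] m(3) by simp
      then have "b (c_ext t - c_ext (t - e n)) (u t) = b (c_ext t - c_ext (t - e n)) (c_ext t)"
        using H.diff_right[OF m(1) c_ext_mem d, of t] by simp
      then show "Lx n t (u t) = indicator {..x} t * quot (e n) t (c_ext t) - indicator {..x} t * w t (u t)"
        by (simp add: Lx_def L_def quot_def right_diff_distrib)
    qed
    then have "(LINT t|I. Lx n t (u t))
        = (LINT t|I. indicator {..x} t * quot (e n) t (c_ext t) - indicator {..x} t * w t (u t))"
      using Lxi[of n] integrable_indicator_time[OF CCi, of "{..x}" n] integrable_indicator_time[OF wui, of "{..x}"]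
      by (intro integral_cong_AE) auto
    also have "\<dots> = prim T (\<lambda>s. quot (e n) s (c_ext s)) x - prim T (\<lambda>s. w s (u s)) x"
      unfolding prim_def by (intro Bochner_Integration.integral_diff integrable_indicator_time CCi wui) auto
    finally show ?thesis .
  qed
  with lim0 show ?thesis by (simp add: LIM_zero_iff)
qed

end

context gelfand
begin

text \<open>Compare the increments of \<open>\<parallel>c\<parallel>\<^sup>2\<close> with backward differences,
  \<open>b (c s) (c s) - b (c r) (c r) = 2 * b (c s - c r) (c s) - b (c s - c r) (c s - c r)\<close> for \<open>r = s - e\<close>.
  The difference quotients of \<open>c\<close> converge weakly to \<open>w\<close>, so the first term gives the claimed
  integral in the limit, while after division by \<open>e\<close> the last term has the sign of \<open>-e\<close>. Thus
  positive \<open>e\<close> and negative \<open>e\<close> yield the two inequalities.\<close>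

theorem energy_identity:
  assumes T: "0 \<le> T" and ev: "evolution T u c w" and x: "0 \<le> x" "x \<le> T"
  shows "b (c x) (c x) = b (c 0) (c 0) + 2 * prim T (\<lambda>s. w s (u s)) x"
proof -
  interpret evolving X H b T u c w
    by unfold_locales (fact T, fact ev)
  define g where "g s = b (c_ext s) (c_ext s)" for s
  have g: "isCont g s" for s unfolding g_def[abs_def] by (intro H.isCont_form c_ext_mem c_ext_tendsto)
  have gx: "g x = b (c x) (c x)" "g 0 = b (c 0) (c 0)" using x T by (auto simp: g_def c_ext_def clamp_def)
  have gq: "(g s - g (s - e)) / e = 2 * quot e s (c_ext s) - b (c_ext s - c_ext (s - e)) (c_ext s - c_ext (s - e)) / e" for s e
  proof -
    have "b (c_ext s - c_ext (s - e)) (c_ext s - c_ext (s - e)) = g s - 2 * b (c_ext s) (c_ext (s - e)) + g (s - e)"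
      unfolding g_def by (rule H.square_diff[OF c_ext_mem c_ext_mem])
    moreover have "b (c_ext s - c_ext (s - e)) (c_ext s) = g s - b (c_ext s) (c_ext (s - e))"
      unfolding g_def by (simp add: H.diff_left c_ext_mem H.sym)
    ultimately show ?thesis by (simp add: quot_def diff_divide_distrib add_divide_distrib)
  qed
  have compare: "\<And>e. 0 < e \<Longrightarrow> prim T (\<lambda>s. (g s - g (s - e)) / e) x \<le> 2 * prim T (\<lambda>s. quot e s (c_ext s)) x"
    and compare': "\<And>e. e < 0 \<Longrightarrow> 2 * prim T (\<lambda>s. quot e s (c_ext s)) x \<le> prim T (\<lambda>s. (g s - g (s - e)) / e) x"
  proof -
    have i: "integrable I (\<lambda>s. (g s - g (s - e)) / e)" "integrable I (\<lambda>s. 2 * quot e s (c_ext s))" if "e \<noteq> 0" for e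
    proof -
      show "integrable I (\<lambda>s. (g s - g (s - e)) / e)"
        using that by (intro continuous_integrable_time T continuous_intros g isCont_o2[OF _ g]) auto
      have "2 * quot e s (c_ext s) = 2 * ((b (c_ext s) (c_ext s) - b (c_ext (s - e)) (c_ext s)) / e)" for s
        by (simp add: quot_def H.diff_left c_ext_mem)
      moreover have "isCont (\<lambda>s. 2 * ((b (c_ext s) (c_ext s) - b (c_ext (s - e)) (c_ext s)) / e)) s" for s
        using that by (intro continuous_intros H.isCont_form c_ext_mem c_ext_tendsto c_ext_shift_tendsto) auto
      ultimately show "integrable I (\<lambda>s. 2 * quot e s (c_ext s))"
        by (intro continuous_integrable_time T) simp
    qed
    have double: "2 * prim T (\<lambda>s. quot e s (c_ext s)) x = prim T (\<lambda>s. 2 * quot e s (c_ext s)) x" for e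
      unfolding prim_def by (simp add: mult.left_commute)
    have sq: "0 \<le> b (c_ext s - c_ext (s - e)) (c_ext s - c_ext (s - e))" for s e by (intro H.nonneg H.diff_mem c_ext_mem)
    show "prim T (\<lambda>s. (g s - g (s - e)) / e) x \<le> 2 * prim T (\<lambda>s. quot e s (c_ext s)) x" if e: "0 < e" for e
      unfolding double unfolding prim_def
    proof (rule integral_mono)
      fix s
      have "(g s - g (s - e)) / e \<le> 2 * quot e s (c_ext s)" unfolding gq using sq[of s e] e by simp
      then show "indicator {..x} s * ((g s - g (s - e)) / e) \<le> indicator {..x} s * (2 * quot e s (c_ext s))"
        by (intro mult_left_mono) auto
    qed (use e in \<open>intro integrable_indicator_time i; simp\<close>)+
    show "2 * prim T (\<lambda>s. quot e s (c_ext s)) x \<le> prim T (\<lambda>s. (g s - g (s - e)) / e) x" if e: "e < 0" for e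
      unfolding double unfolding prim_def
    proof (rule integral_mono)
      fix s
      have "2 * quot e s (c_ext s) \<le> (g s - g (s - e)) / e" unfolding gq using sq[of s e] e by (simp add: divide_nonneg_neg)
      then show "indicator {..x} s * (2 * quot e s (c_ext s)) \<le> indicator {..x} s * ((g s - g (s - e)) / e)"
        by (intro mult_left_mono) auto
    qed (use e in \<open>intro integrable_indicator_time i; simp\<close>)+
  qed
  let ?e = "\<lambda>n. inverse (real (Suc n))"
  have e: "?e \<longlonglongrightarrow> 0" "(\<lambda>n. - ?e n) \<longlonglongrightarrow> 0"
    using LIMSEQ_inverse_real_of_nat tendsto_minus[OF LIMSEQ_inverse_real_of_nat] by auto
  have "g x - g 0 \<le> 2 * prim T (\<lambda>s. w s (u s)) x"
  proof (rule LIMSEQ_le)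
    show "(\<lambda>n. prim T (\<lambda>s. (g s - g (s - ?e n)) / ?e n) x) \<longlonglongrightarrow> g x - g 0"
      by (rule prim_difference_quotient_tendsto[OF T g e(1) _ x]) simp
    show "(\<lambda>n. 2 * prim T (\<lambda>s. quot (?e n) s (c_ext s)) x) \<longlonglongrightarrow> 2 * prim T (\<lambda>s. w s (u s)) x"
      by (intro tendsto_intros quot_tendsto e(1) x) simp
    show "\<exists>quot_bound. \<forall>n\<ge>quot_bound. prim T (\<lambda>s. (g s - g (s - ?e n)) / ?e n) x \<le> 2 * prim T (\<lambda>s. quot (?e n) s (c_ext s)) x"
      by (intro exI allI impI compare) simp
  qed
  moreover have "2 * prim T (\<lambda>s. w s (u s)) x \<le> g x - g 0"
  proof (rule LIMSEQ_le)
    show "(\<lambda>n. prim T (\<lambda>s. (g s - g (s - - ?e n)) / - ?e n) x) \<longlonglongrightarrow> g x - g 0"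
      by (rule prim_difference_quotient_tendsto[OF T g e(2) _ x]) simp
    show "(\<lambda>n. 2 * prim T (\<lambda>s. quot (- ?e n) s (c_ext s)) x) \<longlonglongrightarrow> 2 * prim T (\<lambda>s. w s (u s)) x"
      by (intro tendsto_intros quot_tendsto e(2) x) simp
    show "\<exists>quot_bound. \<forall>n\<ge>quot_bound. 2 * prim T (\<lambda>s. quot (- ?e n) s (c_ext s)) x \<le> prim T (\<lambda>s. (g s - g (s - - ?e n)) / - ?e n) x"
      by (intro exI allI impI compare') simp
  qed
  ultimately show ?thesis using gx by simp
qed

text \<open>Polarization of the energy identity.\<close>

corollary integration_by_parts:
  assumes T: "0 \<le> T" and ev: "evolution T u c w" "evolution T u' c' w'" and x: "0 \<le> x" "x \<le> T"
  shows "b (c x) (c' x) = b (c 0) (c' 0) + prim T (\<lambda>s. w s (u' s) + w' s (u s)) x"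
proof -
  let ?M = "time_interval T"
  interpret B: bochner X ?M by (rule bochner_time)
  interpret D: bochner "dual X" ?M by (rule bochner_dual_time)
  have u: "u \<in> elems (bochner_L2 ?M X)" "u' \<in> elems (bochner_L2 ?M X)"
    and w: "w \<in> elems (bochner_L2 ?M (dual X))" "w' \<in> elems (bochner_L2 ?M (dual X))"
    and cH: "c x \<in> elems H" "c' x \<in> elems H" "c 0 \<in> elems H" "c' 0 \<in> elems H"
    using evolutionD(1-3)[OF ev(1)] evolutionD(1-3)[OF ev(2)] x T by auto
  have int: "integrable ?M (\<lambda>s. w s (u s))" "integrable ?M (\<lambda>s. w s (u' s))"
    "integrable ?M (\<lambda>s. w' s (u s))" "integrable ?M (\<lambda>s. w' s (u' s))"
    using u w by (auto intro: B.bochner_L2_integrable_apply(1))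
  have ev2: "evolution T (\<lambda>t. u t + u' t) (\<lambda>t. c t + c' t) (\<lambda>t. w t + w' t)"
    using evolution_combine[OF ev, of 1 1] by simp
  have "prim T (\<lambda>s. (w s + w' s) (u s + u' s)) x
      = prim T (\<lambda>s. w s (u s)) x + prim T (\<lambda>s. w s (u' s) + w' s (u s)) x + prim T (\<lambda>s. w' s (u' s)) x"
  proof -
    have "prim T (\<lambda>s. (w s + w' s) (u s + u' s)) x
        = (LINT s|?M. indicator {..x} s * w s (u s) + indicator {..x} s * (w s (u' s) + w' s (u s))
            + indicator {..x} s * w' s (u' s))"
      unfolding prim_def
    proof (rule integral_cong_AE)
      show "AE s in ?M. indicator {..x} s * (w s + w' s) (u s + u' s)
          = indicator {..x} s * w s (u s) + indicator {..x} s * (w s (u' s) + w' s (u s))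
            + indicator {..x} s * w' s (u' s)"
        using B.bochner_L2_AE_mem[OF u(1)] B.bochner_L2_AE_mem[OF u(2)]
          D.bochner_L2_AE_mem[OF w(1)] D.bochner_L2_AE_mem[OF w(2)]
        by eventually_elim (simp add: X.dual_add algebra_simps)
      have "integrable ?M (\<lambda>s. (w s + w' s) (u s + u' s))"
        using B.bochner_L2_integrable_apply(1)[OF B.bochner_L2_combine[OF u, of 1 1] D.bochner_L2_combine[OF w, of 1 1]]
        by simp
      from integrable_indicator_time[OF this, of "{..x}"]
      show "(\<lambda>s. indicator {..x} s * (w s + w' s) (u s + u' s)) \<in> borel_measurable ?M" by auto
      show "(\<lambda>s. indicator {..x} s * w s (u s) + indicator {..x} s * (w s (u' s) + w' s (u s))
            + indicator {..x} s * w' s (u' s)) \<in> borel_measurable ?M"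
        using int by (intro borel_measurable_integrable Bochner_Integration.integrable_add integrable_indicator_time) auto
    qed
    also have "\<dots> = prim T (\<lambda>s. w s (u s)) x + prim T (\<lambda>s. w s (u' s) + w' s (u s)) x + prim T (\<lambda>s. w' s (u' s)) x"
      unfolding prim_def using int
      by (simp add: integrable_indicator_time)
    finally show ?thesis .
  qed
  then show ?thesis
    using energy_identity[OF T ev2 x] energy_identity[OF T ev(1) x] energy_identity[OF T ev(2) x]
      H.square_add[OF cH(1,2)] H.square_add[OF cH(3,4)] by simp
qed

end

section \<open>The fractional Sobolev space and the energy form\<close>

text \<open>The square root of the integrand of the double integral, so that the integral becomes an
  \<open>L\<^sup>2\<close> norm of a function depending linearly on \<open>u\<close>.\<close>

definition gagliardo :: "real \<Rightarrow> 'a::euclidean_space set \<Rightarrow> ('a \<Rightarrow> real) \<Rightarrow> 'a \<times> 'a \<Rightarrow> real" where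
  "gagliardo s \<Omega> u = (\<lambda>(x, y). indicator (cross_region \<Omega>) (x, y) * (u x - u y) /
     sqrt (norm (x - y) powr (real DIM('a) + 2 * s)))"

lemma gagliardo_mult:
  fixes u :: "'a::euclidean_space \<Rightarrow> real"
  shows "gagliardo s \<Omega> u (x, y) * gagliardo s \<Omega> v (x, y) =
    indicator (cross_region \<Omega>) (x, y) *\<^sub>R ((u x - u y) * (v x - v y) / norm (x - y) powr (real DIM('a) + 2 * s))"
  by (simp add: gagliardo_def indicator_def)

lemma gagliardo_add: "gagliardo s \<Omega> (u + v) = gagliardo s \<Omega> u + gagliardo s \<Omega> v"
  by (auto simp: gagliardo_def fun_eq_iff indicator_def add_divide_distrib diff_divide_distrib)

lemma gagliardo_scale: "gagliardo s \<Omega> (c *\<^sub>R u) = c *\<^sub>R gagliardo s \<Omega> u"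
  by (auto simp: gagliardo_def fun_eq_iff indicator_def scaleR_fun_def algebra_simps diff_divide_distrib)

lemma gagliardo_zero: "gagliardo s \<Omega> 0 = 0"
  by (auto simp: gagliardo_def fun_eq_iff)

locale fractional_setting =
  fixes \<Omega> :: "'a::euclidean_space set" and \<kappa> :: "'a \<Rightarrow> real" and s T :: real
  assumes s: "0 < s" "s < 1" and T: "0 < T" and open_\<Omega>: "open \<Omega>"
    and \<kappa>_integrable: "integrable (lebesgue_on (- \<Omega>)) \<kappa>"
    and \<kappa>_nonneg: "AE x in lebesgue_on (- \<Omega>). 0 \<le> \<kappa> x"
begin

abbreviation "W \<equiv> W_space s \<Omega> \<kappa>"
abbreviation "\<mu> \<equiv> ext_measure \<Omega> \<kappa>"
abbreviation "LL \<equiv> (lebesgue \<Otimes>\<^sub>M lebesgue) :: ('a \<times> 'a) measure"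

definition ip_in :: "('a \<Rightarrow> real) \<Rightarrow> ('a \<Rightarrow> real) \<Rightarrow> real" where
  "ip_in u v = (LINT x|lebesgue_on \<Omega>. u x * v x)"

definition ip_ext :: "('a \<Rightarrow> real) \<Rightarrow> ('a \<Rightarrow> real) \<Rightarrow> real" where
  "ip_ext u v = (LINT x|\<mu>. u x * v x)"

definition ip_gagliardo :: "('a \<Rightarrow> real) \<Rightarrow> ('a \<Rightarrow> real) \<Rightarrow> real" where
  "ip_gagliardo u v = (LINT z|LL. gagliardo s \<Omega> u z * gagliardo s \<Omega> v z)"

sublocale In: semi_inner "L2 (lebesgue_on \<Omega>)" ip_in
  unfolding ip_in_def by (rule semi_inner_L2)

sublocale Ext: semi_inner "L2 \<mu>" ip_ext
  unfolding ip_ext_def by (rule semi_inner_L2)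

lemma finite_ext: "finite_measure \<mu>"
proof (rule finite_measureI)
  have "emeasure \<mu> (space \<mu>) = (\<integral>\<^sup>+x. ennreal (\<kappa> x) \<partial>lebesgue_on (- \<Omega>))"
    using \<kappa>_integrable unfolding ext_measure_def
    by (subst emeasure_density) (auto intro!: nn_integral_cong simp: indicator_def)
  also have "\<dots> \<noteq> \<infinity>" using \<kappa>_integrable \<kappa>_nonneg by (simp add: nn_integral_eq_integral)
  finally show "emeasure \<mu> (space \<mu>) \<noteq> \<infinity>" .
qed

lemma cross_region_measurable: "cross_region \<Omega> \<in> sets LL"
  using open_\<Omega> unfolding cross_region_def by (intro sets.Un pair_measureI) auto

lemma gagliardo_measurable:
  assumes "u \<in> borel_measurable lebesgue"
  shows "gagliardo s \<Omega> u \<in> borel_measurable LL"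
proof -
  note [measurable] = assms cross_region_measurable
  have [measurable]: "(\<lambda>x. x) \<in> (lebesgue :: 'a measure) \<rightarrow>\<^sub>M borel"
    by (intro measurable_completion) simp
  have [measurable]: "(\<lambda>z. fst z) \<in> LL \<rightarrow>\<^sub>M borel" by measurable
  have [measurable]: "(\<lambda>z. snd z) \<in> LL \<rightarrow>\<^sub>M borel" by measurable
  show ?thesis unfolding gagliardo_def case_prod_beta by measurable
qed

lemma W_mem_iff:
  "u \<in> elems W \<longleftrightarrow> u \<in> borel_measurable lebesgue \<and> u \<in> elems (L2 (lebesgue_on \<Omega>)) \<and>
     u \<in> elems (L2 \<mu>) \<and> gagliardo s \<Omega> u \<in> elems (L2 LL)"
proof -
  have "(\<lambda>z. (gagliardo s \<Omega> u z)\<^sup>2) = (\<lambda>z. indicator (cross_region \<Omega>) z *\<^sub>R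
      (case z of (x, y) \<Rightarrow> \<bar>u x - u y\<bar>\<^sup>2 / norm (x - y) powr (real DIM('a) + 2 * s)))"
    by (auto simp: fun_eq_iff power2_eq_square gagliardo_mult)
  then show ?thesis
    using gagliardo_measurable[of u] by (auto simp: W_space_def set_integrable_def L2_mem_iff)
qed

definition ip_W :: "('a \<Rightarrow> real) \<Rightarrow> ('a \<Rightarrow> real) \<Rightarrow> real" where
  "ip_W u v = ip_in u v + ip_ext u v + ip_gagliardo u v"

lemma set_integral_gagliardo:
  fixes u v :: "'a \<Rightarrow> real"
  shows "set_lebesgue_integral LL (cross_region \<Omega>)
    (\<lambda>(x, y). (u x - u y) * (v x - v y) / norm (x - y) powr (real DIM('a) + 2 * s)) = ip_gagliardo u v"
  unfolding set_lebesgue_integral_def ip_gagliardo_def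
  by (intro Bochner_Integration.integral_cong) (auto simp: gagliardo_mult)

sublocale W: semi_inner W ip_W
proof
  interpret G: semi_inner "L2 LL" "\<lambda>f g. LINT z|LL. f z * g z" by (rule semi_inner_L2)
  fix u v w :: "'a \<Rightarrow> real" and c :: real
  show "0 \<in> elems W"
    using In.zero_mem Ext.zero_mem G.zero_mem by (auto simp: W_mem_iff gagliardo_zero) (simp add: zero_fun_def)
  assume u: "u \<in> elems W"
  note u' = u[unfolded W_mem_iff]
  have cu: "c *\<^sub>R u \<in> borel_measurable lebesgue" using u' by (auto simp: scaleR_fun_def)
  show "c *\<^sub>R u \<in> elems W"
    using u' cu by (auto simp: W_mem_iff gagliardo_scale intro: In.scale_mem Ext.scale_mem G.scale_mem)
  show "0 \<le> ip_W u u"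
    using u' In.nonneg Ext.nonneg by (auto simp: ip_W_def ip_gagliardo_def)
  show "nrm W u = sqrt (ip_W u u)"
    using u' set_integral_gagliardo[of u u] In.nrm_square[of u] Ext.nrm_square[of u]
    by (simp add: W_space_def ip_W_def power2_eq_square abs_mult_self_eq)
  assume v: "v \<in> elems W"
  note v' = v[unfolded W_mem_iff]
  have "u + v \<in> borel_measurable lebesgue" using u' v' by (auto simp: plus_fun_def)
  then show "u + v \<in> elems W"
    using u' v' by (auto simp: W_mem_iff gagliardo_add intro: In.add_mem Ext.add_mem G.add_mem)
  show "ip_W u v = ip_W v u"
    by (simp add: ip_W_def ip_in_def ip_ext_def ip_gagliardo_def mult.commute)
  show "ip_W (c *\<^sub>R u) v = c * ip_W u v"
    using In.scale_left[of u v c] Ext.scale_left[of u v c] G.scale_left[of "gagliardo s \<Omega> u" "gagliardo s \<Omega> v" c] u' v'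
    by (simp add: ip_W_def ip_gagliardo_def gagliardo_scale algebra_simps)
  assume w: "w \<in> elems W"
  note w' = w[unfolded W_mem_iff]
  show "ip_W (u + v) w = ip_W u w + ip_W v w"
    using In.add_left[of u v w] Ext.add_left[of u v w]
      G.add_left[of "gagliardo s \<Omega> u" "gagliardo s \<Omega> v" "gagliardo s \<Omega> w"] u' v' w'
    by (simp add: ip_W_def ip_gagliardo_def gagliardo_add)
qed

lemma W_in: "u \<in> elems W \<Longrightarrow> u \<in> elems (L2 (lebesgue_on \<Omega>))"
  and W_ext: "u \<in> elems W \<Longrightarrow> u \<in> elems (L2 \<mu>)"
  by (auto simp: W_mem_iff)

lemma ip_gagliardo_nonneg: "0 \<le> ip_gagliardo u u"
  by (simp add: ip_gagliardo_def)

lemma nrm_in_le: "u \<in> elems W \<Longrightarrow> nrm (L2 (lebesgue_on \<Omega>)) u \<le> nrm W u"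
  using W_in[of u] W_ext[of u] Ext.nonneg[of u] ip_gagliardo_nonneg[of u]
  by (auto simp: In.nrm_eq W.nrm_eq ip_W_def)

lemma nrm_ext_le: "u \<in> elems W \<Longrightarrow> nrm (L2 \<mu>) u \<le> nrm W u"
  using W_in[of u] W_ext[of u] In.nonneg[of u] ip_gagliardo_nonneg[of u]
  by (auto simp: Ext.nrm_eq W.nrm_eq ip_W_def)

sublocale gelfand W "L2 (lebesgue_on \<Omega>)" ip_in
  by unfold_locales (use W_in in auto)

lemma frac_const_nonneg: "0 \<le> frac_const (real DIM('a)) s"
  unfolding frac_const_def using s by (intro divide_nonneg_nonneg mult_nonneg_nonneg) auto

lemma energy_form_eq:
  assumes u: "u \<in> elems W" and v: "v \<in> elems W"
  shows "energy_form s \<Omega> \<kappa> u v = frac_const (real DIM('a)) s / 2 * ip_gagliardo u v + ip_ext u v"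
proof -
  have [measurable]: "u \<in> borel_measurable (lebesgue_on (- \<Omega>))" "v \<in> borel_measurable (lebesgue_on (- \<Omega>))"
    using u v by (auto simp: W_mem_iff intro: measurable_restrict_space1)
  have "ip_ext u v = (LINT x|lebesgue_on (- \<Omega>). \<kappa> x * (u x * v x))"
    unfolding ip_ext_def ext_measure_def
    using \<kappa>_integrable \<kappa>_nonneg by (subst integral_real_density) auto
  then show ?thesis
    unfolding energy_form_def set_integral_gagliardo by (simp add: mult.assoc)
qed

lemma energy_sym: "u \<in> elems W \<Longrightarrow> v \<in> elems W \<Longrightarrow> energy_form s \<Omega> \<kappa> u v = energy_form s \<Omega> \<kappa> v u"
  by (simp add: energy_form_eq ip_gagliardo_def ip_ext_def mult.commute)

lemma energy_nonneg: "u \<in> elems W \<Longrightarrow> 0 \<le> energy_form s \<Omega> \<kappa> u u"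
  using frac_const_nonneg ip_gagliardo_nonneg[of u] Ext.nonneg[OF W_ext, of u] by (simp add: energy_form_eq)

lemma energy_combine:
  assumes u: "u \<in> elems W" "u' \<in> elems W" and v: "v \<in> elems W"
  shows "energy_form s \<Omega> \<kappa> (\<alpha> *\<^sub>R u + \<beta> *\<^sub>R u') v
    = \<alpha> * energy_form s \<Omega> \<kappa> u v + \<beta> * energy_form s \<Omega> \<kappa> u' v"
proof -
  interpret G: semi_inner "L2 LL" "\<lambda>f g. LINT z|LL. f z * g z" by (rule semi_inner_L2)
  have g: "gagliardo s \<Omega> u \<in> elems (L2 LL)" "gagliardo s \<Omega> u' \<in> elems (L2 LL)" "gagliardo s \<Omega> v \<in> elems (L2 LL)"
    using u v by (auto simp: W_mem_iff)
  have "ip_gagliardo (\<alpha> *\<^sub>R u + \<beta> *\<^sub>R u') v = \<alpha> * ip_gagliardo u v + \<beta> * ip_gagliardo u' v"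
    using g G.add_left[OF G.scale_mem[OF g(1)] G.scale_mem[OF g(2)] g(3), of \<alpha> \<beta>]
      G.scale_left[OF g(1,3), of \<alpha>] G.scale_left[OF g(2,3), of \<beta>]
    by (simp add: ip_gagliardo_def gagliardo_add gagliardo_scale)
  moreover have "ip_ext (\<alpha> *\<^sub>R u + \<beta> *\<^sub>R u') v = \<alpha> * ip_ext u v + \<beta> * ip_ext u' v"
    using W_ext[OF u(1)] W_ext[OF u(2)] W_ext[OF v]
    by (simp add: Ext.add_left Ext.scale_left Ext.scale_mem)
  moreover have "\<alpha> *\<^sub>R u + \<beta> *\<^sub>R u' \<in> elems W" using u by (intro W.add_mem W.scale_mem)
  ultimately show ?thesis using u v by (simp add: energy_form_eq algebra_simps)
qed

lemma ext_dual: "z \<in> elems (L2 \<mu>) \<Longrightarrow> ip_ext z \<in> elems (dual W)"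
  using W_ext nrm_ext_le by (intro Ext.form_in_dual_of_subspace[OF W.seminormed]) auto

lemma in_dual: "f \<in> elems (L2 (lebesgue_on \<Omega>)) \<Longrightarrow> ip_in f \<in> elems (dual W)"
  using W_in nrm_in_le by (intro In.form_in_dual_of_subspace[OF W.seminormed]) auto

lemma energy_dual:
  assumes u: "u \<in> elems W" shows "energy_form s \<Omega> \<kappa> u \<in> elems (dual W)"
proof -
  let ?C = "frac_const (real DIM('a)) s / 2"
  have C: "0 \<le> ?C" using frac_const_nonneg by simp
  have swap: "energy_form s \<Omega> \<kappa> u v = energy_form s \<Omega> \<kappa> v u" if "v \<in> elems W" for v
    by (rule energy_sym[OF u that])
  have bound: "\<bar>energy_form s \<Omega> \<kappa> u v\<bar> \<le> (?C + 1) * nrm W u * nrm W v" if v: "v \<in> elems W" for v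
  proof -
    interpret G: semi_inner "L2 LL" "\<lambda>f g. LINT z|LL. f z * g z" by (rule semi_inner_L2)
    have gle: "nrm (L2 LL) (gagliardo s \<Omega> w) \<le> nrm W w" if "w \<in> elems W" for w
    proof -
      have "0 \<le> ip_in w w" "0 \<le> ip_ext w w" using that by (auto intro: In.nonneg Ext.nonneg W_in W_ext)
      then show ?thesis
        using that by (simp add: L2_nrm W.nrm_eq ip_W_def ip_gagliardo_def power2_eq_square)
    qed
    have g: "gagliardo s \<Omega> u \<in> elems (L2 LL)" "gagliardo s \<Omega> v \<in> elems (L2 LL)"
      using u v by (auto simp: W_mem_iff)
    have "\<bar>ip_gagliardo u v\<bar> \<le> nrm (L2 LL) (gagliardo s \<Omega> u) * nrm (L2 LL) (gagliardo s \<Omega> v)"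
      unfolding ip_gagliardo_def by (rule G.cauchy_schwarz[OF g])
    also have "\<dots> \<le> nrm W u * nrm W v"
      using gle[OF u] gle[OF v] G.nrm_nonneg[OF g(2)] W.nrm_nonneg[OF u] by (intro mult_mono)
    finally have 1: "\<bar>ip_gagliardo u v\<bar> \<le> nrm W u * nrm W v" .
    have "\<bar>ip_ext u v\<bar> \<le> nrm (L2 \<mu>) u * nrm (L2 \<mu>) v"
      by (rule Ext.cauchy_schwarz[OF W_ext[OF u] W_ext[OF v]])
    also have "\<dots> \<le> nrm W u * nrm W v"
      using nrm_ext_le[OF u] nrm_ext_le[OF v] Ext.nrm_nonneg[OF W_ext[OF v]] W.nrm_nonneg[OF u]
      by (intro mult_mono)
    finally have 2: "\<bar>ip_ext u v\<bar> \<le> nrm W u * nrm W v" .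
    have "\<bar>energy_form s \<Omega> \<kappa> u v\<bar> \<le> \<bar>?C * ip_gagliardo u v\<bar> + \<bar>ip_ext u v\<bar>"
      unfolding energy_form_eq[OF u v] by (rule abs_triangle_ineq)
    also have "\<bar>?C * ip_gagliardo u v\<bar> \<le> ?C * (nrm W u * nrm W v)"
      unfolding abs_mult using 1 C by (simp add: mult_left_mono)
    finally show ?thesis using 2 by (simp add: algebra_simps)
  qed
  have add: "energy_form s \<Omega> \<kappa> u (v + w) = energy_form s \<Omega> \<kappa> u v + energy_form s \<Omega> \<kappa> u w"
    if "v \<in> elems W" "w \<in> elems W" for v w
    using energy_combine[OF that u, of 1 1] swap that W.add_mem[OF that] by simp
  have scale: "energy_form s \<Omega> \<kappa> u (c *\<^sub>R v) = c * energy_form s \<Omega> \<kappa> u v" if "v \<in> elems W" for v c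
    using energy_combine[OF that that u, of c 0] swap that W.scale_mem[OF that] by simp
  show ?thesis unfolding W.dual_mem_iff using add scale bound by blast
qed

section \<open>Weak solutions\<close>

text \<open>Evaluating the Bochner integrals in the definition of the distributional derivative at \<open>v\<close>
  reduces the claim to the scalar functions \<open>t \<mapsto> ip_in (u t) v\<close>.\<close>

lemma has_time_deriv_evolution:
  assumes d: "has_time_deriv T s \<Omega> \<kappa> u w" and u: "u \<in> elems (bochner_L2 (time_interval T) W)"
    and c: "\<And>t. t \<in> {0..T} \<Longrightarrow> c t \<in> elems (L2 (lebesgue_on \<Omega>))"
      "\<And>t. t \<in> {0..T} \<Longrightarrow> ((\<lambda>r. nrm (L2 (lebesgue_on \<Omega>)) (c r - c t)) \<longlongrightarrow> 0) (at t within {0..T})"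
    and uc: "AE t in time_interval T. same_in (L2 (lebesgue_on \<Omega>)) (u t) (c t)"
  shows "evolution T u c w"
proof -
  let ?M = "time_interval T"
  interpret B: bochner W ?M by (rule bochner_time)
  interpret D: bochner "dual W" ?M by (rule bochner_dual_time)
  have fu: "(\<lambda>t. ip_in (u t)) \<in> elems (bochner_L2 ?M (dual W))" and w: "w \<in> elems (bochner_L2 ?M (dual W))"
    and weak: "\<And>\<phi>. \<phi> \<in> test_functions T \<Longrightarrow> \<exists>I.
        bochner_integral_in ?M (dual W) (\<lambda>t. deriv \<phi> t *\<^sub>R ip_in (u t)) I \<and>
        bochner_integral_in ?M (dual W) (\<lambda>t. \<phi> t *\<^sub>R w t) (- I)"
    using d unfolding has_time_deriv_def H1_with_deriv_def ip_in_def[abs_def] by blast+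
  have "ip_in (c x) v = ip_in (c 0) v + prim T (\<lambda>t. w t v) x" if v: "v \<in> elems W" and x: "x \<in> {0..T}" for v x
  proof (rule weak_derivative_imp_primitive[where f = "\<lambda>t. ip_in (u t) v", OF T])
    have vI: "v \<in> elems (L2 (lebesgue_on \<Omega>))" by (rule W_in[OF v])
    show "continuous_on {0..T} (\<lambda>t. ip_in (c t) v)"
      unfolding continuous_on_def
    proof
      fix t assume t: "t \<in> {0..T}"
      show "((\<lambda>r. ip_in (c r) v) \<longlongrightarrow> ip_in (c t) v) (at t within {0..T})"
      proof (rule LIM_zero_cancel, rule Lim_null_comparison)
        have "((\<lambda>r. nrm (L2 (lebesgue_on \<Omega>)) (c r - c t) * nrm (L2 (lebesgue_on \<Omega>)) v)
            \<longlongrightarrow> 0 * nrm (L2 (lebesgue_on \<Omega>)) v) (at t within {0..T})"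
          by (intro tendsto_intros c(2) t)
        then show "((\<lambda>r. nrm (L2 (lebesgue_on \<Omega>)) (c r - c t) * nrm (L2 (lebesgue_on \<Omega>)) v)
            \<longlongrightarrow> 0) (at t within {0..T})" by simp
        have "norm (ip_in (c r) v - ip_in (c t) v) \<le> nrm (L2 (lebesgue_on \<Omega>)) (c r - c t) * nrm (L2 (lebesgue_on \<Omega>)) v"
          if "r \<in> {0..T}" for r
          using In.cauchy_schwarz[OF In.diff_mem[OF c(1)[OF that] c(1)[OF t]] vI]
            In.diff_left[OF c(1)[OF that] c(1)[OF t] vI] by simp
        then show "\<forall>\<^sub>F r in at t within {0..T}. norm (ip_in (c r) v - ip_in (c t) v)
            \<le> nrm (L2 (lebesgue_on \<Omega>)) (c r - c t) * nrm (L2 (lebesgue_on \<Omega>)) v"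
          by (auto simp: eventually_at_filter intro: always_eventually)
      qed
    qed
    show "integrable ?M (\<lambda>t. w t v)" by (rule dual_apply_integrable(1)[OF w v])
    show "(\<lambda>t. ip_in (u t) v) \<in> borel_measurable ?M" by (rule dual_apply_integrable(2)[OF fu v])
    show "AE t in ?M. ip_in (u t) v = ip_in (c t) v"
      using uc
    proof eventually_elim
      fix t assume "same_in (L2 (lebesgue_on \<Omega>)) (u t) (c t)"
      then have *: "u t \<in> elems (L2 (lebesgue_on \<Omega>))" "c t \<in> elems (L2 (lebesgue_on \<Omega>))"
        "nrm (L2 (lebesgue_on \<Omega>)) (u t - c t) = 0" by (auto simp: same_in_def)
      have "\<bar>ip_in (u t - c t) v\<bar> \<le> 0"
        using In.cauchy_schwarz[OF In.diff_mem[OF *(1,2)] vI] *(3) by simp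
      then show "ip_in (u t) v = ip_in (c t) v" using In.diff_left[OF *(1,2) vI] by simp
    qed
    fix \<phi> assume "\<phi> \<in> test_functions T"
    then obtain I where I: "bochner_integral_in ?M (dual W) (\<lambda>t. deriv \<phi> t *\<^sub>R ip_in (u t)) I"
      "bochner_integral_in ?M (dual W) (\<lambda>t. \<phi> t *\<^sub>R w t) (- I)" using weak by blast
    have lin: "linear (\<lambda>l. l v)" by (rule linearI) (auto simp: scaleR_fun_def)
    have bd: "\<bar>l v\<bar> \<le> nrm W v * nrm (dual W) l" if "l \<in> elems (dual W)" for l
      using W.dual_bound[OF that v] by (simp add: mult.commute)
    have "I v = (LINT t|?M. (deriv \<phi> t *\<^sub>R ip_in (u t)) v)"
      by (rule D.bochner_integral_apply[OF I(1) lin bd])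
    moreover have "(- I) v = (LINT t|?M. (\<phi> t *\<^sub>R w t) v)"
      by (rule D.bochner_integral_apply[OF I(2) lin bd])
    ultimately show "(LINT t|?M. deriv \<phi> t * ip_in (u t) v) = - (LINT t|?M. \<phi> t * w t v)"
      by (simp add: scaleR_fun_def)
  qed (use x in auto)
  then show ?thesis unfolding evolution_def using u w c uc by blast
qed

abbreviation Q where "Q \<equiv> Q_space T \<Omega>"
abbreviation Z where "Z \<equiv> Z_R T \<Omega> \<kappa>"

lemma bochner_in: "bochner (L2 (lebesgue_on \<Omega>)) (time_interval T)"
  using finite_measure_time complete_measure_time In.seminormed by (simp add: bochner_def)

lemma bochner_ext: "bochner (L2 \<mu>) (time_interval T)"
  using finite_measure_time complete_measure_time Ext.seminormed by (simp add: bochner_def)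

sublocale Q: semi_inner Q "pairing T (lebesgue_on \<Omega>)"
  using In.semi_inner_bochner_L2[OF bochner_in]
  by (simp add: Q_space_def pairing_def[abs_def] ip_in_def)

sublocale Z: semi_inner Z "pairing T \<mu>"
  using Ext.semi_inner_bochner_L2[OF bochner_ext]
  by (simp add: Z_R_def pairing_def[abs_def] ip_ext_def)

lemma complete_Z: "complete_in Z"
  unfolding Z_R_def
  by (rule bochner.complete_bochner_L2[OF bochner_ext finite_measure.complete_L2[OF finite_ext]])
    (use Z.seminormed in \<open>simp add: Z_R_def\<close>)

lemma W_valued_in_Q: "u \<in> elems (bochner_L2 (time_interval T) W) \<Longrightarrow> u \<in> elems Q"
  unfolding Q_space_def using W_in nrm_in_le by (intro bochner_L2_mono[OF bochner_time bochner_in]) auto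

lemma W_valued_in_Z: "u \<in> elems (bochner_L2 (time_interval T) W) \<Longrightarrow> u \<in> elems Z"
  unfolding Z_R_def using W_ext nrm_ext_le by (intro bochner_L2_mono[OF bochner_time bochner_ext]) auto

text \<open>The continuous representative \<open>c\<close> and the time derivative \<open>w\<close> are carried along, so that linear
  combinations of solutions are solutions together with those of \<open>c\<close> and \<open>w\<close>.\<close>

definition solves :: "(real \<Rightarrow> 'a \<Rightarrow> real) \<Rightarrow> (real \<Rightarrow> 'a \<Rightarrow> real) \<Rightarrow> (real \<Rightarrow> 'a \<Rightarrow> real) \<Rightarrow>
    (real \<Rightarrow> ('a \<Rightarrow> real) \<Rightarrow> real) \<Rightarrow> bool" where
  "solves z u c w \<longleftrightarrow> z \<in> elems Z \<and> evolution T u c w \<and> nrm (L2 (lebesgue_on \<Omega>)) (c 0) = 0 \<and>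
     (\<forall>v\<in>elems W. AE t in time_interval T. w t v + energy_form s \<Omega> \<kappa> (u t) v = ip_ext (z t) v)"

lemma state_solution_solves:
  assumes "z \<in> elems Z" "state_solution T s \<Omega> \<kappa> z u"
  obtains c w where "solves z u c w"
proof -
  obtain w where w: "has_time_deriv T s \<Omega> \<kappa> u w"
    and eq: "\<forall>v\<in>elems W. AE t in time_interval T. w t v + energy_form s \<Omega> \<kappa> (u t) v = ip_ext (z t) v"
    using assms(2) unfolding state_solution_def ip_ext_def by blast
  obtain c where c: "\<forall>t\<in>{0..T}. c t \<in> elems (L2 (lebesgue_on \<Omega>))"
      "\<forall>t\<in>{0..T}. ((\<lambda>r. nrm (L2 (lebesgue_on \<Omega>)) (c r - c t)) \<longlongrightarrow> 0) (at t within {0..T})"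
      "AE t in time_interval T. same_in (L2 (lebesgue_on \<Omega>)) (u t) (c t)"
      "same_in (L2 (lebesgue_on \<Omega>)) (c 0) 0"
    using assms(2) unfolding state_solution_def vanishes_at_def by blast
  have "u \<in> elems (bochner_L2 (time_interval T) W)" using assms(2) by (simp add: state_solution_def U_R_def)
  with w c have "evolution T u c w" by (intro has_time_deriv_evolution) auto
  with assms(1) eq c(4) show ?thesis by (intro that[of c w]) (auto simp: solves_def same_in_def)
qed

lemma solves_combine:
  assumes 1: "solves z u c w" and 2: "solves z' u' c' w'"
  shows "solves (\<lambda>t. \<alpha> *\<^sub>R z t + \<beta> *\<^sub>R z' t) (\<lambda>t. \<alpha> *\<^sub>R u t + \<beta> *\<^sub>R u' t)
    (\<lambda>t. \<alpha> *\<^sub>R c t + \<beta> *\<^sub>R c' t) (\<lambda>t. \<alpha> *\<^sub>R w t + \<beta> *\<^sub>R w' t)"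
  unfolding solves_def
proof (intro conjI ballI)
  interpret B: bochner W "time_interval T" by (rule bochner_time)
  interpret E: bochner "L2 \<mu>" "time_interval T" by (rule bochner_ext)
  have ev: "evolution T u c w" "evolution T u' c' w'" and z: "z \<in> elems Z" "z' \<in> elems Z"
    using 1 2 by (auto simp: solves_def)
  show "(\<lambda>t. \<alpha> *\<^sub>R z t + \<beta> *\<^sub>R z' t) \<in> elems Z"
    using z unfolding Z_R_def by (rule E.bochner_L2_combine)
  show "evolution T (\<lambda>t. \<alpha> *\<^sub>R u t + \<beta> *\<^sub>R u' t) (\<lambda>t. \<alpha> *\<^sub>R c t + \<beta> *\<^sub>R c' t) (\<lambda>t. \<alpha> *\<^sub>R w t + \<beta> *\<^sub>R w' t)"
    by (rule evolution_combine[OF ev])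
  have cH: "c 0 \<in> elems (L2 (lebesgue_on \<Omega>))" "c' 0 \<in> elems (L2 (lebesgue_on \<Omega>))"
    using evolutionD(3)[OF ev(1)] evolutionD(3)[OF ev(2)] T by auto
  have c0: "nrm (L2 (lebesgue_on \<Omega>)) (c 0) = 0" "nrm (L2 (lebesgue_on \<Omega>)) (c' 0) = 0"
    using 1 2 by (auto simp: solves_def)
  show "nrm (L2 (lebesgue_on \<Omega>)) (\<alpha> *\<^sub>R c 0 + \<beta> *\<^sub>R c' 0) = 0"
    using In.nrm_add[OF In.scale_mem[OF cH(1)] In.scale_mem[OF cH(2)], of \<alpha> \<beta>] c0
      In.nrm_nonneg[OF In.add_mem[OF In.scale_mem[OF cH(1)] In.scale_mem[OF cH(2)]], of \<alpha> \<beta>]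
    by (simp add: In.nrm_scale cH)
  fix v assume v: "v \<in> elems W"
  have "AE t in time_interval T. w t v + energy_form s \<Omega> \<kappa> (u t) v = ip_ext (z t) v"
    "AE t in time_interval T. w' t v + energy_form s \<Omega> \<kappa> (u' t) v = ip_ext (z' t) v"
    using 1 2 v by (auto simp: solves_def)
  moreover have "AE t in time_interval T. z t \<in> elems (L2 \<mu>)" "AE t in time_interval T. z' t \<in> elems (L2 \<mu>)"
    using z unfolding Z_R_def by (auto intro: E.bochner_L2_AE_mem)
  moreover have "AE t in time_interval T. u t \<in> elems W" "AE t in time_interval T. u' t \<in> elems W"
    using evolutionD(1)[OF ev(1)] evolutionD(1)[OF ev(2)] by (auto intro: B.bochner_L2_AE_mem)
  ultimately show "AE t in time_interval T. (\<alpha> *\<^sub>R w t + \<beta> *\<^sub>R w' t) v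
      + energy_form s \<Omega> \<kappa> (\<alpha> *\<^sub>R u t + \<beta> *\<^sub>R u' t) v = ip_ext (\<alpha> *\<^sub>R z t + \<beta> *\<^sub>R z' t) v"
  proof eventually_elim
    fix t assume t: "w t v + energy_form s \<Omega> \<kappa> (u t) v = ip_ext (z t) v"
      "w' t v + energy_form s \<Omega> \<kappa> (u' t) v = ip_ext (z' t) v"
      "z t \<in> elems (L2 \<mu>)" "z' t \<in> elems (L2 \<mu>)" "u t \<in> elems W" "u' t \<in> elems W"
    have "ip_ext (\<alpha> *\<^sub>R z t + \<beta> *\<^sub>R z' t) v = \<alpha> * ip_ext (z t) v + \<beta> * ip_ext (z' t) v"
      using t W_ext[OF v] by (simp add: Ext.add_left Ext.scale_left Ext.scale_mem)
    also have "\<dots> = \<alpha> * (w t v + energy_form s \<Omega> \<kappa> (u t) v) + \<beta> * (w' t v + energy_form s \<Omega> \<kappa> (u' t) v)"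
      using t by simp
    finally show "(\<alpha> *\<^sub>R w t + \<beta> *\<^sub>R w' t) v
      + energy_form s \<Omega> \<kappa> (\<alpha> *\<^sub>R u t + \<beta> *\<^sub>R u' t) v = ip_ext (\<alpha> *\<^sub>R z t + \<beta> *\<^sub>R z' t) v"
      unfolding energy_combine[OF t(5,6) v] by (simp add: scaleR_fun_def algebra_simps)
  qed
qed


lemma solves_tested:
  assumes sol: "solves z u c w" and p: "p \<in> elems (bochner_L2 (time_interval T) W)"
  shows "AE t in time_interval T. w t (p t) + energy_form s \<Omega> \<kappa> (u t) (p t) = ip_ext (z t) (p t)"
proof -
  let ?M = "time_interval T"
  interpret B: bochner W ?M by (rule bochner_time)
  interpret D: bochner "dual W" ?M by (rule bochner_dual_time)
  interpret E: bochner "L2 \<mu>" ?M by (rule bochner_ext)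
  have ev: "evolution T u c w" and z: "z \<in> elems Z" using sol by (auto simp: solves_def)
  have "AE t in ?M. (w t + energy_form s \<Omega> \<kappa> (u t) - ip_ext (z t)) (p t) = 0"
  proof (rule B.AE_apply_zero[where L = "\<lambda>t. w t + energy_form s \<Omega> \<kappa> (u t) - ip_ext (z t)" and p = p])
    have "AE t in ?M. w t \<in> elems (dual W)" "AE t in ?M. u t \<in> elems W" "AE t in ?M. z t \<in> elems (L2 \<mu>)"
      using evolutionD(1,2)[OF ev] z unfolding Z_R_def
      by (auto intro: B.bochner_L2_AE_mem D.bochner_L2_AE_mem E.bochner_L2_AE_mem)
    then show "AE t in ?M. w t + energy_form s \<Omega> \<kappa> (u t) - ip_ext (z t) \<in> elems (dual W)"
    proof eventually_elim
      fix t assume t: "w t \<in> elems (dual W)" "u t \<in> elems W" "z t \<in> elems (L2 \<mu>)"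
      show "w t + energy_form s \<Omega> \<kappa> (u t) - ip_ext (z t) \<in> elems (dual W)"
        by (rule D.diff_mem[OF D.add_mem[OF t(1) energy_dual[OF t(2)]] ext_dual[OF t(3)]])
    qed
    show "AE t in ?M. (w t + energy_form s \<Omega> \<kappa> (u t) - ip_ext (z t)) v = 0" if "v \<in> elems W" for v
      using sol that by (auto simp: solves_def)
    show "strongly_measurable ?M W p" using p by (simp add: B.bochner_L2_mem_iff)
  qed
  then show ?thesis by simp
qed

text \<open>Testing with the solution itself: its \<open>L\<^sup>2\<close> norm cannot increase when there is no control.\<close>

lemma solves_zero_unique:
  assumes sol: "solves (\<lambda>_. 0) u c w"
  shows "nrm Q u = 0"
proof -
  let ?M = "time_interval T"
  interpret B: bochner W ?M by (rule bochner_time)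
  interpret I: bochner "L2 (lebesgue_on \<Omega>)" ?M by (rule bochner_in)
  have ev: "evolution T u c w" using sol by (simp add: solves_def)
  have uB: "u \<in> elems (bochner_L2 ?M W)" by (rule evolutionD(1)[OF ev])
  have "AE t in ?M. w t (u t) \<le> 0"
    using solves_tested[OF sol uB] B.bochner_L2_AE_mem[OF uB]
  proof eventually_elim
    fix t assume t: "w t (u t) + energy_form s \<Omega> \<kappa> (u t) (u t) = ip_ext 0 (u t)" "u t \<in> elems W"
    have "ip_ext 0 (u t) = 0" by (simp add: ip_ext_def)
    then show "w t (u t) \<le> 0" using t energy_nonneg[OF t(2)] by simp
  qed
  then have neg: "prim T (\<lambda>t. w t (u t)) x \<le> 0" for x
  proof -
    have "AE t in ?M. 0 \<le> - (indicator {..x} t * w t (u t))"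
      using \<open>AE t in ?M. w t (u t) \<le> 0\<close> by eventually_elim (auto simp: indicator_def)
    from integral_nonneg_AE[OF this] show ?thesis by (simp add: prim_def)
  qed
  have c0: "ip_in (c 0) (c 0) = 0"
    using sol evolutionD(3)[OF ev, of 0] T In.nrm_square[of "c 0"] by (simp add: solves_def)
  have c: "nrm (L2 (lebesgue_on \<Omega>)) (c t) = 0" if t: "t \<in> {0..T}" for t
  proof -
    have "ip_in (c t) (c t) \<le> 0"
      using energy_identity[OF _ ev, of t] t T c0 neg[of t] by simp
    then show ?thesis
      using In.nonneg[OF evolutionD(3)[OF ev t]] In.nrm_eq[OF evolutionD(3)[OF ev t]] by simp
  qed
  have "AE t in ?M. (nrm (L2 (lebesgue_on \<Omega>)) (u t))\<^sup>2 = 0"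
    using evolutionD(5)[OF ev] AE_space
  proof eventually_elim
    fix t assume t: "same_in (L2 (lebesgue_on \<Omega>)) (u t) (c t)" "t \<in> space ?M"
    then have tT: "t \<in> {0..T}" by auto
    have "nrm (L2 (lebesgue_on \<Omega>)) (u t) \<le> 0"
      using In.nrm_add[OF In.diff_mem evolutionD(3)[OF ev tT], of "u t" "c t"] t(1) c[OF tT]
      by (simp add: same_in_def)
    then show "(nrm (L2 (lebesgue_on \<Omega>)) (u t))\<^sup>2 = 0"
      using In.nrm_nonneg[of "u t"] t(1) by (simp add: same_in_def)
  qed
  then have "(LINT t|?M. (nrm (L2 (lebesgue_on \<Omega>)) (u t))\<^sup>2) = 0" by (rule integral_eq_zero_AE)
  then show ?thesis by (simp add: Q_space_def I.bochner_L2_nrm)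
qed

text \<open>Testing the state equation with the adjoint state and the adjoint equation with the state, the
  energy forms cancel by symmetry, and the time derivatives cancel after integration by parts since
  one function vanishes initially and the other finally.\<close>

lemma state_adjoint_duality:
  assumes sol: "solves z u c w" and adj: "adjoint_solution T s \<Omega> \<kappa> f p" and f: "f \<in> elems Q"
  shows "pairing T (lebesgue_on \<Omega>) f u = pairing T \<mu> p z"
proof -
  let ?M = "time_interval T"
  interpret B: bochner W ?M by (rule bochner_time)
  interpret D: bochner "dual W" ?M by (rule bochner_dual_time)
  interpret I: bochner "L2 (lebesgue_on \<Omega>)" ?M by (rule bochner_in)
  have ev: "evolution T u c w" and z: "z \<in> elems Z" using sol by (auto simp: solves_def)
  obtain w' where w': "has_time_deriv T s \<Omega> \<kappa> p w'"
    and eq: "\<And>v. v \<in> elems W \<Longrightarrow> AE t in ?M. - w' t v + energy_form s \<Omega> \<kappa> (p t) v = ip_in (f t) v"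
    using adj unfolding adjoint_solution_def ip_in_def by blast
  obtain c' where c': "\<forall>t\<in>{0..T}. c' t \<in> elems (L2 (lebesgue_on \<Omega>))"
      "\<forall>t\<in>{0..T}. ((\<lambda>r. nrm (L2 (lebesgue_on \<Omega>)) (c' r - c' t)) \<longlongrightarrow> 0) (at t within {0..T})"
      "AE t in time_interval T. same_in (L2 (lebesgue_on \<Omega>)) (p t) (c' t)"
      "same_in (L2 (lebesgue_on \<Omega>)) (c' T) 0"
    using adj unfolding adjoint_solution_def vanishes_at_def by blast
  have p: "p \<in> elems (bochner_L2 ?M W)" using adj by (simp add: adjoint_solution_def U_R_def)
  have ev': "evolution T p c' w'" using w' p c' by (intro has_time_deriv_evolution) auto
  have u: "u \<in> elems (bochner_L2 ?M W)" by (rule evolutionD(1)[OF ev])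
  have AEs: "AE t in ?M. w' t \<in> elems (dual W)" "AE t in ?M. u t \<in> elems W" "AE t in ?M. p t \<in> elems W"
    "AE t in ?M. f t \<in> elems (L2 (lebesgue_on \<Omega>))"
    using B.bochner_L2_AE_mem[OF u] B.bochner_L2_AE_mem[OF p] D.bochner_L2_AE_mem[OF evolutionD(2)[OF ev']]
      I.bochner_L2_AE_mem f unfolding Q_space_def by auto
  have "AE t in ?M. (energy_form s \<Omega> \<kappa> (p t) - w' t - ip_in (f t)) (u t) = 0"
  proof (rule B.AE_apply_zero[where L = "\<lambda>t. energy_form s \<Omega> \<kappa> (p t) - w' t - ip_in (f t)" and p = u])
    show "AE t in ?M. energy_form s \<Omega> \<kappa> (p t) - w' t - ip_in (f t) \<in> elems (dual W)"
      using AEs(1,3,4)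
    proof eventually_elim
      fix t assume t: "w' t \<in> elems (dual W)" "p t \<in> elems W" "f t \<in> elems (L2 (lebesgue_on \<Omega>))"
      show "energy_form s \<Omega> \<kappa> (p t) - w' t - ip_in (f t) \<in> elems (dual W)"
        by (rule D.diff_mem[OF D.diff_mem[OF energy_dual[OF t(2)] t(1)] in_dual[OF t(3)]])
    qed
    show "AE t in ?M. (energy_form s \<Omega> \<kappa> (p t) - w' t - ip_in (f t)) v = 0" if "v \<in> elems W" for v
      using eq[OF that] by eventually_elim simp
    show "strongly_measurable ?M W u" using u by (simp add: B.bochner_L2_mem_iff)
  qed
  with solves_tested[OF sol p] AEs(2,3)
  have AE: "AE t in ?M. w t (p t) + w' t (u t) = ip_ext (z t) (p t) - ip_in (f t) (u t)"
  proof eventually_elim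
    fix t assume t: "w t (p t) + energy_form s \<Omega> \<kappa> (u t) (p t) = ip_ext (z t) (p t)"
      "u t \<in> elems W" "p t \<in> elems W" "(energy_form s \<Omega> \<kappa> (p t) - w' t - ip_in (f t)) (u t) = 0"
    then show "w t (p t) + w' t (u t) = ip_ext (z t) (p t) - ip_in (f t) (u t)"
      using energy_sym[OF t(2,3)] by simp
  qed
  have vanish: "ip_in x y = 0"
    if "x \<in> elems (L2 (lebesgue_on \<Omega>))" "y \<in> elems (L2 (lebesgue_on \<Omega>))"
      "nrm (L2 (lebesgue_on \<Omega>)) x = 0 \<or> nrm (L2 (lebesgue_on \<Omega>)) y = 0" for x y
    using In.cauchy_schwarz[OF that(1,2)] that(3) by auto
  have mem: "c t \<in> elems (L2 (lebesgue_on \<Omega>))" "c' t \<in> elems (L2 (lebesgue_on \<Omega>))" if "t \<in> {0..T}" for t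
    using evolutionD(3)[OF ev that] evolutionD(3)[OF ev' that] by auto
  have "ip_in (c T) (c' T) = 0" "ip_in (c 0) (c' 0) = 0"
    using mem[of 0] mem[of T] T sol c'(4) by (auto intro!: vanish simp: solves_def same_in_def)
  then have zero: "prim T (\<lambda>t. w t (p t) + w' t (u t)) T = 0"
    using integration_by_parts[OF _ ev ev', of T] T by simp
  have int1: "integrable ?M (\<lambda>t. ip_ext (z t) (p t))"
    using z W_valued_in_Z[OF p] unfolding Z_R_def by (intro Ext.bochner_L2_form_integrable[OF bochner_ext])
  have int2: "integrable ?M (\<lambda>t. ip_in (f t) (u t))"
    using f W_valued_in_Q[OF u] unfolding Q_space_def by (intro In.bochner_L2_form_integrable[OF bochner_in])
  have "0 = (LINT t|?M. w t (p t) + w' t (u t))" using zero by (simp add: prim_right)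
  also have "\<dots> = (LINT t|?M. ip_ext (z t) (p t) - ip_in (f t) (u t))"
  proof (rule integral_cong_AE[OF _ _ AE])
    show "(\<lambda>t. w t (p t) + w' t (u t)) \<in> borel_measurable ?M"
      using B.bochner_L2_integrable_apply(1)[OF p evolutionD(2)[OF ev]]
        B.bochner_L2_integrable_apply(1)[OF u evolutionD(2)[OF ev']] by auto
  qed (use int1 int2 in auto)
  also have "\<dots> = pairing T \<mu> z p - pairing T (lebesgue_on \<Omega>) f u"
    using int1 int2 by (simp add: pairing_def ip_ext_def ip_in_def)
  finally show ?thesis using Z.sym[OF z W_valued_in_Z[OF p]] by simp
qed

end

section \<open>First order conditions\<close>

text \<open>Differentiable functionals do not distinguish functions that represent the same element.\<close>

lemma frechet_deriv_null:
  assumes "frechet_deriv_at X J l u" and "h \<in> elems X" "nrm X h = 0"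
  shows "J (u + h) = J u"
proof -
  have l: "l \<in> elems (dual X)"
    and F: "\<And>e. e > 0 \<Longrightarrow> \<exists>d>0. \<forall>h\<in>elems X. nrm X h < d \<longrightarrow> \<bar>J (u + h) - J u - l h\<bar> \<le> e * nrm X h"
    using assms(1) by (auto simp: frechet_deriv_at_def)
  obtain C where "\<bar>l h\<bar> \<le> C * nrm X h" using l assms(2) by (auto simp: dual_def)
  then have "l h = 0" using assms(3) by simp
  then show ?thesis using F[of 1] assms(2,3) by auto
qed

lemma (in seminormed) frechet_directional_derivative:
  assumes F: "frechet_deriv_at X J l u" and k: "k \<in> elems X"
  shows "((\<lambda>r. (J (u + r *\<^sub>R k) - J u) / r) \<longlongrightarrow> l k) (at_right 0)"
proof (rule tendstoI)
  fix e :: real assume e: "0 < e"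
  have l: "l \<in> elems (dual X)" using F by (simp add: frechet_deriv_at_def)
  \<comment> \<open>The summand 1 covers directions of seminorm 0.\<close>
  define n where "n = nrm X k + 1"
  have n: "0 < n" "nrm X k < n" using nrm_nonneg[OF k] by (auto simp: n_def)
  have "0 < e / n" using e n by simp
  then obtain d where d: "0 < d"
    "\<And>h. h \<in> elems X \<Longrightarrow> nrm X h < d \<Longrightarrow> \<bar>J (u + h) - J u - l h\<bar> \<le> e / n * nrm X h"
    using F unfolding frechet_deriv_at_def by blast
  have "\<forall>\<^sub>F r in at_right 0. 0 < r \<and> r < d / n"
    using n d by (auto intro: eventually_conj eventually_at_right_less eventually_at_rightI[of 0 "d / n"])
  then show "\<forall>\<^sub>F r in at_right 0. dist ((J (u + r *\<^sub>R k) - J u) / r) (l k) < e"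
  proof eventually_elim
    fix r assume r: "0 < r \<and> r < d / n"
    have rk: "nrm X (r *\<^sub>R k) = r * nrm X k" using nrm_scale[OF k, of r] r by simp
    have "r * nrm X k \<le> r * n" using r n by (intro mult_left_mono) auto
    also have "\<dots> < d" using r n by (simp add: field_simps)
    finally have "\<bar>J (u + r *\<^sub>R k) - J u - l (r *\<^sub>R k)\<bar> \<le> e / n * nrm X (r *\<^sub>R k)"
      using rk by (intro d(2) scale_mem k) simp
    then have "\<bar>J (u + r *\<^sub>R k) - J u - r * l k\<bar> \<le> r * (e / n * nrm X k)"
      unfolding rk dual_scale[OF l k] by (simp add: algebra_simps)
    moreover have "(J (u + r *\<^sub>R k) - J u) / r - l k = (J (u + r *\<^sub>R k) - J u - r * l k) / r"
      using r by (simp add: field_simps)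
    ultimately have "\<bar>(J (u + r *\<^sub>R k) - J u) / r - l k\<bar> \<le> e / n * nrm X k"
      using r by (simp add: abs_divide field_simps)
    also have "\<dots> < e" using n e by (simp add: field_simps)
    finally show "dist ((J (u + r *\<^sub>R k) - J u) / r) (l k) < e" by (simp add: dist_real_def)
  qed
qed

lemma (in seminormed) convex_above_tangent:
  assumes F: "frechet_deriv_at X J l u" and u: "u \<in> elems X" and k: "k \<in> elems X"
    and convex: "convex_on (elems X) J"
  shows "l k \<le> J (u + k) - J u"
proof (rule tendsto_upperbound[OF frechet_directional_derivative[OF F k]])
  have "\<forall>\<^sub>F r in at_right (0::real). 0 < r \<and> r < 1"
    by (auto intro: eventually_conj eventually_at_right_less eventually_at_rightI[of 0 1])
  then show "\<forall>\<^sub>F r in at_right 0. (J (u + r *\<^sub>R k) - J u) / r \<le> J (u + k) - J u"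
  proof eventually_elim
    fix r :: real assume r: "0 < r \<and> r < 1"
    have "J ((1 - r) *\<^sub>R u + r *\<^sub>R (u + k)) \<le> (1 - r) * J u + r * J (u + k)"
      using convex r u add_mem[OF u k] by (intro convex_onD) auto
    moreover have "(1 - r) *\<^sub>R u + r *\<^sub>R (u + k) = u + r *\<^sub>R k" by (simp add: algebra_simps)
    ultimately have "J (u + r *\<^sub>R k) - J u \<le> r * (J (u + k) - J u)" by (simp add: algebra_simps)
    then show "(J (u + r *\<^sub>R k) - J u) / r \<le> J (u + k) - J u" using r by (simp add: field_simps)
  qed
qed simp

context fractional_setting
begin

lemma solution_in_Q:
  assumes "z \<in> elems Z" "state_solution T s \<Omega> \<kappa> z u" shows "u \<in> elems Q"
  using assms(2) by (intro W_valued_in_Q) (simp add: state_solution_def U_R_def)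

text \<open>The difference solves the state equation with control 0.\<close>

lemma solution_along_segment:
  assumes z: "z \<in> elems Z" "z' \<in> elems Z" and u: "state_solution T s \<Omega> \<kappa> z u"
    and u': "state_solution T s \<Omega> \<kappa> z' u'"
    and ur: "state_solution T s \<Omega> \<kappa> (z + r *\<^sub>R (z' - z)) ur"
  shows "nrm Q (ur - (u + r *\<^sub>R (u' - u))) = 0"
proof -
  obtain c w where 1: "solves z u c w" using state_solution_solves[OF z(1) u] .
  obtain c' w' where 2: "solves z' u' c' w'" using state_solution_solves[OF z(2) u'] .
  have "z + r *\<^sub>R (z' - z) \<in> elems Z" using z by (intro Z.add_mem Z.scale_mem Z.diff_mem)
  then obtain cr wr where 3: "solves (z + r *\<^sub>R (z' - z)) ur cr wr"
    using state_solution_solves[OF _ ur] by blast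
  have zero: "1 *\<^sub>R (z + r *\<^sub>R (z' - z)) t + (-1) *\<^sub>R ((1 - r) *\<^sub>R z t + r *\<^sub>R z' t) = 0" for t
    by (simp add: scaleR_fun_def algebra_simps fun_eq_iff)
  have "1 *\<^sub>R ur t + (-1) *\<^sub>R ((1 - r) *\<^sub>R u t + r *\<^sub>R u' t) = (ur - (u + r *\<^sub>R (u' - u))) t" for t
    by (simp add: scaleR_fun_def algebra_simps fun_eq_iff)
  then have "(\<lambda>t. 1 *\<^sub>R ur t + (-1) *\<^sub>R ((1 - r) *\<^sub>R u t + r *\<^sub>R u' t)) = ur - (u + r *\<^sub>R (u' - u))" by auto
  with solves_zero_unique[OF solves_combine[OF 3 solves_combine[OF 1 2, of "1 - r" r], of 1 "-1", unfolded zero]]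
  show ?thesis by simp
qed

lemma duality_difference:
  assumes z: "z \<in> elems Z" "z' \<in> elems Z" and u: "state_solution T s \<Omega> \<kappa> z u"
    and u': "state_solution T s \<Omega> \<kappa> z' u'"
    and adj: "adjoint_solution T s \<Omega> \<kappa> f p" and f: "f \<in> elems Q"
  shows "pairing T (lebesgue_on \<Omega>) f (u' - u) = pairing T \<mu> p (z' - z)"
proof -
  obtain c w where 1: "solves z u c w" using state_solution_solves[OF z(1) u] .
  obtain c' w' where 2: "solves z' u' c' w'" using state_solution_solves[OF z(2) u'] .
  have p: "p \<in> elems Z" using adj by (intro W_valued_in_Z) (simp add: adjoint_solution_def U_R_def)
  show ?thesis
    using state_adjoint_duality[OF 1 adj f] state_adjoint_duality[OF 2 adj f]
      Q.diff_right[OF solution_in_Q[OF z(2) u'] solution_in_Q[OF z(1) u] f]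
      Z.diff_right[OF z(2,1) p] by simp
qed

end

theorem theorem4p6:
  fixes \<Omega> :: "'a::euclidean_space set"
    and \<kappa> :: "'a \<Rightarrow> real"
    and s T \<xi> :: real
    and Zad Zo :: "(real \<Rightarrow> 'a \<Rightarrow> real) set"
    and S :: "(real \<Rightarrow> 'a \<Rightarrow> real) \<Rightarrow> (real \<Rightarrow> 'a \<Rightarrow> real)"
    and J :: "(real \<Rightarrow> 'a \<Rightarrow> real) \<Rightarrow> real"
    and J' :: "(real \<Rightarrow> 'a \<Rightarrow> real) \<Rightarrow> (real \<Rightarrow> 'a \<Rightarrow> real)"
    and zbar pbar :: "real \<Rightarrow> 'a \<Rightarrow> real"
  assumes s: "0 < s" "s < 1" and T: "0 < T" and \<xi>: "0 < \<xi>"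
    and \<Omega>: "lipschitz_domain \<Omega>"
    and \<kappa>_L1: "integrable (lebesgue_on (- \<Omega>)) \<kappa>"
    and \<kappa>_Linf: "\<exists>C. AE x in lebesgue_on (- \<Omega>). \<bar>\<kappa> x\<bar> \<le> C"
    and \<kappa>_nonneg: "AE x in lebesgue_on (- \<Omega>). 0 \<le> \<kappa> x"
    and Zad: "closed_in (Z_R T \<Omega> \<kappa>) Zad" "convex Zad"
    and Zo: "open_in (Z_R T \<Omega> \<kappa>) Zo" "Zad \<subseteq> Zo"
    and S: "\<And>z. z \<in> elems (Z_R T \<Omega> \<kappa>) \<Longrightarrow> state_solution T s \<Omega> \<kappa> z (S z)"
    and J_lsc: "weakly_lsc (Q_space T \<Omega>) J"
    and J_C1: "continuously_frechet (Q_space T \<Omega>) J (\<lambda>u h. pairing T (lebesgue_on \<Omega>) (J' u) h)"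
    and J'_L2: "\<And>u. u \<in> elems (Q_space T \<Omega>) \<Longrightarrow> J' u \<in> elems (Q_space T \<Omega>)"
    and zbar: "zbar \<in> Zad"
    and pbar: "adjoint_solution T s \<Omega> \<kappa> (J' (S zbar)) pbar"
  shows "(is_minimizer Zad (reduced_cost T \<Omega> \<kappa> \<xi> J S) zbar \<longrightarrow>
      optimality_condition T \<Omega> \<kappa> \<xi> Zad pbar zbar) \<and>
    (optimality_condition T \<Omega> \<kappa> \<xi> Zad pbar zbar \<longleftrightarrow>
      same_in (Z_R T \<Omega> \<kappa>) zbar (proj_onto (Z_R T \<Omega> \<kappa>) Zad ((- inverse \<xi>) *\<^sub>R pbar))) \<and>
    (convex_on (elems (Q_space T \<Omega>)) J \<longrightarrow> optimality_condition T \<Omega> \<kappa> \<xi> Zad pbar zbar \<longrightarrow>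
      is_minimizer Zad (reduced_cost T \<Omega> \<kappa> \<xi> J S) zbar)"
proof -
  interpret fractional_setting \<Omega> \<kappa> s T
    using s T \<Omega> \<kappa>_L1 \<kappa>_nonneg by unfold_locales (auto simp: lipschitz_domain_def)
  let ?b = "pairing T \<mu>" and ?l = "pairing T (lebesgue_on \<Omega>) (J' (S zbar))"
  have ZadZ: "Zad \<subseteq> elems Z" using Zad(1) by (simp add: closed_in_def)
  have zb: "zbar \<in> elems Z" using zbar ZadZ by auto
  have SQ: "S z \<in> elems Q" if "z \<in> elems Z" for z by (rule solution_in_Q[OF that S[OF that]])
  have p: "pbar \<in> elems Z" using pbar by (intro W_valued_in_Z) (simp add: adjoint_solution_def U_R_def)
  have F: "frechet_deriv_at Q J (\<lambda>h. pairing T (lebesgue_on \<Omega>) (J' u) h) u" if "u \<in> elems Q" for u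
    using J_C1 that by (simp add: continuously_frechet_def)
  have l: "?l (S z - S zbar) = ?b pbar (z - zbar)" if "z \<in> elems Z" for z
    by (rule duality_difference[OF zb that S[OF zb] S[OF that] pbar J'_L2[OF SQ[OF zb]]])
  have split: "?b (pbar + \<xi> *\<^sub>R zbar) (z - zbar) = ?l (S z - S zbar) + \<xi> * ?b zbar (z - zbar)"
    if "z \<in> elems Z" for z
    using l[OF that] Z.diff_mem[OF that zb]
    by (simp add: Z.add_left Z.scale_left Z.scale_mem p zb)

  have necessary: "optimality_condition T \<Omega> \<kappa> \<xi> Zad pbar zbar"
    if min: "is_minimizer Zad (reduced_cost T \<Omega> \<kappa> \<xi> J S) zbar"
    unfolding optimality_condition_def
  proof
    fix z assume z: "z \<in> Zad"
    then have zZ: "z \<in> elems Z" using ZadZ by auto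
    define h where "h = z - zbar"
    define k where "k = S z - S zbar"
    have h: "h \<in> elems Z" unfolding h_def by (rule Z.diff_mem[OF zZ zb])
    have k: "k \<in> elems Q" unfolding k_def by (rule Q.diff_mem[OF SQ[OF zZ] SQ[OF zb]])
    have lim: "((\<lambda>r. (J (S zbar + r *\<^sub>R k) - J (S zbar)) / r + \<xi> * ?b zbar h + \<xi> / 2 * r * ?b h h)
        \<longlongrightarrow> ?l k + \<xi> * ?b zbar h + \<xi> / 2 * 0 * ?b h h) (at_right 0)"
      by (intro tendsto_intros Q.frechet_directional_derivative[OF F[OF SQ[OF zb]] k])
    have "\<forall>\<^sub>F r in at_right (0::real). 0 < r \<and> r < 1"
      by (auto intro: eventually_conj eventually_at_right_less eventually_at_rightI[of 0 1])
    then have "\<forall>\<^sub>F r in at_right 0.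
        0 \<le> (J (S zbar + r *\<^sub>R k) - J (S zbar)) / r + \<xi> * ?b zbar h + \<xi> / 2 * r * ?b h h"
    proof eventually_elim
      fix r :: real assume r: "0 < r \<and> r < 1"
      define zr where "zr = zbar + r *\<^sub>R h"
      have zr: "zr \<in> Zad"
        using convexD_alt[OF Zad(2) zbar z, of r] r by (simp add: zr_def h_def algebra_simps)
      then have zrZ: "zr \<in> elems Z" using ZadZ by auto
      define q where "q = S zbar + r *\<^sub>R k"
      have q: "q \<in> elems Q" unfolding q_def by (intro Q.add_mem Q.scale_mem SQ zb k)
      have zr_eq: "zbar + r *\<^sub>R (z - zbar) = zr" by (simp only: zr_def h_def)
      have "state_solution T s \<Omega> \<kappa> (zbar + r *\<^sub>R (z - zbar)) (S zr)"
        unfolding zr_eq by (rule S[OF zrZ])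
      from solution_along_segment[OF zb zZ S[OF zb] S[OF zZ] this]
      have "nrm Q (S zr - q) = 0" unfolding q_def k_def .
      from frechet_deriv_null[OF F[OF q] Q.diff_mem[OF SQ[OF zrZ] q] this]
      have J: "J (S zr) = J q" by simp
      have "reduced_cost T \<Omega> \<kappa> \<xi> J S zbar \<le> reduced_cost T \<Omega> \<kappa> \<xi> J S zr"
        using min zr by (simp add: is_minimizer_def)
      moreover have "(nrm Z zr)\<^sup>2 = (nrm Z zbar)\<^sup>2 + 2 * r * ?b zbar h + r\<^sup>2 * ?b h h"
        unfolding zr_def Z.nrm_square[OF Z.add_mem[OF zb Z.scale_mem[OF h]]] Z.nrm_square[OF zb]
          Z.square_add[OF zb Z.scale_mem[OF h]] Z.scale_right[OF h zb]
          Z.scale_right[OF h Z.scale_mem[OF h]] Z.scale_left[OF h h]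
        by (simp add: power2_eq_square)
      ultimately have "0 \<le> J q - J (S zbar) + \<xi> / 2 * (2 * r * ?b zbar h + r\<^sup>2 * ?b h h)"
        by (simp add: reduced_cost_def J algebra_simps)
      also have "\<dots> = r * ((J q - J (S zbar)) / r + \<xi> * ?b zbar h + \<xi> / 2 * r * ?b h h)"
        using r by (simp add: field_simps power2_eq_square)
      finally show "0 \<le> (J (S zbar + r *\<^sub>R k) - J (S zbar)) / r + \<xi> * ?b zbar h + \<xi> / 2 * r * ?b h h"
        using r by (simp add: zero_le_mult_iff q_def)
    qed
    from tendsto_lowerbound[OF lim this]
    show "0 \<le> ?b (pbar + \<xi> *\<^sub>R zbar) (z - zbar)" by (simp add: split[OF zZ] h_def k_def)
  qed

  define q where "q = (- inverse \<xi>) *\<^sub>R pbar"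
  have q: "q \<in> elems Z" unfolding q_def by (rule Z.scale_mem[OF p])
  define best where "best w \<longleftrightarrow> w \<in> Zad \<and> (\<forall>y\<in>Zad. nrm Z (q - w) \<le> nrm Z (q - y))" for w
  have vi: "optimality_condition T \<Omega> \<kappa> \<xi> Zad pbar zbar \<longleftrightarrow> best zbar"
  proof -
    have "q - zbar = (- inverse \<xi>) *\<^sub>R (pbar + \<xi> *\<^sub>R zbar)"
      using \<xi> by (simp add: q_def algebra_simps)
    then have "?b (q - zbar) (z - zbar) = - inverse \<xi> * ?b (pbar + \<xi> *\<^sub>R zbar) (z - zbar)" if "z \<in> Zad" for z
      using that ZadZ zb p by (simp only: Z.scale_left[OF Z.add_mem[OF p Z.scale_mem[OF zb]] Z.diff_mem] subset_iff)
    then have "optimality_condition T \<Omega> \<kappa> \<xi> Zad pbar zbar \<longleftrightarrow> (\<forall>z\<in>Zad. ?b (q - zbar) (z - zbar) \<le> 0)"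
      using \<xi> by (auto simp: optimality_condition_def mult_le_0_iff zero_le_mult_iff)
    then show ?thesis
      using Z.best_approximation_iff[OF Zad(2) ZadZ q zbar] zbar by (simp add: best_def)
  qed
  \<comment> \<open>The projection is a best approximation because one exists, by completeness.\<close>
  have proj: "best (proj_onto Z Zad q)"
  proof -
    have "\<exists>w. best w"
      using Z.best_approximation_exists[OF complete_Z Zad(1,2) _ q] zbar by (auto simp: best_def)
    then show ?thesis unfolding proj_onto_def best_def by (rule someI_ex)
  qed
  have projection: "optimality_condition T \<Omega> \<kappa> \<xi> Zad pbar zbar \<longleftrightarrow> same_in Z zbar (proj_onto Z Zad q)"
  proof
    assume "optimality_condition T \<Omega> \<kappa> \<xi> Zad pbar zbar"
    then have "nrm Z (zbar - proj_onto Z Zad q) = 0"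
      using vi proj by (intro Z.best_approximation_unique[OF Zad(2) ZadZ q]) (auto simp: best_def)
    then show "same_in Z zbar (proj_onto Z Zad q)"
      using zb proj ZadZ by (auto simp: same_in_def best_def)
  next
    assume same: "same_in Z zbar (proj_onto Z Zad q)"
    have pZ: "proj_onto Z Zad q \<in> elems Z" using proj ZadZ by (auto simp: best_def)
    have "nrm Z (q - zbar) \<le> nrm Z (q - proj_onto Z Zad q)"
      using Z.nrm_triangle[OF q pZ zb] Z.nrm_diff_commute[OF zb pZ] same by (simp add: same_in_def)
    then have "best zbar" using proj zbar by (force simp: best_def)
    then show "optimality_condition T \<Omega> \<kappa> \<xi> Zad pbar zbar" by (simp add: vi)
  qed

  have sufficient: "is_minimizer Zad (reduced_cost T \<Omega> \<kappa> \<xi> J S) zbar"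
    if convex: "convex_on (elems Q) J" and opt: "optimality_condition T \<Omega> \<kappa> \<xi> Zad pbar zbar"
    unfolding is_minimizer_def
  proof (intro conjI ballI zbar)
    fix z assume z: "z \<in> Zad"
    then have zZ: "z \<in> elems Z" using ZadZ by auto
    have h: "z - zbar \<in> elems Z" by (rule Z.diff_mem[OF zZ zb])
    have "?l (S z - S zbar) \<le> J (S z) - J (S zbar)"
      using Q.convex_above_tangent[OF F[OF SQ[OF zb]] SQ[OF zb] Q.diff_mem[OF SQ[OF zZ] SQ[OF zb]] convex] by simp
    moreover have "0 \<le> ?l (S z - S zbar) + \<xi> * ?b zbar (z - zbar)"
      using opt z unfolding optimality_condition_def split[OF zZ, symmetric] by blast
    moreover have "(nrm Z z)\<^sup>2 = (nrm Z zbar)\<^sup>2 + 2 * ?b zbar (z - zbar) + ?b (z - zbar) (z - zbar)"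
      using Z.square_add[OF zb h] by (simp add: Z.nrm_square zb zZ)
    then have "\<xi> / 2 * (nrm Z z)\<^sup>2 - \<xi> / 2 * (nrm Z zbar)\<^sup>2
        = \<xi> * ?b zbar (z - zbar) + \<xi> / 2 * ?b (z - zbar) (z - zbar)"
      by (simp add: algebra_simps)
    moreover have "0 \<le> \<xi> / 2 * ?b (z - zbar) (z - zbar)" using \<xi> Z.nonneg[OF h] by simp
    ultimately show "reduced_cost T \<Omega> \<kappa> \<xi> J S zbar \<le> reduced_cost T \<Omega> \<kappa> \<xi> J S z"
      by (simp add: reduced_cost_def)
  qed

  from necessary projection sufficient show ?thesis unfolding q_def by blast
qed

end
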